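(* For every $A>0$ there is a constant $C_A$ such that for all integers $1\le m\le n$, $$\sum_{Y\in\mathbb{Z}/3^n\mathbb{Z}}\Big|\,p_n(Y)-3^{m-n}\sum_{Y'\in\mathbb{Z}/3^n\mathbb{Z}:\ Y'=Y\bmod 3^m}p_n(Y')\Big|\ \le\ C_A\,m^{-A},$$ where $p_n(Y):=\mathbb{P}(\mathbf{Syrac}(\mathbb{Z}/3^n\mathbb{Z})=Y)$.
   Context: $\mathbf{Syrac}(\mathbb{Z}/3^n\mathbb{Z})$ (the Syracuse random variable) is a random variable on $\mathbb{Z}/3^n\mathbb{Z}$ with the distribution of $F_n(\mathbf{a}_1,\dots,\mathbf{a}_n)\bmod 3^n$, where $\mathbf{a}_1,\dots,\mathbf{a}_n$ are independent with $\mathbb{P}(\mathbf{a}_i=a)=2^{-a}$ for $a=1,2,\dots$, and $$F_n(a_1,\dots,a_n):=\sum_{m=1}^n3^{n-m}2^{-(a_m+a_{m+1}+\dots+a_n)}\in\mathbb{Z}[\tfrac12].$$ Here $x\mapsto x\bmod 3^n$ is the unique ring homomorphism $\mathbb{Z}[\frac12]\to\mathbb{Z}/3^n\mathbb{Z}$. *)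

theory Defs
  imports
    "HOL-Probability.Probability"
    "HOL-Number_Theory.Number_Theory"
begin

text \<open>The ring \<open>\<int>[1/2]\<close>, as a subring of the rationals.\<close>

definition dyadic_ring :: "rat ring"
  where
    "dyadic_ring =
      \<lparr>carrier = {of_int c / 2 ^ k |c k. True},
       monoid.mult = (*),
       one = 1,
       zero = 0,
       add = (+)\<rparr>"

text \<open>
  The unique ring homomorphism \<open>\<int>[1/2] \<rightarrow> \<int>/3\<^sup>n\<int>\<close>. The latter ring is represented by
  \<open>residue_ring (3 ^ n)\<close>, with carrier \<open>{0..3 ^ n - 1}\<close>. Extensionality fixes the values
  outside \<open>\<int>[1/2]\<close>, without which uniqueness could not hold in HOL; see \<open>mod3_ex1\<close> below.
  For \<open>n = 0\<close> the value is junk, because \<open>residue_ring 1\<close> has \<open>1\<close> outside its carrier.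
\<close>

definition mod3 :: "nat \<Rightarrow> rat \<Rightarrow> int"
  where "mod3 n =
    (THE h. h \<in> ring_hom dyadic_ring (residue_ring (3 ^ n)) \<inter> extensional (carrier dyadic_ring))"

definition syrac_offset :: "nat \<Rightarrow> (nat \<Rightarrow> nat) \<Rightarrow> rat"
  where "syrac_offset n a = (\<Sum>m = 1..n. 3 ^ (n - m) * (1 / 2 ^ (\<Sum>i = m..n. a i)))"

text \<open>
  The library's \<open>geometric_pmf\<close> counts failures and so starts at \<open>0\<close>; the shift gives
  \<open>P(a) = 2\<^sup>-\<^sup>a\<close> for \<open>a \<ge> 1\<close>, see \<open>pmf_geom2\<close>.
\<close>

definition geom2_pmf :: "nat pmf"
  where "geom2_pmf = map_pmf Suc (geometric_pmf (1 / 2))"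

text \<open>
  \<open>Pi_pmf\<close> is the law of independent \<open>a 1, \<dots>, a n\<close>; its second argument is the dummy value
  of \<open>a\<close> outside \<open>{1..n}\<close>, on which \<open>syrac_offset n\<close> does not depend.
\<close>

definition syrac_pmf :: "nat \<Rightarrow> int pmf"
  where "syrac_pmf n = map_pmf (\<lambda>a. mod3 n (syrac_offset n a)) (Pi_pmf {1..n} 0 (\<lambda>_. geom2_pmf))"

lemma pmf_geom2: "pmf geom2_pmf a = (if a \<ge> 1 then 1 / 2 ^ a else 0)"
proof (cases a)
  case 0
  then show ?thesis
    by (auto simp: geom2_pmf_def pmf_eq_0_set_pmf)
next
  case (Suc b)
  then show ?thesis
    by (simp add: geom2_pmf_def pmf_map_inj' power_one_over)
qed

lemma dyadic_carrierI: "of_int c / 2 ^ k \<in> carrier dyadic_ring"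
  by (auto simp: dyadic_ring_def)

lemma dyadic_add:
  assumes "x \<in> carrier dyadic_ring" "y \<in> carrier dyadic_ring"
  shows "x \<oplus>\<^bsub>dyadic_ring\<^esub> y \<in> carrier dyadic_ring"
proof -
  obtain c k d l where "x = of_int c / 2 ^ k" "y = of_int d / 2 ^ l"
    using assms by (auto simp: dyadic_ring_def)
  then have "x + y = of_int (c * 2 ^ l + d * 2 ^ k) / 2 ^ (k + l)"
    by (simp add: power_add add_divide_distrib)
  then have "x + y \<in> carrier dyadic_ring" by (simp only: dyadic_carrierI)
  then show ?thesis by (simp add: dyadic_ring_def)
qed

lemma dyadic_mult:
  assumes "x \<in> carrier dyadic_ring" "y \<in> carrier dyadic_ring"
  shows "x \<otimes>\<^bsub>dyadic_ring\<^esub> y \<in> carrier dyadic_ring"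
proof -
  obtain c k d l where "x = of_int c / 2 ^ k" "y = of_int d / 2 ^ l"
    using assms by (auto simp: dyadic_ring_def)
  then have "x * y = of_int (c * d) / 2 ^ (k + l)"
    by (simp add: power_add)
  then have "x * y \<in> carrier dyadic_ring" by (simp only: dyadic_carrierI)
  then show ?thesis by (simp add: dyadic_ring_def)
qed

lemma dyadic_one: "\<one>\<^bsub>dyadic_ring\<^esub> \<in> carrier dyadic_ring"
  using dyadic_carrierI[of 1 0] by (simp add: dyadic_ring_def)

lemma mod3_hom_cong:
  assumes h: "h \<in> ring_hom dyadic_ring (residue_ring (3 ^ n))"
  shows "[h (of_int c / 2 ^ k) * 2 ^ k = c] (mod 3 ^ n)"
proof -
  let ?N = "3 ^ n :: int"
  have int_in: "of_int i \<in> carrier dyadic_ring" for i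
    using dyadic_carrierI[of i 0] by simp
  have add: "[h (x + y) = h x + h y] (mod ?N)"
    if "x \<in> carrier dyadic_ring" "y \<in> carrier dyadic_ring" for x y
    using ring_hom_add[OF h that] by (simp add: dyadic_ring_def residue_ring_def cong_def)
  have mult: "[h (x * y) = h x * h y] (mod ?N)"
    if "x \<in> carrier dyadic_ring" "y \<in> carrier dyadic_ring" for x y
    using ring_hom_mult[OF h that] by (simp add: dyadic_ring_def residue_ring_def cong_def)
  have one: "h 1 = 1"
    using ring_hom_one[OF h] by (simp add: dyadic_ring_def residue_ring_def)
  have step: "[h (of_int (i + 1)) = h (of_int i) + 1] (mod ?N)" for i
    using add[OF int_in[of i] int_in[of 1]] one by simp
  have of_int: "[h (of_int i) = i] (mod ?N)" for i
  proof (induction i rule: int_induct[where k = 1])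
    case base
    show ?case by (simp add: one)
  next
    case (step1 i)
    show ?case
      using cong_trans[OF step[of i] cong_add[OF step1(2) cong_refl]] .
  next
    case (step2 i)
    have "[h (of_int (i - 1)) + 1 = i] (mod ?N)"
      using cong_trans[OF cong_sym[OF step[of "i - 1"]]] step2(2) by simp
    then have "[h (of_int (i - 1)) + 1 - 1 = i - 1] (mod ?N)"
      by (rule cong_diff) simp
    then show ?case by simp
  qed
  have "[h (of_int c / 2 ^ k) * 2 ^ k = h (of_int c / 2 ^ k) * h (of_int (2 ^ k))] (mod ?N)"
    by (rule cong_mult[OF cong_refl cong_sym[OF of_int]])
  also have "[h (of_int c / 2 ^ k) * h (of_int (2 ^ k)) = h (of_int c)] (mod ?N)"
    using cong_sym[OF mult[OF dyadic_carrierI[of c k] int_in[of "2 ^ k"]]] by simp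
  also note of_int[of c]
  finally show ?thesis .
qed

lemma mod3_ex1:
  assumes "n \<ge> 1"
  shows "\<exists>!h. h \<in> ring_hom dyadic_ring (residue_ring (3 ^ n)) \<inter> extensional (carrier dyadic_ring)"
proof (rule ex_ex1I)
  let ?N = "3 ^ n :: int"
  have N: "?N > 1" using assms by simp
  have "coprime (2 :: int) ?N" by simp
  then obtain u :: int where u: "[2 * u = 1] (mod ?N)"
    using cong_solve_coprime_int by blast
  have u2: "[2 ^ k * u ^ k = 1] (mod ?N)" for k
    using cong_pow[OF u, of k] by (simp add: power_mult_distrib)
  define g where "g c k = (c * u ^ k) mod ?N" for c k
  define f :: "rat \<Rightarrow> int"
    where "f x = (SOME r. \<exists>c k. x = of_int c / 2 ^ k \<and> r = g c k)" for x
  have wd: "g c k = g d l" if "of_int c / 2 ^ k = (of_int d / 2 ^ l :: rat)" for c d k l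
  proof -
    have "of_int (c * 2 ^ l) = (of_int (d * 2 ^ k) :: rat)"
      using that by (simp add: field_simps)
    then have eq: "c * 2 ^ l = d * 2 ^ k"
      by (simp only: of_int_eq_iff)
    have "[c * u ^ k * 1 = c * u ^ k * (2 ^ l * u ^ l)] (mod ?N)"
      by (rule cong_mult[OF cong_refl cong_sym[OF u2]])
    also have "c * u ^ k * (2 ^ l * u ^ l) = (c * 2 ^ l) * u ^ k * u ^ l"
      by (simp add: algebra_simps)
    also have "\<dots> = d * u ^ l * (2 ^ k * u ^ k)"
      unfolding eq by (simp add: algebra_simps)
    also have "[d * u ^ l * (2 ^ k * u ^ k) = d * u ^ l * 1] (mod ?N)"
      by (rule cong_mult[OF cong_refl u2])
    finally show ?thesis by (simp add: g_def cong_def)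
  qed
  have f: "f (of_int c / 2 ^ k) = g c k" for c k
  proof -
    have "\<exists>d l. of_int c / 2 ^ k = (of_int d / 2 ^ l :: rat) \<and> f (of_int c / 2 ^ k) = g d l"
      unfolding f_def by (rule someI_ex) blast
    then show ?thesis using wd by metis
  qed
  have gmult: "g (c * d) (k + l) = (g c k * g d l) mod ?N" for c d k l
    by (simp add: g_def power_add algebra_simps mod_mult_eq)
  have gadd: "g (c * 2 ^ l + d * 2 ^ k) (k + l) = (g c k + g d l) mod ?N" for c d k l
  proof -
    have "[c * u ^ k * (2 ^ l * u ^ l) + d * u ^ l * (2 ^ k * u ^ k)
        = c * u ^ k * 1 + d * u ^ l * 1] (mod ?N)"
      by (intro cong_add cong_mult cong_refl u2)
    then show ?thesis
      by (simp add: g_def cong_def power_add algebra_simps mod_add_eq)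
  qed
  have "f \<in> ring_hom dyadic_ring (residue_ring ?N)"
  proof (rule ring_hom_memI)
    fix x assume "x \<in> carrier dyadic_ring"
    then obtain c k where "x = of_int c / 2 ^ k" by (auto simp: dyadic_ring_def)
    then show "f x \<in> carrier (residue_ring ?N)"
      using N by (simp add: f g_def residue_ring_def)
  next
    fix x y assume "x \<in> carrier dyadic_ring" "y \<in> carrier dyadic_ring"
    then obtain c k d l where xy: "x = of_int c / 2 ^ k" "y = of_int d / 2 ^ l"
      by (auto simp: dyadic_ring_def)
    have m: "x * y = of_int (c * d) / 2 ^ (k + l)"
      by (simp add: xy power_add)
    have a: "x + y = of_int (c * 2 ^ l + d * 2 ^ k) / 2 ^ (k + l)"
      by (simp add: xy power_add field_simps)
    have "f (x * y) = (f x * f y) mod ?N"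
      unfolding m f gmult unfolding xy f ..
    then show "f (x \<otimes>\<^bsub>dyadic_ring\<^esub> y) = f x \<otimes>\<^bsub>residue_ring ?N\<^esub> f y"
      by (simp add: dyadic_ring_def residue_ring_def)
    have "f (x + y) = (f x + f y) mod ?N"
      unfolding a f gadd unfolding xy f ..
    then show "f (x \<oplus>\<^bsub>dyadic_ring\<^esub> y) = f x \<oplus>\<^bsub>residue_ring ?N\<^esub> f y"
      by (simp add: dyadic_ring_def residue_ring_def)
  next
    show "f \<one>\<^bsub>dyadic_ring\<^esub> = \<one>\<^bsub>residue_ring ?N\<^esub>"
      using f[of 1 0] N by (simp add: dyadic_ring_def residue_ring_def g_def)
  qed
  then have "restrict f (carrier dyadic_ring) \<in> ring_hom dyadic_ring (residue_ring ?N)"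
    using dyadic_add dyadic_mult dyadic_one by (simp add: ring_hom_def Pi_def)
  then have "restrict f (carrier dyadic_ring)
      \<in> ring_hom dyadic_ring (residue_ring ?N) \<inter> extensional (carrier dyadic_ring)"
    by simp
  then show "\<exists>h. h \<in> ring_hom dyadic_ring (residue_ring ?N) \<inter> extensional (carrier dyadic_ring)"
    by blast
next
  let ?N = "3 ^ n :: int"
  fix h h'
  assume h: "h \<in> ring_hom dyadic_ring (residue_ring ?N) \<inter> extensional (carrier dyadic_ring)"
    and h': "h' \<in> ring_hom dyadic_ring (residue_ring ?N) \<inter> extensional (carrier dyadic_ring)"
  show "h = h'"
  proof (rule extensionalityI)
    show "h \<in> extensional (carrier dyadic_ring)" "h' \<in> extensional (carrier dyadic_ring)"
      using h h' by auto
    fix x assume x: "x \<in> carrier dyadic_ring"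
    then obtain c k where ck: "x = of_int c / 2 ^ k" by (auto simp: dyadic_ring_def)
    have "[h x * 2 ^ k = h' x * 2 ^ k] (mod ?N)"
      using mod3_hom_cong[of h n c k] mod3_hom_cong[of h' n c k] h h'
      by (auto simp: ck cong_def)
    then have "[h x = h' x] (mod ?N)"
      by (subst (asm) cong_mult_rcancel) auto
    moreover have "h x \<in> carrier (residue_ring ?N)" "h' x \<in> carrier (residue_ring ?N)"
      using ring_hom_closed[OF _ x] h h' by auto
    ultimately show "h x = h' x"
      by (auto simp: residue_ring_def cong_def)
  qed
qed

lemma mod3_in_hom:
  assumes "n \<ge> 1"
  shows "mod3 n \<in> ring_hom dyadic_ring (residue_ring (3 ^ n))"
  using theI'[OF mod3_ex1[OF assms]] by (simp add: mod3_def)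

lemma syrac_offset_in_dyadic: "syrac_offset n a \<in> carrier dyadic_ring"
proof -
  have "(\<Sum>m\<in>M. 3 ^ (n - m) * (1 / 2 ^ (\<Sum>i = m..n. a i))) \<in> carrier dyadic_ring"
    if "finite M" for M
    using that
  proof induction
    case empty
    show ?case using dyadic_carrierI[of 0 0] by simp
  next
    case (insert m M)
    show ?case
      using dyadic_add[OF dyadic_carrierI[of "3 ^ (n - m)" "\<Sum>i = m..n. a i"] insert.IH] insert.hyps
      by (simp add: dyadic_ring_def)
  qed
  then show ?thesis by (simp add: syrac_offset_def)
qed

end

theory Submission
  imports Defs
begin

text \<open>
  A geometric variable is the waiting time for heads of a fair coin, so the Syracuse variable can be
  generated one toss at a time. For its characteristic function \<open>\<Phi>\<^sub>n(\<xi>)\<close> at the frequency \<open>\<xi> / 3\<^sup>n\<close>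
  this reads \<open>\<Phi>\<^sub>n(2 \<xi>) = (e(\<xi> / 3\<^sup>n) \<Phi>\<^sub>n\<^sub>-\<^sub>1(\<xi>) + \<Phi>\<^sub>n(\<xi>)) / 2\<close>. Two tosses produce the factor
  \<open>cos (\<pi> \<zeta> / 3\<^sup>N)\<close> at the current frequency \<open>\<zeta> / 3\<^sup>N\<close>, a gain unless that frequency is close to
  an integer.

  Write the centered representative of a frequency coprime to 3 as \<open>2\<^sup>s\<close> times an odd number.
  If \<open>s\<close> is bounded, some outcome of boundedly many tosses leads to a frequency far from the integers.
  If \<open>s\<close> is large, then after \<open>s\<close> tosses the number \<open>m\<close> of heads is binomial, hence equidistributed
  modulo powers of 2, and the frequencies of the following tosses are close to \<open>3\<^sup>m r / 2\<^sup>i\<close> with \<open>r\<close>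
  odd; as 3 generates a subgroup of index 2 of the units modulo \<open>2\<^sup>i\<close>, few of them are close to integers.
  Since \<open>2\<^sup>s \<le> 3\<^sup>n\<close>, a fixed proportion of the \<open>n\<close> levels is left at that time. So the supremum
  \<open>M(n)\<close> of \<open>|\<Phi>\<^sub>n|\<close> over frequencies coprime to 3 satisfies \<open>M(n) \<le> \<eta> M(n / 200) + C q\<^sup>n\<close> for
  each \<open>\<eta> > 0\<close>, with a fixed \<open>q < 1\<close>, and therefore decays faster than any power of \<open>n\<close>.

  By telescoping, mixing is only needed from scale \<open>3\<^sup>n\<^sup>-\<^sup>1\<close> to \<open>3\<^sup>n\<close>, which involves just the frequencies
  coprime to 3. Cauchy--Schwarz would lose \<open>3\<^sup>n\<^sup>/\<^sup>2\<close>; conditioning first on \<open>h\<close> tosses with \<open>2\<^sup>h\<close>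
  slightly below \<open>3\<^sup>n\<close> reduces the loss to a power of \<open>n\<close>, because words with the same number of heads
  contribute distinct residues.
\<close>

section \<open>Averaging over fair coin tosses\<close>

text \<open>One fair toss, with the state \<open>m\<close> counting heads:
  \<open>avg_pow h f m\<close> is the mean of \<open>f (m + X)\<close> for \<open>X\<close> binomial
  with parameters \<open>h\<close> and 1/2.\<close>

definition avg_step :: "(nat \<Rightarrow> real) \<Rightarrow> nat \<Rightarrow> real" where
  "avg_step f m = (f m + f (Suc m)) / 2"

abbreviation avg_pow :: "nat \<Rightarrow> (nat \<Rightarrow> real) \<Rightarrow> nat \<Rightarrow> real" where
  "avg_pow h \<equiv> avg_step ^^ h"

lemma avg_pow_Suc: "avg_pow (Suc h) f m = (avg_pow h f m + avg_pow h f (Suc m)) / 2"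
  by (simp add: avg_step_def)

lemma avg_pow_add: "avg_pow h (avg_pow k f) = avg_pow (h + k) f"
  by (simp add: funpow_add)

lemma avg_pow_2:
  "avg_pow (Suc (Suc h)) f m
     = (avg_pow h f m + 2 * avg_pow h f (Suc m) + avg_pow h f (Suc (Suc m))) / 4"
  by (simp add: avg_step_def field_simps)

lemma avg_pow_mono: "(\<And>m. f m \<le> g m) \<Longrightarrow> avg_pow h f m \<le> avg_pow h g m"
proof (induction h arbitrary: m)
  case (Suc h)
  have "avg_pow h f m \<le> avg_pow h g m" "avg_pow h f (Suc m) \<le> avg_pow h g (Suc m)"
    using Suc by auto
  then show ?case unfolding avg_pow_Suc by simp
qed simp

lemma avg_pow_const: "avg_pow h (\<lambda>_. c) m = c"
  by (induction h arbitrary: m) (simp_all add: avg_step_def)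

lemma avg_pow_plus: "avg_pow h (\<lambda>m. f m + g m) m = avg_pow h f m + avg_pow h g m"
  by (induction h arbitrary: m) (simp_all add: avg_step_def field_simps)

lemma avg_pow_scale: "avg_pow h (\<lambda>m. c * f m) m = c * avg_pow h f m"
  by (induction h arbitrary: m) (simp_all add: avg_step_def field_simps)

lemma avg_pow_sum: "avg_pow h (\<lambda>m. \<Sum>k\<in>I. f k m) m = (\<Sum>k\<in>I. avg_pow h (f k) m)"
  by (induction h arbitrary: m)
    (simp_all add: avg_step_def sum.distrib[symmetric] sum_divide_distrib)

lemma avg_pow_nonneg: "(\<And>m. 0 \<le> f m) \<Longrightarrow> 0 \<le> avg_pow h f m"
  using avg_pow_mono[of "\<lambda>_. 0" f h m] by (simp add: avg_pow_const)

lemma avg_pow_power: "avg_pow h (\<lambda>m. c ^ m) m = ((1 + c) / 2) ^ h * c ^ m"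
  by (induction h arbitrary: m) (simp_all add: avg_step_def field_simps)

lemma avg_pow_abs_le: "(\<And>m. \<bar>f m\<bar> \<le> B) \<Longrightarrow> \<bar>avg_pow h f m\<bar> \<le> B"
  using avg_pow_mono[of f "\<lambda>_. B" h m] avg_pow_mono[of "\<lambda>_. - B" f h m]
  by (simp add: avg_pow_const abs_le_iff minus_le_iff)

lemma avg_pow_binomial:
  "avg_pow h f m = (\<Sum>i\<le>h. real (h choose i) * f (m + i)) / 2 ^ h"
proof (induction h arbitrary: m)
  case (Suc h)
  have 1: "(\<Sum>i\<le>Suc h. real (Suc h choose i) * f (m + i))
      = f m + (\<Sum>i\<le>h. real (h choose i) * f (m + Suc i))
        + (\<Sum>i\<le>h. real (h choose Suc i) * f (m + Suc i))"
    by (subst sum.atMost_Suc_shift) (simp add: distrib_right sum.distrib)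
  have 2: "f m + (\<Sum>i\<le>h. real (h choose Suc i) * f (m + Suc i))
      = (\<Sum>i\<le>h. real (h choose i) * f (m + i))"
    using sum.atMost_Suc_shift[of "\<lambda>i. real (h choose i) * f (m + i)" h] by (simp add: binomial_eq_0)
  have "(\<Sum>i\<le>Suc h. real (Suc h choose i) * f (m + i))
      = (\<Sum>i\<le>h. real (h choose i) * f (m + i)) + (\<Sum>i\<le>h. real (h choose i) * f (Suc m + i))"
    using 1 2 by simp
  then show ?case unfolding avg_pow_Suc Suc.IH by (simp add: field_simps)
qed simp

section \<open>Equidistribution of binomial variables modulo a fixed period\<close>

lemma sum_period_shift:
  fixes f :: "nat \<Rightarrow> real"
  assumes "\<And>i. f (i + d) = f i"
  shows "(\<Sum>i<d. f (m + i)) = (\<Sum>i<d. f i)"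
proof (induction m)
  case (Suc m)
  have "(\<Sum>i<d. f (Suc m + i)) + f m = (\<Sum>i<Suc d. f (m + i))"
    by (subst sum.lessThan_Suc_shift) simp
  also have "\<dots> = (\<Sum>i<d. f (m + i)) + f m"
    using assms[of m] by simp
  finally show ?case using Suc by simp
qed simp

text \<open>
  Every residue class modulo \<open>d\<close> has mass at least \<open>2\<^sup>-\<^sup>d\<close> after \<open>d\<close> steps (Doeblin's condition).
\<close>

lemma avg_pow_contraction:
  assumes per: "\<And>i. f (i + d) = f i" and sum0: "(\<Sum>i<d. f i) = 0"
    and bd: "\<And>i. \<bar>f i\<bar> \<le> B"
  shows "\<bar>avg_pow d f m\<bar> \<le> (1 - d / 2 ^ d) * B"
proof -
  have s0: "(\<Sum>i<d. f (m + i)) = 0"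
    using sum_period_shift[of f d, OF per] sum0 by simp
  have ch: "(\<Sum>i<d. real (d choose i)) = 2 ^ d - 1"
  proof -
    have "(\<Sum>i\<le>d. real (d choose i)) = 2 ^ d"
      using choose_row_sum[of d] by (metis of_nat_numeral of_nat_power of_nat_sum)
    then show ?thesis by (simp flip: lessThan_Suc_atMost)
  qed
  \<comment> \<open>The sum over a full period vanishes, so one unit can be taken off each
    coefficient with \<open>i < d\<close>. The remaining weights are nonnegative with total
    \<open>2 ^ d - d\<close>.\<close>
  have "(\<Sum>i\<le>d. real (d choose i) * f (m + i))
      = (\<Sum>i<d. real (d choose i) * f (m + i)) - (\<Sum>i<d. f (m + i)) + f (m + d)"
    using s0 by (simp flip: lessThan_Suc_atMost)
  also have "\<dots> = (\<Sum>i<d. (real (d choose i) - 1) * f (m + i)) + f (m + d)"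
    by (simp add: sum_subtractf left_diff_distrib)
  also have "\<bar>\<dots>\<bar> \<le> (\<Sum>i<d. \<bar>(real (d choose i) - 1) * f (m + i)\<bar>) + B"
    by (rule order_trans[OF abs_triangle_ineq add_mono[OF sum_abs bd]])
  also have "(\<Sum>i<d. \<bar>(real (d choose i) - 1) * f (m + i)\<bar>) \<le> (\<Sum>i<d. (real (d choose i) - 1) * B)"
  proof (rule sum_mono)
    fix i assume "i \<in> {..<d}"
    then have "1 \<le> real (d choose i)"
      by (metis less_imp_le lessThan_iff Suc_leI One_nat_def of_nat_1 of_nat_le_iff zero_less_binomial)
    then show "\<bar>(real (d choose i) - 1) * f (m + i)\<bar> \<le> (real (d choose i) - 1) * B"
      using bd[of "m + i"] by (simp add: abs_mult mult_left_mono)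
  qed
  also have "(\<Sum>i<d. (real (d choose i) - 1) * B) = (2 ^ d - 1 - real d) * B"
    unfolding sum_distrib_right[symmetric] sum_subtractf ch by simp
  finally have "\<bar>\<Sum>i\<le>d. real (d choose i) * f (m + i)\<bar> \<le> (2 ^ d - real d) * B"
    by (simp add: algebra_simps)
  then show ?thesis
    unfolding avg_pow_binomial by (simp add: field_simps)
qed

lemma avg_pow_periodic:
  assumes "\<And>i. f (i + d) = f i"
  shows "avg_pow h f (m + d) = avg_pow h f m"
  by (induction h arbitrary: m) (simp_all add: assms avg_step_def, metis add_Suc)

lemma avg_pow_sum_period:
  assumes "\<And>i. f (i + d) = f i"
  shows "(\<Sum>i<d. avg_pow h f i) = (\<Sum>i<d. f i)"
proof (induction h)
  case (Suc h)
  have "(\<Sum>i<d. avg_pow h f (Suc i)) = (\<Sum>i<d. avg_pow h f i)"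
    using sum_period_shift[of "avg_pow h f" d 1] avg_pow_periodic[of f d h, OF assms] by simp
  then show ?case
    using Suc unfolding avg_pow_Suc by (simp add: sum_divide_distrib[symmetric] sum.distrib)
qed simp

lemma avg_pow_contraction_iter:
  assumes per: "\<And>i. f (i + d) = f i" and sum0: "(\<Sum>i<d. f i) = 0"
    and bd: "\<And>i. \<bar>f i\<bar> \<le> B"
  shows "\<bar>avg_pow (t * d) f m\<bar> \<le> (1 - d / 2 ^ d) ^ t * B"
proof (induction t arbitrary: m)
  case 0
  then show ?case using bd by simp
next
  case (Suc t)
  have "\<bar>avg_pow d (avg_pow (t * d) f) m\<bar> \<le> (1 - d / 2 ^ d) * ((1 - d / 2 ^ d) ^ t * B)"
    using avg_pow_periodic[of f d "t * d", OF per] avg_pow_sum_period[of f d "t * d", OF per] sum0 Suc.IH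
    by (intro avg_pow_contraction) auto
  then show ?case by (simp add: avg_pow_add mult.assoc)
qed

text \<open>Subtracting the mean over a period leaves a function that the iterated contraction makes
  small; further tosses only average it. The threshold depends on \<open>d\<close> and \<delta>
  alone, which later makes it uniform in the frequency.\<close>

lemma avg_pow_equidistribution:
  fixes d :: nat and \<delta> :: real
  assumes "d > 0" "\<delta> > 0"
  shows "\<exists>h0. \<forall>h\<ge>h0. \<forall>f m. (\<forall>i. f (i + d) = f i) \<longrightarrow> (\<forall>i. 0 \<le> f i \<and> f i \<le> 1) \<longrightarrow>
           avg_pow h f m \<le> (\<Sum>i<d. f i) / d + \<delta>"
proof -
  have "real d < 2 ^ d" using of_nat_less_two_power[of d] by simp
  then have lt1: "\<bar>1 - d / 2 ^ d :: real\<bar> < 1" using assms(1) by (simp add: field_simps)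
  have "(\<lambda>t. (1 - d / 2 ^ d :: real) ^ t) \<longlonglongrightarrow> 0"
    using LIMSEQ_power_zero[of "1 - d / 2 ^ d :: real"] lt1 by simp
  then obtain t where t: "(1 - d / 2 ^ d :: real) ^ t < \<delta>"
    by (metis (no_types, lifting) assms(2) eventually_sequentially le_refl order_tendstoD(2))
  show ?thesis
  proof (intro exI[of _ "t * d"] allI impI)
    fix h f m
    assume h: "t * d \<le> h" and per: "\<forall>i. f (i + d) = f i" and f01: "\<forall>i. 0 \<le> f i \<and> f i \<le> (1::real)"
    define a where "a = (\<Sum>i<d. f i) / d"
    have a01: "0 \<le> a" "a \<le> 1"
      using f01 assms(1) sum_mono[of "{..<d}" f "\<lambda>_. 1"]
      by (auto simp: a_def sum_nonneg divide_le_eq)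
    define g where "g i = f i - a" for i
    have "\<bar>avg_pow (t * d) g i\<bar> \<le> (1 - d / 2 ^ d) ^ t * 1" for i
    proof (rule avg_pow_contraction_iter)
      show "(\<Sum>i<d. g i) = 0" using assms(1) by (simp add: g_def a_def sum_subtractf)
      show "\<bar>g i\<bar> \<le> 1" for i using f01[rule_format, of i] a01 by (auto simp: g_def)
    qed (use per in \<open>simp add: g_def\<close>)
    then have "\<bar>avg_pow (t * d) g i\<bar> \<le> \<delta>" for i
      using order.trans[OF _ less_imp_le[OF t]] by simp
    then have "\<bar>avg_pow (h - t * d) (avg_pow (t * d) g) m\<bar> \<le> \<delta>"
      by (rule avg_pow_abs_le)
    then have "avg_pow h g m \<le> \<delta>" using h by (simp add: avg_pow_add)
    moreover have "avg_pow h f m = avg_pow h g m + a"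
      using avg_pow_plus[of h g "\<lambda>_. a" m] by (simp add: g_def avg_pow_const)
    ultimately show "avg_pow h f m \<le> (\<Sum>i<d. f i) / d + \<delta>" by (simp add: a_def)
  qed
qed

text \<open>The case without any gain: two tosses per level then merely average, so the value at
  level 0 is at most the mean of the bound at level \<open>K\<close>. It settles the case in which
  no black block is tolerated any more.\<close>

lemma avg_pow_trivial_gain_bound:
  fixes T g :: "nat \<Rightarrow> nat \<Rightarrow> real" and \<mu> :: real
  assumes "\<And>k m. 0 \<le> T k m"
    and "\<And>k m. T k m \<le> (T (Suc k) m + 2 * g k m * T (Suc k) (Suc m) + T (Suc k) (Suc (Suc m))) / 4"
    and "\<And>k m. g k m \<le> 1"
    and "\<And>m. T K m \<le> \<mu> + tail m"
  shows "T 0 m \<le> \<mu> + avg_pow (2 * K) tail m"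
  using assms
proof (induction K arbitrary: T g m)
  case 0
  then show ?case by simp
next
  case (Suc K)
  have IH: "T 1 m \<le> \<mu> + avg_pow (2 * K) tail m" for m
    using Suc.IH[of "\<lambda>k. T (Suc k)" "\<lambda>k. g (Suc k)" m] Suc.prems by simp
  have "g 0 m * T 1 (Suc m) \<le> 1 * T 1 (Suc m)"
    by (intro mult_right_mono Suc.prems)
  then have "T 0 m \<le> (T 1 m + 2 * T 1 (Suc m) + T 1 (Suc (Suc m))) / 4"
    using Suc.prems(2)[of 0 m] by simp
  also have "\<dots> \<le> \<mu> + avg_pow (2 * Suc K) tail m"
    using IH[of m] IH[of "Suc m"] IH[of "Suc (Suc m)"] avg_pow_2[of "2 * K" tail m] by simp
  finally show ?case .
qed

text \<open>
  The parameter \<open>r\<close> is the number of black blocks (those with \<open>b \<ge> 1\<close>, where no gain is available)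
  that are still tolerated; meeting more than \<open>q\<close> of them is charged to Markov's inequality.
\<close>

lemma avg_pow_gain_bound:
  fixes T g b :: "nat \<Rightarrow> nat \<Rightarrow> real" and \<gamma> \<mu> :: real and q r :: nat
  assumes T0: "\<And>k m. 0 \<le> T k m"
    and step: "\<And>k m. T k m \<le> (T (Suc k) m + 2 * g k m * T (Suc k) (Suc m) + T (Suc k) (Suc (Suc m))) / 4"
    and g01: "\<And>k m. g k m \<le> 1"
    and gain: "\<And>k m. g k m \<le> \<gamma> \<or> 1 \<le> b k m"
    and b0: "\<And>k m. 0 \<le> b k m"
    and fin: "\<And>m. T K m \<le> \<mu> + tail m"
    and tail0: "\<And>m. 0 \<le> tail m"
    and \<gamma>: "0 < \<gamma>" "\<gamma> < 1" and \<mu>: "0 \<le> \<mu>" and r: "r \<le> q"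
  shows "T 0 m \<le> \<mu> * (((1 + \<gamma>) / 2) ^ K / \<gamma> ^ r
            + (\<Sum>k<K. avg_pow (2 * k) (b k) m) / q + 1 - r / q) + avg_pow (2 * K) tail m"
  using T0 step g01 gain b0 fin r
proof (induction K arbitrary: T g b r m)
  case 0
  have "r / q \<le> (1::real)" using 0(7) by (cases "q = 0") auto
  moreover have "1 \<le> 1 / \<gamma> ^ r" using \<gamma> by (simp add: power_le_one)
  ultimately have "1 \<le> 1 / \<gamma> ^ r + 1 - r / q" by linarith
  then have "\<mu> * 1 \<le> \<mu> * (1 / \<gamma> ^ r + 1 - r / q)"
    using \<mu> by (intro mult_left_mono)
  then show ?case using 0(6)[of m] by simp
next
  case (Suc K)
  define \<rho> where "\<rho> = (1 + \<gamma>) / 2"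
  have \<rho>: "\<gamma> \<le> \<rho>" "0 < \<rho>" "\<rho> < 1" using \<gamma> by (auto simp: \<rho>_def)
  define B where "B m = (\<Sum>k<K. avg_pow (2 * k) (b (Suc k)) m) / q" for m
  define V where "V m = avg_pow (2 * K) tail m" for m
  have V0: "0 \<le> V m" for m using tail0 by (simp add: V_def avg_pow_nonneg)
  have B0: "0 \<le> B m" for m using Suc.prems(5) by (simp add: B_def avg_pow_nonneg sum_nonneg)
  define W where "W m = \<mu> * B m + V m" for m
  have W0: "0 \<le> W m" for m using V0 B0 \<mu> by (simp add: W_def)
  have IH: "T 1 m \<le> \<mu> * (\<rho> ^ K / \<gamma> ^ r + (1 - r / q)) + W m" if "r \<le> q" for m r
  proof -
    have "T (Suc 0) m \<le> \<mu> * (((1 + \<gamma>) / 2) ^ K / \<gamma> ^ r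
            + (\<Sum>k<K. avg_pow (2 * k) (b (Suc k)) m) / q + 1 - r / q) + avg_pow (2 * K) tail m"
      using Suc.prems(1-6) that
      by (intro Suc.IH[of "\<lambda>k. T (Suc k)" "\<lambda>k. g (Suc k)" "\<lambda>k. b (Suc k)" r m]) blast+
    then show ?thesis
      by (simp add: \<rho>_def B_def W_def V_def algebra_simps)
  qed
  have rq: "0 \<le> 1 - r / q" using Suc.prems(7) by (cases "q = 0") auto
  have sumB: "(\<Sum>k<Suc K. avg_pow (2 * k) (b k) m) / q
      = b 0 m / q + (B m + 2 * B (Suc m) + B (Suc (Suc m))) / 4"
  proof -
    have e: "avg_pow (2 * Suc k) f m
        = (avg_pow (2 * k) f m + 2 * avg_pow (2 * k) f (Suc m) + avg_pow (2 * k) f (Suc (Suc m))) / 4"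
      for k f
      using avg_pow_2[of "2 * k" f m] by simp
    have "(\<Sum>k<K. avg_pow (2 * Suc k) (b (Suc k)) m)
        = ((\<Sum>k<K. avg_pow (2 * k) (b (Suc k)) m) + 2 * (\<Sum>k<K. avg_pow (2 * k) (b (Suc k)) (Suc m))
            + (\<Sum>k<K. avg_pow (2 * k) (b (Suc k)) (Suc (Suc m)))) / 4"
      by (simp only: e sum.distrib sum_distrib_left[symmetric] sum_divide_distrib[symmetric])
    then have "(\<Sum>k<Suc K. avg_pow (2 * k) (b k) m) = b 0 m
        + ((\<Sum>k<K. avg_pow (2 * k) (b (Suc k)) m) + 2 * (\<Sum>k<K. avg_pow (2 * k) (b (Suc k)) (Suc m))
            + (\<Sum>k<K. avg_pow (2 * k) (b (Suc k)) (Suc (Suc m)))) / 4"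
      by (subst sum.lessThan_Suc_shift) simp
    then show ?thesis
      unfolding B_def by (simp only: add_divide_distrib times_divide_eq_right divide_divide_eq_left mult.commute)
  qed
  have tailV: "avg_pow (2 * Suc K) tail m = (V m + 2 * V (Suc m) + V (Suc (Suc m))) / 4"
    using avg_pow_2[of "2 * K" tail m] by (simp add: V_def)
  have goal: "\<mu> * (\<rho> ^ Suc K / \<gamma> ^ r + b 0 m / q + (1 - r / q))
        + (W m + 2 * W (Suc m) + W (Suc (Suc m))) / 4
      = \<mu> * (\<rho> ^ Suc K / \<gamma> ^ r + (\<Sum>k<Suc K. avg_pow (2 * k) (b k) m) / q + 1 - r / q)
        + avg_pow (2 * Suc K) tail m"
    unfolding sumB tailV by (simp add: W_def algebra_simps add_divide_distrib)
  have st: "T 0 m \<le> (T 1 m + 2 * (g 0 m * T 1 (Suc m)) + T 1 (Suc (Suc m))) / 4"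
    using Suc.prems(2)[of 0 m] by simp
  have "T 0 m \<le> \<mu> * (\<rho> ^ Suc K / \<gamma> ^ r + b 0 m / q + (1 - r / q))
        + (W m + 2 * W (Suc m) + W (Suc (Suc m))) / 4"
  proof (cases "g 0 m \<le> \<gamma>")
    case True
    \<comment> \<open>The middle outcome, of weight 1/2, gains the factor \<gamma>, so the
      \<open>A\<close> part shrinks by \<rho>; the \<open>W\<close> part is simply averaged.\<close>
    define A where "A = \<mu> * (\<rho> ^ K / \<gamma> ^ r + (1 - r / q))"
    have T1: "T 1 m \<le> A + W m" for m using IH[OF Suc.prems(7)] by (simp add: A_def)
    have "g 0 m * T 1 (Suc m) \<le> \<gamma> * T 1 (Suc m)"
      using True Suc.prems(1) by (intro mult_right_mono) auto
    also have "\<dots> \<le> \<gamma> * (A + W (Suc m))" using T1 \<gamma> by (intro mult_left_mono) auto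
    also have "\<dots> \<le> \<gamma> * A + W (Suc m)" using W0[of "Suc m"] \<gamma>
      by (simp add: distrib_left mult_le_cancel_right1 mult_left_le_one_le)
    finally have "T 0 m \<le> \<rho> * A + (W m + 2 * W (Suc m) + W (Suc (Suc m))) / 4"
      using st T1[of m] T1[of "Suc (Suc m)"] by (simp add: \<rho>_def field_simps)
    moreover have "\<rho> * A \<le> \<mu> * (\<rho> ^ Suc K / \<gamma> ^ r + b 0 m / q + (1 - r / q))"
    proof -
      have "\<rho> * A = \<mu> * (\<rho> ^ Suc K / \<gamma> ^ r + \<rho> * (1 - r / q))"
        by (simp add: A_def algebra_simps)
      also have "\<dots> \<le> \<mu> * (\<rho> ^ Suc K / \<gamma> ^ r + b 0 m / q + (1 - r / q))"
      proof (intro mult_left_mono \<mu>)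
        have "\<rho> * (1 - r / q) \<le> 1 - r / q" using rq \<rho> by (intro mult_left_le_one_le) auto
        moreover have "0 \<le> b 0 m / q" using Suc.prems(5) by simp
        ultimately show "\<rho> ^ Suc K / \<gamma> ^ r + \<rho> * (1 - r / q)
            \<le> \<rho> ^ Suc K / \<gamma> ^ r + b 0 m / q + (1 - r / q)" by linarith
      qed
      finally show ?thesis .
    qed
    ultimately show ?thesis by linarith
  next
    case False
    then have b1: "1 \<le> b 0 m" using Suc.prems(4) by blast
    show ?thesis
    proof (cases r)
      case 0
      \<comment> \<open>With \<open>r = 0\<close> the term \<open>1 - r / q\<close> is 1, so the
        bound without gain suffices.\<close>
      have "T 0 m \<le> \<mu> + avg_pow (2 * Suc K) tail m"
        by (rule avg_pow_trivial_gain_bound[where g = g]) (use Suc.prems in auto)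
      also have "\<dots> \<le> \<mu> * (\<rho> ^ Suc K / \<gamma> ^ r + b 0 m / q + (1 - r / q))
          + (W m + 2 * W (Suc m) + W (Suc (Suc m))) / 4"
      proof (rule add_mono)
        have "\<mu> * 1 \<le> \<mu> * (\<rho> ^ Suc K / \<gamma> ^ r + b 0 m / q + (1 - r / q))"
          using 0 b1 \<rho> \<mu> by (intro mult_left_mono) (auto intro!: add_nonneg_nonneg)
        then show "\<mu> \<le> \<mu> * (\<rho> ^ Suc K / \<gamma> ^ r + b 0 m / q + (1 - r / q))" by simp
        have "V m \<le> W m" for m using B0 \<mu> by (simp add: W_def)
        then show "avg_pow (2 * Suc K) tail m \<le> (W m + 2 * W (Suc m) + W (Suc (Suc m))) / 4"
          unfolding tailV by (intro divide_right_mono add_mono mult_left_mono) auto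
      qed
      finally show ?thesis .
    next
      case (Suc r')
      \<comment> \<open>A tolerated black block uses up one unit of \<open>r\<close>. One power of
        \<gamma> is traded for one of \<rho>, which is larger, and the increase of
        \<open>1 - r / q\<close> by \<open>1 / q\<close> is paid by
        \<open>b 0 m / q\<close>.\<close>
      define A where "A = \<mu> * (\<rho> ^ K / \<gamma> ^ r' + (1 - r' / q))"
      have T1: "T 1 m \<le> A + W m" for m using IH[of r'] Suc.prems(7) Suc by (simp add: A_def)
      have "g 0 m * T 1 (Suc m) \<le> 1 * T 1 (Suc m)"
        using Suc.prems by (intro mult_right_mono) auto
      then have "T 0 m \<le> A + (W m + 2 * W (Suc m) + W (Suc (Suc m))) / 4"
        using st T1[of m] T1[of "Suc m"] T1[of "Suc (Suc m)"] by (simp add: field_simps)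
      moreover have "A \<le> \<mu> * (\<rho> ^ Suc K / \<gamma> ^ r + b 0 m / q + (1 - r / q))"
        unfolding A_def
      proof (intro mult_left_mono \<mu>)
        have "\<rho> ^ K / \<gamma> ^ r' = \<rho> ^ K * \<gamma> / \<gamma> ^ r" using \<gamma> Suc by simp
        also have "\<dots> \<le> \<rho> ^ Suc K / \<gamma> ^ r"
          using \<rho> \<gamma> by (intro divide_right_mono) (auto simp: mult.commute intro: mult_right_mono)
        finally have 1: "\<rho> ^ K / \<gamma> ^ r' \<le> \<rho> ^ Suc K / \<gamma> ^ r" .
        have "q > 0" using Suc.prems(7) Suc by simp
        then have "1 - r' / q \<le> b 0 m / q + (1 - r / q)"
          using b1 Suc by (simp add: field_simps)
        with 1 show "\<rho> ^ K / \<gamma> ^ r' + (1 - r' / q) \<le> \<rho> ^ Suc K / \<gamma> ^ r + b 0 m / q + (1 - r / q)"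
          by linarith
      qed
      ultimately show ?thesis by linarith
    qed
  qed
  then show ?case unfolding goal unfolding \<rho>_def .
qed

section \<open>The Syracuse distribution\<close>

text \<open>The inverse of 2 modulo \<open>3 ^ n\<close>, as an integer; division by powers of 2
  becomes multiplication by its powers.\<close>

definition half_mod :: "nat \<Rightarrow> int" where
  "half_mod n = (3 ^ n + 1) div 2"

lemma two_half_mod: "2 * half_mod n = 3 ^ n + 1"
  unfolding half_mod_def by (rule dvd_mult_div_cancel) simp

lemma cong_two_half_mod: "[2 * half_mod n = 1] (mod 3 ^ n)"
  by (simp add: two_half_mod cong_def)

lemma cong_half_mod_Suc: "[half_mod (Suc n) = half_mod n] (mod 3 ^ n)"
proof -
  have "half_mod (Suc n) = half_mod n + 3 ^ n"
    using two_half_mod[of n] two_half_mod[of "Suc n"] by simp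
  then show ?thesis by (simp add: cong_def)
qed

lemma cong_pow3_mult3:
  fixes x y :: int
  shows "[x = y] (mod 3 ^ n) \<Longrightarrow> [3 * x = 3 * y] (mod 3 ^ Suc n)"
  unfolding cong_def power_Suc mod_mult_mult1 by simp

text \<open>Also true for \<open>n = 0\<close>, where \<open>mod3 0\<close> is junk but the modulus
  is 1.\<close>

lemma mod3_cong: "[mod3 n (of_int c / 2 ^ k) * 2 ^ k = c] (mod 3 ^ n)"
proof (cases n)
  case (Suc n')
  show ?thesis by (rule mod3_hom_cong, rule mod3_in_hom) (use Suc in simp)
qed (simp add: cong_def)

lemma mod3_bounds:
  assumes "n \<ge> 1" "x \<in> carrier dyadic_ring"
  shows "mod3 n x \<in> {0..<3 ^ n}"
  using ring_hom_closed[OF mod3_in_hom[OF assms(1)] assms(2)] by (auto simp: residue_ring_def)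

lemma syrac_offset_Suc:
  "syrac_offset (Suc n) a = (1 + 3 * syrac_offset n a) / 2 ^ a (Suc n)"
proof -
  have "syrac_offset (Suc n) a
      = (\<Sum>m = 1..n. 3 ^ (Suc n - m) * (1 / 2 ^ (\<Sum>i = m..Suc n. a i))) + 1 / 2 ^ a (Suc n)"
    by (simp add: syrac_offset_def)
  also have "(\<Sum>m = 1..n. 3 ^ (Suc n - m) * (1 / 2 ^ (\<Sum>i = m..Suc n. a i)) :: rat)
      = (\<Sum>m = 1..n. 3 * (3 ^ (n - m) * (1 / 2 ^ (\<Sum>i = m..n. a i))) / 2 ^ a (Suc n))"
    by (intro sum.cong refl) (simp add: Suc_diff_le power_add)
  also have "\<dots> = 3 * syrac_offset n a / 2 ^ a (Suc n)"
    by (simp add: syrac_offset_def sum_distrib_left sum_divide_distrib)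
  finally show ?thesis by (simp add: add_divide_distrib)
qed

text \<open>By \<open>syrac_offset_Suc\<close> the old offset enters with a factor 3, so its residue
  modulo \<open>3 ^ n\<close> determines the new one modulo \<open>3 ^ Suc n\<close>.\<close>

lemma mod3_syrac_offset_Suc:
  "mod3 (Suc n) (syrac_offset (Suc n) a)
     = (half_mod (Suc n) ^ a (Suc n) * (1 + 3 * mod3 n (syrac_offset n a))) mod 3 ^ Suc n"
proof -
  let ?N = "3 ^ Suc n :: int"
  define b where "b = a (Suc n)"
  obtain c k where ck: "syrac_offset n a = of_int c / 2 ^ k"
    using syrac_offset_in_dyadic[of n a] by (auto simp: dyadic_ring_def)
  define z where "z = mod3 n (syrac_offset n a)"
  define y where "y = mod3 (Suc n) (syrac_offset (Suc n) a)"
  have "syrac_offset (Suc n) a = of_int (2 ^ k + 3 * c) / 2 ^ (k + b)"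
    unfolding syrac_offset_Suc ck b_def by (simp add: power_add field_simps)
  then have y: "[y * 2 ^ (k + b) = 2 ^ k + 3 * c] (mod ?N)"
    unfolding y_def by (simp only: mod3_cong)
  have "[z * 2 ^ k = c] (mod 3 ^ n)" unfolding z_def ck by (rule mod3_cong)
  then have z: "[3 * (z * 2 ^ k) = 3 * c] (mod ?N)" by (rule cong_pow3_mult3)
  have "half_mod (Suc n) ^ b * (1 + 3 * z) * 2 ^ (k + b)
      = (2 * half_mod (Suc n)) ^ b * (2 ^ k + 3 * (z * 2 ^ k))"
    by (simp add: power_add power_mult_distrib algebra_simps)
  also have "[(2 * half_mod (Suc n)) ^ b * (2 ^ k + 3 * (z * 2 ^ k)) = 1 ^ b * (2 ^ k + 3 * c)] (mod ?N)"
    by (intro cong_mult cong_pow cong_add cong_refl z cong_two_half_mod)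
  also have "1 ^ b * (2 ^ k + 3 * c) = 2 ^ k + 3 * c" by simp
  also have "[2 ^ k + 3 * c = y * 2 ^ (k + b)] (mod ?N)" by (rule cong_sym[OF y])
  finally have "[half_mod (Suc n) ^ b * (1 + 3 * z) * 2 ^ (k + b) = y * 2 ^ (k + b)] (mod ?N)" .
  then have "[half_mod (Suc n) ^ b * (1 + 3 * z) = y] (mod ?N)"
    by (subst (asm) cong_mult_rcancel) auto
  moreover have "y \<in> {0..<?N}"
    unfolding y_def by (intro mod3_bounds syrac_offset_in_dyadic) simp
  ultimately show ?thesis
    by (simp add: cong_def y_def z_def b_def)
qed

lemma syrac_offset_cong:
  assumes "\<And>i. i \<in> {1..n} \<Longrightarrow> a i = b i"
  shows "syrac_offset n a = syrac_offset n b"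
  unfolding syrac_offset_def using assms by (intro sum.cong) auto

lemma syrac_pmf_Suc:
  "syrac_pmf (Suc n) = map_pmf (\<lambda>(a, y). (half_mod (Suc n) ^ a * (1 + 3 * y)) mod 3 ^ Suc n)
     (pair_pmf geom2_pmf (syrac_pmf n))"
proof -
  have ins: "{1..Suc n} = insert (Suc n) {1..n}" by auto
  have off: "syrac_offset n (f(Suc n := y)) = syrac_offset n f" for f y
    by (rule syrac_offset_cong) auto
  have "syrac_pmf (Suc n) = map_pmf (\<lambda>(y, f). mod3 (Suc n) (syrac_offset (Suc n) (f(Suc n := y))))
      (pair_pmf geom2_pmf (Pi_pmf {1..n} 0 (\<lambda>_. geom2_pmf)))"
    unfolding syrac_pmf_def ins
    by (subst Pi_pmf_insert) (auto simp: pmf.map_comp o_def case_prod_unfold)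
  also have "\<dots> = map_pmf (\<lambda>(a, y). (half_mod (Suc n) ^ a * (1 + 3 * y)) mod 3 ^ Suc n)
     (pair_pmf geom2_pmf (syrac_pmf n))"
    unfolding mod3_syrac_offset_Suc off
    by (simp add: syrac_pmf_def pair_map_pmf2 pmf.map_comp o_def case_prod_unfold)
  finally show ?thesis .
qed

section \<open>The Syracuse law one toss at a time\<close>

lemma geom2_pmf_unfold:
  "geom2_pmf = bernoulli_pmf (1 / 2) \<bind> (\<lambda>b. if b then return_pmf 1 else map_pmf Suc geom2_pmf)"
  unfolding geom2_pmf_def
  by (subst geometric_bind_pmf_unfold)
    (auto simp: map_bind_pmf intro!: bind_pmf_cong)

text \<open>Doubling cancels one factor of \<open>half_mod (Suc n) ^ a\<close>. If the first toss is
  heads, then \<open>a = 1\<close> and no factor is left; if it is tails, the waiting time minus one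
  has the original law.\<close>

lemma syrac_pmf_double:
  "map_pmf (\<lambda>x. (2 * x) mod 3 ^ Suc n) (syrac_pmf (Suc n))
     = bernoulli_pmf (1 / 2) \<bind> (\<lambda>b. if b then map_pmf (\<lambda>y. (1 + 3 * y) mod 3 ^ Suc n) (syrac_pmf n)
         else syrac_pmf (Suc n))"
proof -
  let ?N = "3 ^ Suc n :: int"
  define v where "v = half_mod (Suc n)"
  have v: "(2 * ((v ^ Suc a * x) mod ?N)) mod ?N = (v ^ a * x) mod ?N" for a and x :: int
  proof -
    have "[2 * (v ^ Suc a * x) = 1 * (v ^ a * x)] (mod ?N)"
      using cong_mult[OF cong_two_half_mod[of "Suc n"] cong_refl[of "v ^ a * x"]]
      by (simp add: v_def ac_simps)
    then show ?thesis by (simp only: cong_def mod_mult_right_eq mult_1)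
  qed
  define F where "F a = map_pmf (\<lambda>y. (2 * ((v ^ a * (1 + 3 * y)) mod ?N)) mod ?N) (syrac_pmf n)" for a
  have F: "F (Suc a) = map_pmf (\<lambda>y. (v ^ a * (1 + 3 * y)) mod ?N) (syrac_pmf n)" for a
    unfolding F_def v ..
  have S: "syrac_pmf (Suc n) = geom2_pmf \<bind> (\<lambda>a. map_pmf (\<lambda>y. (v ^ a * (1 + 3 * y)) mod ?N) (syrac_pmf n))"
    unfolding syrac_pmf_Suc v_def pair_pmf_def
    by (simp add: map_bind_pmf map_pmf_def bind_assoc_pmf bind_return_pmf)
  have "map_pmf (\<lambda>x. (2 * x) mod ?N) (syrac_pmf (Suc n)) = geom2_pmf \<bind> F"
    unfolding S F_def by (simp add: map_bind_pmf pmf.map_comp o_def)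
  also have "\<dots> = bernoulli_pmf (1 / 2) \<bind> (\<lambda>b. if b then F 1 else geom2_pmf \<bind> (\<lambda>a. F (Suc a)))"
    by (subst geom2_pmf_unfold)
      (auto simp: bind_assoc_pmf bind_return_pmf bind_map_pmf intro!: bind_pmf_cong)
  also have "geom2_pmf \<bind> (\<lambda>a. F (Suc a)) = syrac_pmf (Suc n)"
    unfolding F S ..
  also have "F 1 = map_pmf (\<lambda>y. (1 + 3 * y) mod ?N) (syrac_pmf n)"
    using F[of 0] by simp
  finally show ?thesis .
qed

text \<open>By induction: modulo \<open>3 ^ Suc n\<close> the recursions for two consecutive scales
  coincide, and both see their input only modulo \<open>3 ^ n\<close>. The right-hand side is
  reduced as well for the sake of \<open>n = 0\<close>.\<close>

lemma syrac_pmf_project: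
  "map_pmf (\<lambda>y. y mod 3 ^ n) (syrac_pmf (Suc n)) = map_pmf (\<lambda>y. y mod 3 ^ n) (syrac_pmf n)"
proof (induction n)
  case 0
  show ?case by simp
next
  case (Suc n)
  let ?N = "3 ^ Suc n :: int"
  define v where "v = half_mod (Suc n)"
  have v: "[half_mod (Suc (Suc n)) = v] (mod ?N)"
    unfolding v_def by (rule cong_half_mod_Suc)
  have 1: "(half_mod (Suc (Suc n)) ^ a * (1 + 3 * y)) mod 3 ^ Suc (Suc n) mod ?N
      = (v ^ a * (1 + 3 * (y mod 3 ^ n))) mod ?N" for a and y :: int
  proof -
    have "[3 * y = 3 * (y mod 3 ^ n)] (mod ?N)"
      by (rule cong_pow3_mult3) simp
    then have "[half_mod (Suc (Suc n)) ^ a * (1 + 3 * y) = v ^ a * (1 + 3 * (y mod 3 ^ n))] (mod ?N)"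
      by (rule cong_mult[OF cong_pow[OF v] cong_add[OF cong_refl]])
    moreover have "x mod 3 ^ Suc (Suc n) mod ?N = x mod ?N" for x :: int
      by (rule mod_mod_cancel) (simp add: le_imp_power_dvd)
    ultimately show ?thesis by (simp add: cong_def)
  qed
  define G where "G = (\<lambda>(a, y). (v ^ a * (1 + 3 * y)) mod ?N)"
  have "map_pmf (\<lambda>y. y mod ?N) (syrac_pmf (Suc (Suc n)))
      = map_pmf G (pair_pmf geom2_pmf (map_pmf (\<lambda>y. y mod 3 ^ n) (syrac_pmf (Suc n))))"
    unfolding syrac_pmf_Suc[of "Suc n"] pair_map_pmf2 pmf.map_comp G_def
    by (intro map_pmf_cong refl) (auto simp: 1 simp del: power_Suc)
  also have "\<dots> = map_pmf G (pair_pmf geom2_pmf (map_pmf (\<lambda>y. y mod 3 ^ n) (syrac_pmf n)))"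
    unfolding Suc.IH ..
  also have "\<dots> = map_pmf (\<lambda>y. y mod ?N) (syrac_pmf (Suc n))"
  proof -
    have "(v ^ a * (1 + 3 * (y mod 3 ^ n))) mod ?N = (v ^ a * (1 + 3 * y)) mod ?N mod ?N" for a and y :: int
    proof -
      have "[3 * y = 3 * (y mod 3 ^ n)] (mod ?N)"
        by (rule cong_pow3_mult3) simp
      then have "[v ^ a * (1 + 3 * y) = v ^ a * (1 + 3 * (y mod 3 ^ n))] (mod ?N)"
        by (rule cong_mult[OF cong_refl cong_add[OF cong_refl]])
      then show ?thesis by (simp add: cong_def)
    qed
    then show ?thesis
      unfolding syrac_pmf_Suc[of n] pair_map_pmf2 pmf.map_comp G_def v_def[symmetric]
      by (intro map_pmf_cong refl) (auto simp del: power_Suc)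
  qed
  finally show ?case .
qed

lemma finite_set_syrac_pmf [simp]: "finite (set_pmf (syrac_pmf n))"
proof (cases n)
  case 0
  then show ?thesis by (simp add: syrac_pmf_def)
next
  case (Suc n')
  have "set_pmf (syrac_pmf (Suc n')) \<subseteq> {0..<3 ^ Suc n'}"
    unfolding syrac_pmf_Suc by auto
  then show ?thesis using Suc finite_subset by blast
qed

lemma set_syrac_pmf: "n \<ge> 1 \<Longrightarrow> set_pmf (syrac_pmf n) \<subseteq> {0..<3 ^ n}"
  by (cases n) (auto simp: syrac_pmf_Suc)

section \<open>Expectations of functions of the residue\<close>

definition syrac_exp :: "nat \<Rightarrow> (int \<Rightarrow> 'a) \<Rightarrow> 'a::{banach, second_countable_topology}" where
  "syrac_exp n f = measure_pmf.expectation (syrac_pmf n) f"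

text \<open>Functions on the residues modulo \<open>3 ^ n\<close>, kept as functions on the integers
  so that affine substitutions need no choice of representatives.\<close>

definition periodic_mod :: "nat \<Rightarrow> (int \<Rightarrow> 'a) \<Rightarrow> bool" where
  "periodic_mod n f \<longleftrightarrow> (\<forall>x y. [x = y] (mod 3 ^ n) \<longrightarrow> f x = f y)"

lemma periodic_modD: "periodic_mod n f \<Longrightarrow> [x = y] (mod 3 ^ n) \<Longrightarrow> f x = f y"
  by (auto simp: periodic_mod_def)

lemma periodic_mod_mod: "periodic_mod n f \<Longrightarrow> f (x mod 3 ^ n) = f x"
  by (auto simp: periodic_mod_def)

lemma syrac_exp_sum: "syrac_exp n f = (\<Sum>x\<in>set_pmf (syrac_pmf n). pmf (syrac_pmf n) x *\<^sub>R f x)"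
  unfolding syrac_exp_def by (subst integral_measure_pmf[where A = "set_pmf (syrac_pmf n)"]) auto

lemma syrac_exp_sum_residues:
  assumes "n \<ge> 1"
  shows "syrac_exp n f = (\<Sum>x\<in>{0..<3 ^ n}. pmf (syrac_pmf n) x *\<^sub>R f x)"
  unfolding syrac_exp_def
  by (rule integral_measure_pmf) (use set_syrac_pmf[OF assms] in auto)

lemma syrac_exp_const [simp]: "syrac_exp n (\<lambda>_. c) = c"
  by (simp add: syrac_exp_def)

lemma syrac_exp_add: "syrac_exp n (\<lambda>x. f x + g x) = syrac_exp n f + syrac_exp n g"
  by (simp add: syrac_exp_sum scaleR_add_right sum.distrib)

lemma syrac_exp_cmult: "syrac_exp n (\<lambda>x. c * f x) = c * (syrac_exp n f :: 'a::{real_normed_algebra, banach, second_countable_topology})"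
  by (simp add: syrac_exp_sum sum_distrib_left)

lemma syrac_exp_swap_sum: "syrac_exp n (\<lambda>x. \<Sum>i\<in>I. f i x) = (\<Sum>i\<in>I. syrac_exp n (f i))"
  by (simp add: syrac_exp_sum scaleR_sum_right sum.swap[of _ I])

lemma norm_syrac_exp_le:
  assumes "\<And>x. norm (f x) \<le> B"
  shows "norm (syrac_exp n f) \<le> B"
proof -
  have "norm (syrac_exp n f) \<le> syrac_exp n (\<lambda>x. norm (f x))"
    unfolding syrac_exp_def by (rule integral_norm_bound)
  also have "\<dots> \<le> syrac_exp n (\<lambda>_. B)"
    unfolding syrac_exp_sum using assms by (intro sum_mono) (auto intro: mult_left_mono)
  finally show ?thesis by simp
qed

text \<open>At \<open>n = 0\<close> truncated subtraction keeps the level at 0, and the identity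
  persists because \<open>f\<close> is constant. So tosses may go on after the levels are
  exhausted.\<close>

lemma syrac_exp_double:
  assumes f: "periodic_mod n f"
  shows "syrac_exp n (\<lambda>x. f (2 * x)) = (1 / 2) *\<^sub>R (syrac_exp (n - 1) (\<lambda>x. f (1 + 3 * x)) + syrac_exp n f)"
proof (cases n)
  case 0
  then have "f x = f 0" for x using periodic_modD[OF f, of x 0] by (simp add: cong_def)
  then obtain c where "f = (\<lambda>_. c)" by blast
  then show ?thesis by (simp add: scaleR_half_double)
next
  case (Suc n')
  have "syrac_exp n (\<lambda>x. f (2 * x)) = measure_pmf.expectation (map_pmf (\<lambda>x. (2 * x) mod 3 ^ n) (syrac_pmf n)) f"
    unfolding syrac_exp_def integral_map_pmf periodic_mod_mod[OF f] ..
  also have "\<dots> = (\<Sum>b\<in>UNIV. pmf (bernoulli_pmf (1 / 2)) b *\<^sub>R measure_pmf.expectation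
      (if b then map_pmf (\<lambda>y. (1 + 3 * y) mod 3 ^ n) (syrac_pmf n') else syrac_pmf n) f)"
    unfolding Suc syrac_pmf_double by (intro pmf_expectation_bind) auto
  also have "\<dots> = (1 / 2) *\<^sub>R (syrac_exp n' (\<lambda>x. f (1 + 3 * x)) + syrac_exp n f)"
    unfolding UNIV_bool syrac_exp_def
    by (simp add: integral_map_pmf periodic_mod_mod[OF f] scaleR_add_right)
  finally show ?thesis using Suc by simp
qed

lemma syrac_exp_project:
  assumes f: "periodic_mod n f"
  shows "syrac_exp (Suc n) f = syrac_exp n f"
proof -
  have "syrac_exp m f = measure_pmf.expectation (map_pmf (\<lambda>y. y mod 3 ^ n) (syrac_pmf m)) f" for m
    unfolding syrac_exp_def integral_map_pmf periodic_mod_mod[OF f] ..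
  then show ?thesis by (simp only: syrac_pmf_project)
qed

section \<open>Arithmetic and analytic preliminaries\<close>

text \<open>For \<open>i \<ge> 2\<close> the order of 3 modulo \<open>2 ^ (2 * i)\<close> is exactly
  a quarter of the modulus, half the number of units; modulo 4 it is enough that it is
  positive.\<close>

lemma ord_four_pow_3:
  assumes "i \<ge> 1"
  shows "ord (4 ^ i) (3 :: nat) > 0" "4 ^ i \<le> 4 * ord (4 ^ i) (3 :: nat)"
proof -
  have "ord (4 ^ i) (3 :: nat) \<ge> 4 ^ i div 4"
  proof (cases "i = 1")
    case False
    then have "ord (2 ^ (2 * i)) (3 :: nat) = 2 ^ (2 * i - 2)"
      using assms by (intro ord_twopow_3_5) auto
    also have "2 ^ (2 * i - 2) = (2 ^ (2 * i) div 4 :: nat)"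
      using assms power_diff[of "2::nat" 2 "2 * i"] by simp
    finally show ?thesis by (simp add: power_mult)
  qed simp
  moreover have "(4 :: nat) dvd 4 ^ i" using assms by (metis dvd_power zero_less_one order_less_le_trans)
  ultimately show "4 ^ i \<le> 4 * ord (4 ^ i) (3 :: nat)" by auto
  then show "ord (4 ^ i) (3 :: nat) > 0" by (rule_tac gr0I) simp
qed

text \<open>The event that \<open>3 ^ m * r / 4 ^ i\<close> is within \<epsilon> of an integer, in
  which the cosine may give no gain. The base is 4 because gains come once per pair of
  tosses.\<close>

definition near_multiple :: "real \<Rightarrow> nat \<Rightarrow> int \<Rightarrow> nat \<Rightarrow> bool" where
  "near_multiple \<epsilon> i r m \<longleftrightarrow> (\<exists>u::int. \<bar>real_of_int (3 ^ m * r - u * 4 ^ i)\<bar> < \<epsilon> * 4 ^ i)"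

lemma near_multiple_periodic:
  "near_multiple \<epsilon> i r (m + ord (4 ^ i) (3 :: nat)) \<longleftrightarrow> near_multiple \<epsilon> i r m"
proof -
  let ?d = "ord (4 ^ i) (3 :: nat)"
  have "[(3 :: nat) ^ ?d = 1] (mod 4 ^ i)" by (rule ord)
  then have "[(3 :: int) ^ ?d = 1] (mod 4 ^ i)"
    by (metis cong_int_iff of_nat_1 of_nat_numeral of_nat_power)
  then have "[3 ^ m * r * 3 ^ ?d = 3 ^ m * r * 1] (mod 4 ^ i)"
    by (rule cong_mult[OF cong_refl])
  then obtain w where w: "3 ^ (m + ?d) * r = 3 ^ m * r + w * 4 ^ i"
    by (auto simp: cong_iff_dvd_diff dvd_def power_add algebra_simps)
  have 1: "3 ^ (m + ?d) * r - u * 4 ^ i = 3 ^ m * r - (u - w) * 4 ^ i" for u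
    unfolding w by (simp add: algebra_simps)
  have 2: "3 ^ m * r - u * 4 ^ i = 3 ^ (m + ?d) * r - (u + w) * 4 ^ i" for u
    unfolding w by (simp add: algebra_simps)
  show ?thesis
    unfolding near_multiple_def by (intro iffI; elim exE) (simp only: 1, blast, simp only: 2, blast)
qed

text \<open>Sending \<open>m\<close> to the residual \<open>3 ^ m * r - u * 4 ^ i\<close> is
  injective: below the order, powers of 3 are distinct modulo \<open>4 ^ i\<close>, and
  \<open>r\<close> is a unit. The residuals are nonzero, being odd, and smaller than
  \<open>\<epsilon> * 4 ^ i\<close> in absolute value.\<close>

lemma card_near_multiple:
  fixes r :: int
  assumes "i \<ge> 1" "odd r" "\<epsilon> > 0"
  shows "real (card {m. m < ord (4 ^ i) (3 :: nat) \<and> near_multiple \<epsilon> i r m}) \<le> 2 * \<epsilon> * 4 ^ i"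
proof -
  let ?S = "{m. m < ord (4 ^ i) (3 :: nat) \<and> near_multiple \<epsilon> i r m}"
  define x where "x = \<epsilon> * 4 ^ i"
  have x0: "x > 0" using assms by (simp add: x_def)
  obtain u where u: "\<And>m. m \<in> ?S \<Longrightarrow> \<bar>real_of_int (3 ^ m * r - u m * 4 ^ i)\<bar> < x"
    unfolding near_multiple_def x_def[symmetric] by (atomize_elim, intro choice) blast
  define w where "w m = 3 ^ m * r - u m * 4 ^ i" for m
  have odd: "odd (w m)" for m using assms by (simp add: w_def)
  have inj: "inj_on w ?S"
  proof (rule inj_onI)
    fix a b assume ab: "a \<in> ?S" "b \<in> ?S" and "w a = w b"
    then have "3 ^ a * r - 3 ^ b * r = (u a - u b) * 4 ^ i"
      by (simp add: w_def algebra_simps)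
    then have "[3 ^ a * r = 3 ^ b * r] (mod 4 ^ i)"
      by (simp add: cong_iff_dvd_diff)
    moreover have "coprime r (4 ^ i)"
    proof -
      have "coprime r (2 ^ (2 * i))" using assms(2) by simp
      then show ?thesis by (simp add: power_mult)
    qed
    ultimately have "[(3 :: int) ^ a = 3 ^ b] (mod 4 ^ i)"
      by (simp add: cong_mult_rcancel)
    then have "[(3 :: nat) ^ a = 3 ^ b] (mod 4 ^ i)"
      by (metis cong_int_iff of_nat_numeral of_nat_power)
    moreover have "coprime (4 ^ i) (3 :: nat)"
      using ord_four_pow_3(1)[OF assms(1)] by simp
    ultimately show "a = b"
      using inj_power_mod[of "4 ^ i" "3 :: nat"] ab by (auto simp: inj_on_def cong_def)
  qed
  have "w ` ?S \<subseteq> {- \<lfloor>x\<rfloor>..\<lfloor>x\<rfloor>} - {0}"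
  proof
    fix y assume "y \<in> w ` ?S"
    then obtain m where m: "m \<in> ?S" "y = w m" by blast
    have "\<bar>real_of_int y\<bar> < x" using u[OF m(1)] m(2) by (simp only: w_def)
    then have "\<bar>y\<bar> \<le> \<lfloor>x\<rfloor>" by (metis le_floor_iff less_imp_le of_int_abs)
    moreover have "y \<noteq> 0" using odd[of m] m(2) by auto
    ultimately show "y \<in> {- \<lfloor>x\<rfloor>..\<lfloor>x\<rfloor>} - {0}" by auto
  qed
  then have "card (w ` ?S) \<le> card ({- \<lfloor>x\<rfloor>..\<lfloor>x\<rfloor>} - {0})"
    by (intro card_mono) auto
  then have "card ?S \<le> card ({- \<lfloor>x\<rfloor>..\<lfloor>x\<rfloor>} - {0})"
    by (simp only: card_image[OF inj])
  also have "\<dots> = nat (2 * \<lfloor>x\<rfloor>)" using x0 by simp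
  finally have "real (card ?S) \<le> real_of_int (2 * \<lfloor>x\<rfloor>)"
    using x0 by (simp add: le_nat_iff nat_le_iff)
  also have "\<dots> \<le> 2 * x" by simp
  finally show ?thesis by (simp add: x_def)
qed

text \<open>At most \<open>2 * \<epsilon> * 4 ^ i\<close> bad residues in a period of length at
  least \<open>4 ^ i / 4\<close> give the share \<open>8 * \<epsilon>\<close>. The threshold must
  not depend on \<open>r\<close>, which will vary with the frequency.\<close>

lemma avg_pow_near_multiple:
  assumes "i \<ge> 1" "\<epsilon> > 0" "\<delta> > 0"
  shows "\<exists>h0. \<forall>h\<ge>h0. \<forall>r. odd r \<longrightarrow> avg_pow h (\<lambda>m. of_bool (near_multiple \<epsilon> i r m)) 0 \<le> 8 * \<epsilon> + \<delta>"
proof -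
  let ?d = "ord (4 ^ i) (3 :: nat)"
  have d: "?d > 0" "4 ^ i \<le> 4 * ?d" using ord_four_pow_3[OF assms(1)] by auto
  obtain h0 where h0: "\<forall>h\<ge>h0. \<forall>f m. (\<forall>i. f (i + ?d) = f i) \<longrightarrow> (\<forall>i. 0 \<le> f i \<and> f i \<le> 1) \<longrightarrow>
      avg_pow h f m \<le> (\<Sum>i<?d. f i) / ?d + \<delta>"
    using avg_pow_equidistribution[OF d(1) assms(3)] by blast
  show ?thesis
  proof (intro exI[of _ h0] allI impI)
    fix h and r :: int assume "h0 \<le> h" and r: "odd r"
    then have "avg_pow h (\<lambda>m. of_bool (near_multiple \<epsilon> i r m)) 0
        \<le> (\<Sum>m<?d. of_bool (near_multiple \<epsilon> i r m)) / ?d + \<delta>"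
      by (intro h0[rule_format]) (auto simp: near_multiple_periodic)
    also have "(\<Sum>m<?d. of_bool (near_multiple \<epsilon> i r m) :: real)
        = card {m. m < ?d \<and> near_multiple \<epsilon> i r m}"
      by (simp add: lessThan_def Collect_conj_eq[symmetric] Int_def)
    also have "\<dots> / ?d \<le> (2 * \<epsilon> * 4 ^ i) / ?d"
      using card_near_multiple[OF assms(1) r assms(2)] by (intro divide_right_mono) auto
    also have "(2 * \<epsilon> * 4 ^ i) / ?d \<le> 8 * \<epsilon>"
    proof -
      have "real (4 ^ i) \<le> real (4 * ?d)" using d(2) by (rule of_nat_mono)
      then have "2 * \<epsilon> * 4 ^ i \<le> 2 * \<epsilon> * (4 * ?d)"
        using assms(2) by (intro mult_left_mono) auto
      then show ?thesis using d(1) by (simp add: divide_le_eq)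
    qed
    finally show "avg_pow h (\<lambda>m. of_bool (near_multiple \<epsilon> i r m)) 0 \<le> 8 * \<epsilon> + \<delta>" by simp
  qed
qed

section \<open>Elementary estimates for cosines and decaying sequences\<close>

lemma abs_cos_pi_le:
  assumes "0 \<le> \<epsilon>" "\<epsilon> \<le> 1" "\<And>u::int. \<epsilon> \<le> \<bar>t - of_int u\<bar>"
  shows "\<bar>cos (pi * t)\<bar> \<le> cos (pi * \<epsilon>)"
proof -
  define u where "u = round t"
  define s where "s = \<bar>t - of_int u\<bar>"
  have s: "\<epsilon> \<le> s" "s \<le> 1 / 2"
    using assms(3)[of u] of_int_round_abs_le[of t] by (auto simp: s_def u_def abs_minus_commute)
  have "cos (pi * (t - of_int u)) = cos (pi * t) * cos (pi * of_int u)"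
    by (simp add: right_diff_distrib cos_diff mult.commute)
  moreover have "\<bar>cos (pi * of_int u)\<bar> = 1"
    by (simp add: mult.commute)
  ultimately have "\<bar>cos (pi * t)\<bar> = \<bar>cos (pi * (t - of_int u))\<bar>"
    by (simp add: abs_mult)
  also have "cos (pi * (t - of_int u)) = cos \<bar>pi * (t - of_int u)\<bar>"
    by simp
  also have "\<bar>pi * (t - of_int u)\<bar> = pi * s"
    by (simp add: s_def abs_mult)
  also have "\<bar>cos (pi * s)\<bar> = cos (pi * s)"
    using s assms by (intro abs_of_nonneg cos_ge_zero) (auto simp: field_simps intro: order_trans[of _ 0])
  also have "\<dots> \<le> cos (pi * \<epsilon>)"
    using s assms(1) by (intro cos_monotone_0_pi_le) auto
  finally show ?thesis .
qed

lemma bounded_power_times_geometric: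
  fixes q :: real
  assumes "0 < q" "q < 1"
  shows "\<exists>C. \<forall>n. real n ^ A * q ^ n \<le> C"
proof (cases A)
  case 0
  then show ?thesis using assms by (intro exI[of _ 1]) (simp add: power_le_one)
next
  case (Suc A')
  \<comment> \<open>An \<open>A\<close>-th root of \<open>q\<close> reduces the claim to the
    convergence of \<open>n * p ^ n\<close> to 0.\<close>
  define p where "p = root A q"
  have p: "0 < p" "p < 1" using assms Suc by (auto simp: p_def)
  have pA: "p ^ A = q" unfolding p_def using assms Suc by (intro real_root_pow_pos2) auto
  have "(\<lambda>n. real n * p ^ n) \<longlonglongrightarrow> 0"
    using powser_times_n_limit_0[of p] p by simp
  then obtain B where B: "\<And>n. norm (real n * p ^ n) \<le> B"
    using convergent_imp_Bseq convergentI Bseq_def by metis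
  have "real n ^ A * q ^ n \<le> B ^ A" for n
  proof -
    have "(real n * p ^ n) ^ A \<le> B ^ A" using B[of n] p by (intro power_mono) auto
    moreover have "(p ^ n) ^ A = q ^ n" using pA by (metis power_mult mult.commute)
    ultimately show ?thesis by (simp add: power_mult_distrib)
  qed
  then show ?thesis by blast
qed

lemma superpolynomial_decay:
  fixes f :: "nat \<Rightarrow> real" and q :: real and D :: nat
  assumes f01: "\<And>n. 0 \<le> f n" "\<And>n. f n \<le> 1" and q: "0 < q" "q < 1" and D: "D \<ge> 2"
    and rec: "\<And>\<eta>. \<eta> > 0 \<Longrightarrow> \<exists>C. \<forall>n. f n \<le> \<eta> * f (n div D) + C * q ^ n"
  shows "\<exists>C. \<forall>n. f n * real n ^ A \<le> C"
proof -
  \<comment> \<open>Replacing \<open>n \<ge> D\<close> by \<open>n div D\<close> changes the weight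
    \<open>n ^ A\<close> by at most a factor \<open>(2 * D) ^ A\<close>; this \<eta> outweighs that
    with a factor 1/2 to spare, and the other half of \<open>K\<close> covers the geometric
    term.\<close>
  define \<eta> where "\<eta> = 1 / (2 * (2 * real D) ^ A)"
  have \<eta>: "\<eta> > 0" using D by (simp add: \<eta>_def)
  obtain C where C: "\<And>n. f n \<le> \<eta> * f (n div D) + C * q ^ n" using rec[OF \<eta>] by blast
  obtain B where B: "\<And>n. real n ^ A * q ^ n \<le> B" using bounded_power_times_geometric[OF q] by blast
  define K where "K = max (real D ^ A) (2 * (\<bar>C\<bar> * B))"
  have K0: "0 \<le> K" by (simp add: K_def le_max_iff_disj)
  have "f n * real n ^ A \<le> K" for n
  proof (induction n rule: less_induct)
    case (less n)
    show ?case
    proof (cases "n < D")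
      case True
      have "f n * real n ^ A \<le> 1 * real D ^ A"
        using True f01 by (intro mult_mono power_mono) auto
      then show ?thesis by (simp add: K_def)
    next
      case False
      define k where "k = n div D"
      have kn: "k < n" using False D by (simp add: k_def)
      have "n < D * (k + 1)" using D by (simp add: k_def dividend_less_times_div)
      moreover have "k \<ge> 1" using False D by (simp add: k_def div_greater_zero_iff Suc_le_eq)
      ultimately have "n \<le> 2 * D * k"
      proof -
        assume "n < D * (k + 1)" "k \<ge> 1"
        then have "D \<le> D * k" "n < D * k + D" by (simp_all add: add.commute)
        then have "n \<le> 2 * (D * k)" by linarith
        then show ?thesis by (simp only: mult.assoc)
      qed
      then have "real n \<le> 2 * real D * real k" by (metis of_nat_le_iff of_nat_mult of_nat_numeral)
      then have "real n ^ A \<le> (2 * real D) ^ A * real k ^ A"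
        by (metis power_mono power_mult_distrib of_nat_0_le_iff)
      then have "\<eta> * f k * real n ^ A \<le> \<eta> * f k * ((2 * real D) ^ A * real k ^ A)"
        using \<eta> f01 by (intro mult_left_mono) auto
      also have "\<dots> = (f k * real k ^ A) / 2" using D by (simp add: \<eta>_def)
      also have "\<dots> \<le> K / 2" using less.IH[OF kn] by simp
      finally have 1: "\<eta> * f k * real n ^ A \<le> K / 2" .
      have "C * q ^ n * real n ^ A \<le> \<bar>C\<bar> * (real n ^ A * q ^ n)"
        using q by (simp add: mult.assoc mult.commute[of "q ^ n"] mult_right_mono)
      also have "\<dots> \<le> \<bar>C\<bar> * B" using B by (intro mult_left_mono) auto
      also have "\<dots> \<le> K / 2" by (simp add: K_def)
      finally have 2: "C * q ^ n * real n ^ A \<le> K / 2" .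
      have "f n * real n ^ A \<le> (\<eta> * f k + C * q ^ n) * real n ^ A"
        using C[of n] by (intro mult_right_mono) (auto simp: k_def)
      then show ?thesis using 1 2 by (simp add: algebra_simps)
    qed
  qed
  then show ?thesis by blast
qed

text \<open>The mean of \<open>2 ^ m\<close> over the number \<open>m\<close> of heads in
  \<open>s\<close> tosses is \<open>(3 / 2) ^ s\<close>, to be compared with \<open>2 ^ N\<close>.
  The exponent 24/25 is the product of 3/5 and 8/5, which exceed the binary logarithms of 3/2 and 3;
  being below 1, it leaves a proportion of the levels.\<close>

lemma three_halves_pow_le:
  assumes "(2::real) ^ s \<le> 3 ^ N"
  shows "(3 / 2 :: real) ^ s \<le> 2 powr (24 / 25 * N)"
proof -
  have a: "(3 / 2 :: real) \<le> 2 powr (3 / 5)"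
  proof -
    have "(2 powr (3 / 5)) ^ 5 = (2 ^ 3 :: real)" by (simp add: powr_power)
    then have "(3 / 2 :: real) ^ Suc 4 \<le> (2 powr (3 / 5)) ^ Suc 4" by (simp add: power_divide)
    then show ?thesis by (rule power_le_imp_le_base) simp
  qed
  have b: "(3 :: real) \<le> 2 powr (8 / 5)"
  proof -
    have "(2 powr (8 / 5)) ^ 5 = (2 ^ 8 :: real)" by (simp add: powr_power)
    then have "(3 :: real) ^ Suc 4 \<le> (2 powr (8 / 5)) ^ Suc 4" by simp
    then show ?thesis by (rule power_le_imp_le_base) simp
  qed
  have "2 powr real s = 2 ^ s" by (simp add: powr_realpow)
  also have "\<dots> \<le> 3 ^ N" by (rule assms)
  also have "\<dots> \<le> (2 powr (8 / 5)) ^ N" using b by (intro power_mono) auto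
  also have "\<dots> = 2 powr (8 / 5 * N)" by (simp add: powr_power mult.commute)
  finally have s: "real s \<le> 8 / 5 * N" by simp
  have "(3 / 2 :: real) ^ s \<le> (2 powr (3 / 5)) ^ s" using a by (intro power_mono) auto
  also have "\<dots> = 2 powr (3 / 5 * s)" by (simp add: powr_power mult.commute)
  also have "\<dots> \<le> 2 powr (24 / 25 * N)" using s by simp
  finally show ?thesis .
qed

section \<open>The characteristic function\<close>

definition phase :: "nat \<Rightarrow> int \<Rightarrow> complex" where
  "phase n a = cis (2 * pi * (of_int a / 3 ^ n))"

lemma norm_phase [simp]: "norm (phase n a) = 1"
  by (simp add: phase_def)

lemma phase_add: "phase n (a + b) = phase n a * phase n b"
  by (simp add: phase_def cis_mult add_divide_distrib distrib_left)

lemma phase_minus: "phase n (- a) = cnj (phase n a)"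
  by (simp add: phase_def cis_cnj)

lemma phase_diff: "phase n (a - b) = phase n a * cnj (phase n b)"
  using phase_add[of n a "- b"] by (simp add: phase_minus)

lemma phase_mult_pow3: "phase n (3 ^ n * a) = 1"
  by (simp add: phase_def)

lemma phase_cong:
  assumes "[a = b] (mod 3 ^ n)"
  shows "phase n a = phase n b"
proof -
  obtain k where "a = b + 3 ^ n * k"
    using assms by (metis cong_iff_lin cong_sym mult.commute)
  then show ?thesis by (simp add: phase_add phase_mult_pow3)
qed

lemma phase_mult3: "phase n (3 * a) = phase (n - 1) a"
proof (cases n)
  case 0
  then show ?thesis using phase_cong[of "3 * a" a 0] by (simp add: cong_def)
next
  case (Suc n')
  then show ?thesis by (simp add: phase_def)
qed

lemma norm_phase_double_add:
  "norm (phase n (2 * a) + phase n a) = 2 * \<bar>cos (pi * (of_int a / 3 ^ n))\<bar>"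
proof -
  define t where "t = pi * (of_int a / 3 ^ n :: real)"
  have "cis (2 * t) + 1 = cis t * (cis t + cis (- t))"
    by (simp add: distrib_left cis_mult)
  also have "cis t + cis (- t) = of_real (2 * cos t)"
    by (simp add: complex_eq_iff)
  finally have "norm (cis (2 * t) + 1) = 2 * \<bar>cos t\<bar>"
    by (simp add: norm_mult abs_mult del: of_real_mult)
  moreover have "phase n (2 * a) + phase n a = phase n a * (phase n a + 1)"
    using phase_add[of n a a] by (simp add: distrib_left)
  moreover have "phase n a = cis (2 * t)" by (simp add: phase_def t_def mult.assoc)
  ultimately show ?thesis by (simp add: norm_mult t_def)
qed

definition syrac_char :: "nat \<Rightarrow> int \<Rightarrow> complex" where
  "syrac_char n \<xi> = syrac_exp n (\<lambda>y. phase n (\<xi> * y))"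

lemma syrac_char_cong:
  assumes "[\<xi> = \<xi>'] (mod 3 ^ n)"
  shows "syrac_char n \<xi> = syrac_char n \<xi>'"
proof -
  have "phase n (\<xi> * y) = phase n (\<xi>' * y)" for y
    by (rule phase_cong, rule cong_mult[OF assms cong_refl])
  then show ?thesis by (simp add: syrac_char_def)
qed

lemma norm_syrac_char_le_1: "norm (syrac_char n \<xi>) \<le> 1"
  unfolding syrac_char_def by (rule norm_syrac_exp_le) simp

lemma syrac_char_double:
  "syrac_char n (2 * \<xi>) = (phase n \<xi> * syrac_char (n - 1) \<xi> + syrac_char n \<xi>) / 2"
proof -
  have per: "periodic_mod n (\<lambda>y. phase n (\<xi> * y))"
    unfolding periodic_mod_def using phase_cong cong_mult[OF cong_refl] by blast
  have "syrac_char n (2 * \<xi>) = syrac_exp n (\<lambda>y. phase n (\<xi> * (2 * y)))"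
    by (simp add: syrac_char_def ac_simps)
  also have "\<dots> = (1 / 2) *\<^sub>R (syrac_exp (n - 1) (\<lambda>y. phase n (\<xi> * (1 + 3 * y))) + syrac_char n \<xi>)"
    unfolding syrac_char_def using syrac_exp_double[OF per] .
  also have "(\<lambda>y. phase n (\<xi> * (1 + 3 * y))) = (\<lambda>y. phase n \<xi> * phase (n - 1) (\<xi> * y))"
  proof
    fix y
    have "\<xi> * (1 + 3 * y) = \<xi> + 3 * (\<xi> * y)" by (simp add: algebra_simps)
    then show "phase n (\<xi> * (1 + 3 * y)) = phase n \<xi> * phase (n - 1) (\<xi> * y)"
      by (simp only: phase_add phase_mult3)
  qed
  finally show ?thesis
    by (simp add: syrac_char_def syrac_exp_cmult scaleR_conv_of_real)
qed

lemma norm_syrac_char_double_le: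
  "norm (syrac_char n (2 * \<xi>)) \<le> (norm (syrac_char n \<xi>) + norm (syrac_char (n - 1) \<xi>)) / 2"
  using norm_triangle_ineq[of "phase n \<xi> * syrac_char (n - 1) \<xi>" "syrac_char n \<xi>"]
  by (simp add: syrac_char_double norm_divide norm_mult)

text \<open>
  The words heads--tails and tails--heads lead to the same state; the cosine is their interference.
\<close>

lemma norm_syrac_char_quadruple_le:
  "norm (syrac_char n (4 * \<xi>)) \<le> (norm (syrac_char n \<xi>)
     + 2 * \<bar>cos (pi * (of_int \<xi> / 3 ^ n))\<bar> * norm (syrac_char (n - 1) \<xi>)
     + norm (syrac_char (n - 2) \<xi>)) / 4"
proof -
  define a b c where "a = syrac_char n \<xi>" and "b = syrac_char (n - 1) \<xi>" and "c = syrac_char (n - 2) \<xi>"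
  have "syrac_char n (4 * \<xi>) = (phase n (2 * \<xi>) * syrac_char (n - 1) (2 * \<xi>) + syrac_char n (2 * \<xi>)) / 2"
    using syrac_char_double[of n "2 * \<xi>"] by simp
  also have "\<dots> = (a + (phase n (2 * \<xi>) + phase n \<xi>) * b + phase n (2 * \<xi>) * phase (n - 1) \<xi> * c) / 4"
    unfolding syrac_char_double by (simp add: a_def b_def c_def algebra_simps add_divide_distrib numeral_2_eq_2)
  finally have "norm (syrac_char n (4 * \<xi>))
      = norm (a + (phase n (2 * \<xi>) + phase n \<xi>) * b + phase n (2 * \<xi>) * phase (n - 1) \<xi> * c) / 4"
    by (simp only: norm_divide) simp
  also have "\<dots> \<le> (norm a + norm ((phase n (2 * \<xi>) + phase n \<xi>) * b)
      + norm (phase n (2 * \<xi>) * phase (n - 1) \<xi> * c)) / 4"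
    by (intro divide_right_mono order_trans[OF norm_triangle_ineq] add_mono norm_triangle_ineq) auto
  finally show ?thesis
    unfolding a_def b_def c_def by (simp add: norm_mult norm_phase_double_add)
qed

section \<open>The supremum over frequencies coprime to 3\<close>

definition char_sup :: "nat \<Rightarrow> real" where
  "char_sup n = (SUP \<xi>\<in>{\<xi>. \<not> 3 dvd \<xi>}. norm (syrac_char n \<xi>))"

lemma norm_syrac_char_le_sup: "\<not> 3 dvd \<xi> \<Longrightarrow> norm (syrac_char n \<xi>) \<le> char_sup n"
  unfolding char_sup_def
  by (rule cSUP_upper) (auto intro!: bdd_aboveI[of _ 1] norm_syrac_char_le_1)

lemma char_sup_least: "(\<And>\<xi>. \<not> 3 dvd \<xi> \<Longrightarrow> norm (syrac_char n \<xi>) \<le> B) \<Longrightarrow> char_sup n \<le> B"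
  unfolding char_sup_def by (rule cSUP_least) (auto intro!: exI[of _ 1])

lemma char_sup_le_1: "char_sup n \<le> 1"
  by (rule char_sup_least) (rule norm_syrac_char_le_1)

lemma char_sup_nonneg: "0 \<le> char_sup n"
  by (rule order_trans[OF norm_ge_zero norm_syrac_char_le_sup[of 1]]) simp

text \<open>Ensures that the frequencies met when doublings are undone stay in the range of the
  supremum \<open>char_sup\<close>.\<close>

lemma not_3_dvd_half_mod_mult:
  assumes "n \<ge> 1" "\<not> 3 dvd x"
  shows "\<not> 3 dvd half_mod n ^ k * x"
proof -
  have "\<not> 3 dvd half_mod n"
  proof
    assume "3 dvd half_mod n"
    then have "3 dvd 2 * half_mod n" by simp
    then have "3 dvd (3 ^ n + 1 :: int)" by (simp only: two_half_mod)
    moreover have "3 dvd (3 ^ n :: int)" using assms(1) by (simp add: dvd_power)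
    ultimately have "3 dvd (1 :: int)" by (simp only: dvd_add_right_iff)
    then show False by simp
  qed
  moreover have p: "prime (3 :: int)" by simp
  ultimately show ?thesis
    using assms(2) prime_dvd_power[OF p] by (auto simp only: prime_dvd_mult_iff[OF p])
qed

lemma cong_half: "[2 * (half_mod n * x) = x] (mod 3 ^ n)"
  using cong_mult[OF cong_two_half_mod cong_refl, of n x] by (simp add: mult.assoc)

text \<open>Every frequency modulo \<open>3 ^ Suc n\<close> is the double of another, so one toss
  bounds \<open>char_sup (Suc n)\<close> by its mean with \<open>char_sup n\<close>; its own share
  of the mean is then absorbed.\<close>

lemma char_sup_Suc_le: "char_sup (Suc n) \<le> char_sup n"
proof -
  have "char_sup (Suc n) \<le> (char_sup (Suc n) + char_sup n) / 2"
  proof (rule char_sup_least)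
    fix \<xi> :: int assume "\<not> 3 dvd \<xi>"
    define \<zeta> where "\<zeta> = half_mod (Suc n) * \<xi>"
    have \<zeta>: "\<not> 3 dvd \<zeta>"
      using not_3_dvd_half_mod_mult[of "Suc n" \<xi> 1] \<open>\<not> 3 dvd \<xi>\<close> by (simp add: \<zeta>_def)
    have "norm (syrac_char (Suc n) \<xi>) = norm (syrac_char (Suc n) (2 * \<zeta>))"
      using syrac_char_cong[OF cong_half[of "Suc n" \<xi>]] by (simp add: \<zeta>_def)
    also have "\<dots> \<le> (norm (syrac_char (Suc n) \<zeta>) + norm (syrac_char n \<zeta>)) / 2"
      using norm_syrac_char_double_le[of "Suc n" \<zeta>] by simp
    also have "\<dots> \<le> (char_sup (Suc n) + char_sup n) / 2"
      using norm_syrac_char_le_sup[OF \<zeta>] by (intro divide_right_mono add_mono) auto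
    finally show "norm (syrac_char (Suc n) \<xi>) \<le> (char_sup (Suc n) + char_sup n) / 2" .
  qed
  then show ?thesis by simp
qed

lemma char_sup_antimono: "m \<le> n \<Longrightarrow> char_sup n \<le> char_sup m"
  using lift_Suc_antimono_le[of char_sup] char_sup_Suc_le by (simp add: antimono_def)

lemma norm_syrac_char_pow2_avg:
  "norm (syrac_char (N - m) (2 ^ s * x)) \<le> avg_pow s (\<lambda>m. norm (syrac_char (N - m) x)) m"
proof (induction s arbitrary: m)
  case (Suc s)
  have "norm (syrac_char (N - m) (2 ^ Suc s * x)) \<le> (norm (syrac_char (N - m) (2 ^ s * x))
      + norm (syrac_char (N - Suc m) (2 ^ s * x))) / 2"
    using norm_syrac_char_double_le[of "N - m" "2 ^ s * x"] by (simp add: mult.assoc)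
  also have "\<dots> \<le> avg_pow (Suc s) (\<lambda>m. norm (syrac_char (N - m) x)) m"
    unfolding avg_pow_Suc using Suc by (intro divide_right_mono add_mono) auto
  finally show ?case .
qed simp

text \<open>Once the \<open>s\<close> doublings are undone, the frequency is
  \<open>o' / 3 ^ (N - m)\<close> after \<open>m\<close> heads; then come \<open>K\<close> pairs of
  tosses governed by \<open>avg_pow_gain_bound\<close>. Three bad events are charged by their means:
  \<open>near_multiple\<close> (mean at most \<beta>), a contribution of \<open>o'\<close> that is
  too large (\<open>carry\<close>), and a level below \<open>n1\<close>
  (\<open>tail\<close>).\<close>

lemma norm_syrac_char_large_valuation:
  fixes \<epsilon> :: real
  assumes o: "odd o'" "\<not> 3 dvd o'" and small: "2 ^ s * \<bar>o'\<bar> \<le> 3 ^ N"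
    and N: "n1 \<le> N" "1 \<le> N" and \<epsilon>: "0 < \<epsilon>" "\<epsilon> < 1 / 2" and q: "q > 0"
    and near: "\<And>k r. k < K \<Longrightarrow> odd r \<Longrightarrow>
        avg_pow (s + 2 * k) (\<lambda>m. of_bool (near_multiple (2 * \<epsilon>) (Suc k) r m)) 0 \<le> \<beta>"
  defines "\<gamma> \<equiv> cos (pi * \<epsilon>)"
  defines "c \<equiv> sqrt (1 / (2 ^ s * \<epsilon>))"
  shows "norm (syrac_char N (2 ^ s * o')) \<le> char_sup n1 * (((1 + \<gamma>) / 2) ^ K / \<gamma> ^ q
      + K * (c * ((1 + sqrt 3) / 2) ^ (s + 2 * K) + \<beta>) / q) + (3 / 2) ^ (s + 2 * K) / 2 ^ (N - n1)"
proof -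
  have \<gamma>: "0 < \<gamma>" "\<gamma> < 1"
  proof -
    show "0 < \<gamma>" unfolding \<gamma>_def using \<epsilon> by (intro cos_gt_zero_pi) (auto simp: field_simps intro: order_less_trans[of _ 0])
    have "cos (pi * \<epsilon>) < cos 0" using \<epsilon> by (intro cos_monotone_0_pi) auto
    then show "\<gamma> < 1" by (simp add: \<gamma>_def)
  qed
  \<comment> \<open>The frequency reached after \<open>k + 1\<close> pairs, congruent to
    \<open>o' / 4 ^ (k + 1)\<close> modulo \<open>3 ^ N\<close>. Writing
    \<open>4 ^ (k + 1) * z k\<close> as \<open>o' + 3 ^ N * r\<close> turns
    \<open>z k / 3 ^ (N - m)\<close> into \<open>3 ^ m * r / 4 ^ (k + 1)\<close> plus a term that is
    small unless \<open>m\<close> is large.\<close>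
  define z where "z k = half_mod N ^ (2 * Suc k) * o'" for k
  have z3: "\<not> 3 dvd half_mod N ^ k * o'" for k
    using not_3_dvd_half_mod_mult[OF N(2) o(2)] .
  have z_step: "[4 * z k = half_mod N ^ (2 * k) * o'] (mod 3 ^ N)" for k
  proof -
    have "4 * z k = (2 * half_mod N) ^ 2 * (half_mod N ^ (2 * k) * o')"
      by (simp add: z_def power2_eq_square algebra_simps)
    also have "[\<dots> = 1 ^ 2 * (half_mod N ^ (2 * k) * o')] (mod 3 ^ N)"
      by (intro cong_mult cong_pow cong_refl cong_two_half_mod)
    finally show ?thesis by simp
  qed
  have "[4 ^ Suc k * z k = o'] (mod 3 ^ N)" for k
  proof -
    have "4 ^ Suc k * z k = (2 * half_mod N) ^ (2 * Suc k) * o'"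
      by (simp only: z_def power_mult power_mult_distrib) (simp add: power_mult_distrib)
    also have "[\<dots> = 1 ^ (2 * Suc k) * o'] (mod 3 ^ N)"
      by (intro cong_mult cong_pow cong_refl cong_two_half_mod)
    finally show ?thesis by simp
  qed
  then have "\<forall>k. \<exists>r. 4 ^ Suc k * z k = o' + 3 ^ N * r"
    by (metis cong_iff_lin cong_sym)
  then obtain r where r: "\<And>k. 4 ^ Suc k * z k = o' + 3 ^ N * r k" by metis
  have r_odd: "odd (r k)" for k
  proof
    assume "even (r k)"
    then have "odd (o' + 3 ^ N * r k)" using o(1) by simp
    then show False unfolding r[symmetric] by simp
  qed
  define T where "T k m = norm (syrac_char (N - m) (half_mod N ^ (2 * k) * o'))" for k m
  define g where "g k m = \<bar>cos (pi * (of_int (z k) / 3 ^ (N - m)))\<bar>" for k m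
  \<comment> \<open>A large \<open>o'\<close> term forces
    \<open>3 ^ m \<ge> 2 ^ s * \<epsilon>\<close>, hence \<open>carry m \<ge> 1\<close>. The square
    root matters: the mean of \<open>3 ^ m\<close> after \<open>s\<close> tosses is
    \<open>2 ^ s\<close>, which gains nothing, whereas that of \<open>sqrt 3 ^ m\<close> is
    \<open>((1 + sqrt 3) / 2) ^ s\<close>, which grows more slowly than
    \<open>sqrt 2 ^ s\<close>.\<close>
  define carry where "carry m = c * sqrt 3 ^ m" for m
  have c0: "0 \<le> c" using \<epsilon> by (simp add: c_def)
  have carry0: "0 \<le> carry m" for m using c0 by (simp add: carry_def)
  define b where "b k m = carry m + of_bool (near_multiple (2 * \<epsilon>) (Suc k) (r k) m)" for k m
  \<comment> \<open>Below level \<open>n1\<close> only the bound 1 is available; there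
    \<open>2 ^ m\<close> exceeds \<open>2 ^ (N - n1)\<close>.\<close>
  define tail where "tail m = 2 ^ m / (2 ^ (N - n1) :: real)" for m :: nat
  have carry1: "1 \<le> carry m" if "\<epsilon> \<le> 3 ^ m * \<bar>real_of_int o'\<bar> / 3 ^ N" for m
  proof -
    have "real_of_int (2 ^ s * \<bar>o'\<bar>) \<le> real_of_int (3 ^ N)" using small by (simp only: of_int_le_iff)
    then have "\<bar>real_of_int o'\<bar> / 3 ^ N \<le> 1 / 2 ^ s" by (simp add: field_simps)
    then have "3 ^ m * (\<bar>real_of_int o'\<bar> / 3 ^ N) \<le> 3 ^ m * (1 / 2 ^ s)" by (intro mult_left_mono) auto
    then have "\<epsilon> \<le> 3 ^ m / 2 ^ s" using that by simp
    then have "1 \<le> 1 / (2 ^ s * \<epsilon>) * 3 ^ m" using \<epsilon> by (simp add: field_simps)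
    then have "1 \<le> sqrt (1 / (2 ^ s * \<epsilon>) * 3 ^ m)" by simp
    then show ?thesis by (simp only: carry_def c_def real_sqrt_mult real_sqrt_power)
  qed
  have T_avg: "norm (syrac_char N (2 ^ s * o')) \<le> avg_pow s (T 0) 0"
    using norm_syrac_char_pow2_avg[of N 0 s o'] by (simp add: T_def[abs_def])
  \<comment> \<open>With \<open>r = q\<close> tolerated blocks the constant term
    \<open>1 - r / q\<close> disappears.\<close>
  have main: "T 0 m \<le> char_sup n1 * (((1 + \<gamma>) / 2) ^ K / \<gamma> ^ q
      + (\<Sum>k<K. avg_pow (2 * k) (b k) m) / q + 1 - q / q) + avg_pow (2 * K) tail m" for m
  proof (rule avg_pow_gain_bound[where g = g])
    fix k m
    show "T k m \<le> (T (Suc k) m + 2 * g k m * T (Suc k) (Suc m) + T (Suc k) (Suc (Suc m))) / 4"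
    proof -
      have "syrac_char (N - m) (half_mod N ^ (2 * k) * o') = syrac_char (N - m) (4 * z k)"
        by (rule syrac_char_cong, rule cong_sym, rule cong_dvd_modulus[OF z_step])
          (simp add: le_imp_power_dvd)
      then have "T k m = norm (syrac_char (N - m) (4 * z k))" by (simp only: T_def)
      moreover have "T (Suc k) m' = norm (syrac_char (N - m') (z k))" for m'
        by (simp only: T_def z_def)
      moreover have "N - m - 1 = N - Suc m" "N - m - 2 = N - Suc (Suc m)" by simp_all
      ultimately show ?thesis
        using norm_syrac_char_quadruple_le[of "N - m" "z k"] by (simp only: g_def)
    qed
    show "g k m \<le> 1" by (simp add: g_def)
    show "0 \<le> b k m" using carry0 by (simp add: b_def)
    show "g k m \<le> \<gamma> \<or> 1 \<le> b k m"
    proof (rule disjCI)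
      assume nb: "\<not> 1 \<le> b k m"
      then have nn: "\<not> near_multiple (2 * \<epsilon>) (Suc k) (r k) m" and "carry m < 1"
        using carry0[of m] by (cases "near_multiple (2 * \<epsilon>) (Suc k) (r k) m"; simp add: b_def)+
      then have lt: "3 ^ m * \<bar>real_of_int o'\<bar> / 3 ^ N < \<epsilon>" using carry1[of m] by linarith
      \<comment> \<open>The level is a truncated difference, so
        \<open>3 ^ (N - m) = 3 ^ N / 3 ^ m\<close> requires this; an \<open>m\<close> beyond
        \<open>N\<close> would make the \<open>o'\<close> term at least 1.\<close>
      have "m \<le> N"
      proof (rule ccontr)
        assume "\<not> m \<le> N"
        then have "(3::real) ^ N \<le> 3 ^ m" by simp
        moreover have "1 \<le> \<bar>real_of_int o'\<bar>" using o(1) by (cases "o' = 0") auto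
        ultimately have "3 ^ N * 1 \<le> 3 ^ m * \<bar>real_of_int o'\<bar>" by (intro mult_mono) auto
        then have "1 \<le> 3 ^ m * \<bar>real_of_int o'\<bar> / 3 ^ N" by simp
        then show False using lt \<epsilon> by linarith
      qed
      define t where "t = real_of_int (z k) / 3 ^ (N - m)"
      have t_eq: "t * 4 ^ Suc k = 3 ^ m * real_of_int o' / 3 ^ N + real_of_int (3 ^ m * r k)"
      proof -
        have "real_of_int (4 ^ Suc k * z k) = real_of_int (o' + 3 ^ N * r k)" by (simp only: r)
        then have "4 ^ Suc k * real_of_int (z k) = real_of_int o' + 3 ^ N * real_of_int (r k)" by simp
        moreover have "(3::real) ^ (N - m) = 3 ^ N / 3 ^ m" using \<open>m \<le> N\<close> by (simp add: power_diff)
        ultimately show ?thesis unfolding t_def by (simp add: field_simps)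
      qed
      have "\<bar>cos (pi * t)\<bar> \<le> cos (pi * \<epsilon>)"
      proof (rule abs_cos_pi_le)
        fix u :: int
        show "\<epsilon> \<le> \<bar>t - of_int u\<bar>"
        proof (rule ccontr)
          assume "\<not> \<epsilon> \<le> \<bar>t - of_int u\<bar>"
          then have "\<bar>t - of_int u\<bar> * 4 ^ Suc k < \<epsilon> * 4 ^ Suc k" by (intro mult_strict_right_mono) auto
          then have "\<bar>(t - of_int u) * 4 ^ Suc k\<bar> < \<epsilon> * 4 ^ Suc k" by (simp add: abs_mult)
          moreover have "(t - of_int u) * 4 ^ Suc k = 3 ^ m * real_of_int o' / 3 ^ N
              + real_of_int (3 ^ m * r k - u * 4 ^ Suc k)"
            using t_eq by (simp add: left_diff_distrib)
          moreover have "\<bar>3 ^ m * real_of_int o' / 3 ^ N\<bar> < \<epsilon> * 4 ^ Suc k"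
          proof -
            have "\<epsilon> * 1 \<le> \<epsilon> * 4 ^ Suc k" using \<epsilon> one_le_power[of "4::real" "Suc k"] by (intro mult_left_mono) auto
            then show ?thesis using lt by (simp add: abs_mult)
          qed
          ultimately have "\<bar>real_of_int (3 ^ m * r k - u * 4 ^ Suc k)\<bar> < (2 * \<epsilon>) * 4 ^ Suc k"
            by linarith
          then show False using nn unfolding near_multiple_def by blast
        qed
      qed (use \<epsilon> in auto)
      then show "g k m \<le> \<gamma>" by (simp add: g_def t_def \<gamma>_def)
    qed
  next
    fix m
    show "T K m \<le> char_sup n1 + tail m"
    proof (cases "n1 \<le> N - m")
      case True
      then have "T K m \<le> char_sup n1"
        unfolding T_def using norm_syrac_char_le_sup[OF z3] char_sup_antimono order_trans by blast
      then show ?thesis by (simp add: tail_def add_increasing2)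
    next
      case False
      then have "(2::real) ^ (N - n1) \<le> 2 ^ m" by (intro power_increasing) auto
      then have "1 \<le> tail m" by (simp add: tail_def)
      moreover have "T K m \<le> 1" unfolding T_def by (rule norm_syrac_char_le_1)
      ultimately show ?thesis using char_sup_nonneg[of n1] by linarith
    qed
  qed (use \<gamma> char_sup_nonneg in \<open>auto simp: T_def tail_def\<close>)
  define a1 where "a1 = ((1 + \<gamma>) / 2) ^ K / \<gamma> ^ q"
  have "avg_pow s (T 0) 0 \<le> avg_pow s (\<lambda>m. char_sup n1 * (a1 + (1 / q) * (\<Sum>k<K. avg_pow (2 * k) (b k) m))
      + avg_pow (2 * K) tail m) 0"
    using main q by (intro avg_pow_mono) (simp add: a1_def)
  also have "\<dots> = char_sup n1 * (a1 + (1 / q) * (\<Sum>k<K. avg_pow (s + 2 * k) (b k) 0))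
      + avg_pow (s + 2 * K) tail 0"
    by (simp only: avg_pow_plus avg_pow_scale avg_pow_const avg_pow_sum avg_pow_add)
  also have "avg_pow (s + 2 * K) tail 0 = (3 / 2) ^ (s + 2 * K) / 2 ^ (N - n1)"
    using avg_pow_scale[of "s + 2 * K" "1 / 2 ^ (N - n1)" "\<lambda>m. 2 ^ m" 0] avg_pow_power[of "s + 2 * K" 2 0]
    by (simp add: tail_def[abs_def])
  also have "char_sup n1 * (a1 + (1 / q) * (\<Sum>k<K. avg_pow (s + 2 * k) (b k) 0))
      \<le> char_sup n1 * (a1 + (1 / q) * (\<Sum>k<K. c * ((1 + sqrt 3) / 2) ^ (s + 2 * K) + \<beta>))"
  proof (intro mult_left_mono add_left_mono sum_mono char_sup_nonneg)
    fix k assume "k \<in> {..<K}"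
    then have k: "k < K" by simp
    have "avg_pow (s + 2 * k) (b k) 0 = c * ((1 + sqrt 3) / 2) ^ (s + 2 * k)
        + avg_pow (s + 2 * k) (\<lambda>m. of_bool (near_multiple (2 * \<epsilon>) (Suc k) (r k) m)) 0"
      unfolding b_def[abs_def] avg_pow_plus carry_def[abs_def] avg_pow_scale avg_pow_power by simp
    also have "\<dots> \<le> c * ((1 + sqrt 3) / 2) ^ (s + 2 * K) + \<beta>"
      using near[OF k r_odd] c0 k by (intro add_mono mult_left_mono power_increasing) auto
    finally show "avg_pow (s + 2 * k) (b k) 0 \<le> c * ((1 + sqrt 3) / 2) ^ (s + 2 * K) + \<beta>" .
  qed simp
  finally show ?thesis
    using T_avg by (simp add: a1_def)
qed

section \<open>Superpolynomial decay\<close>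

text \<open>Over \<open>4 * q\<close> pairs of tosses the accumulated factor has to outweigh
  \<open>1 / \<gamma> ^ q\<close>, the price of \<open>q\<close> tolerated blocks. With
  \<open>t = 1 - \<gamma>\<close> the left side begins with \<open>1 - 2 * t\<close>, the right side
  is \<open>1 - t\<close>.\<close>

lemma quartic_mean_less:
  fixes \<gamma> :: real
  assumes "1 / 2 \<le> \<gamma>" "\<gamma> < 1"
  shows "((1 + \<gamma>) / 2) ^ 4 < \<gamma>"
proof -
  define t where "t = 1 - \<gamma>"
  have t: "0 < t" "t \<le> 1 / 2" "\<gamma> = 1 - t" using assms by (auto simp: t_def)
  have "t * t \<le> 1 / 2 * t" using t by (intro mult_right_mono) auto
  moreover have "t * t * t \<le> 1 / 4 * t"
  proof -
    have "t * t \<le> 1 / 2 * (1 / 2)" using t by (intro mult_mono) auto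
    then show ?thesis using t(1) by (intro mult_right_mono) auto
  qed
  moreover have "0 \<le> t * t * t" using t by simp
  moreover have "t * (t * t * t) \<le> 1 / 2 * (t * t * t)" using t by (intro mult_right_mono) auto
  moreover have "((1 + \<gamma>) / 2) ^ 4 = 1 - 2 * t + 3 / 2 * (t * t) - 1 / 2 * (t * t * t) + 1 / 16 * (t * (t * t * t))"
    unfolding t(3) by (simp add: power4_eq_xxxx field_simps)
  ultimately show ?thesis using t by linarith
qed

text \<open>The parameters are fixed in the order \<epsilon>, \<gamma>, \<open>q\<close>,
  \<open>K\<close>, \<open>S\<close>. Only the last depends on the number of blocks: it makes both
  the equidistribution in all \<open>K\<close> blocks and the carry estimate effective.\<close>

lemma norm_syrac_char_large_valuation_le:
  assumes "\<eta> > 0"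
  shows "\<exists>S K. \<forall>s\<ge>S. \<forall>N n1 o'. odd o' \<longrightarrow> \<not> 3 dvd o' \<longrightarrow> 2 ^ s * \<bar>o'\<bar> \<le> 3 ^ N \<longrightarrow> n1 \<le> N \<longrightarrow> 1 \<le> N \<longrightarrow>
    norm (syrac_char N (2 ^ s * o')) \<le> \<eta> * char_sup n1 + (3 / 2) ^ (s + 2 * K) / 2 ^ (N - n1)"
proof -
  \<comment> \<open>The cap 1/4 ensures \<open>\<gamma> \<ge> 1 / 2\<close>. A block costs at most
    \<open>18 * \<epsilon>\<close> in the mean (16 for the share of bad residues, 1 for
    equidistribution, 1 for the carry), and \<open>K / q = 4\<close> makes this
    \<open>72 * \<epsilon>\<close>, below \<open>\<eta> / 2\<close>.\<close>
  define \<epsilon> where "\<epsilon> = min (1 / 4) (\<eta> / 200)"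
  have \<epsilon>: "0 < \<epsilon>" "\<epsilon> \<le> 1 / 4" "200 * \<epsilon> \<le> \<eta>" using assms by (auto simp: \<epsilon>_def)
  define \<gamma> where "\<gamma> = cos (pi * \<epsilon>)"
  have "cos (pi / 3) \<le> \<gamma>" unfolding \<gamma>_def using \<epsilon> by (intro cos_monotone_0_pi_le) auto
  then have \<gamma>: "1 / 2 \<le> \<gamma>" by (simp add: cos_60)
  have \<gamma>1: "\<gamma> < 1"
  proof -
    have "cos (pi * \<epsilon>) < cos 0" using \<epsilon> by (intro cos_monotone_0_pi) auto
    then show ?thesis by (simp add: \<gamma>_def)
  qed
  define p where "p = ((1 + \<gamma>) / 2) ^ 4 / \<gamma>"
  have p: "0 \<le> p" "p < 1" using quartic_mean_less[OF \<gamma> \<gamma>1] \<gamma> by (auto simp: p_def)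
  then have "(\<lambda>q. p ^ q) \<longlonglongrightarrow> 0" by (intro LIMSEQ_power_zero) auto
  then have "eventually (\<lambda>q. p ^ q < \<eta> / 2) sequentially"
    using assms by (intro order_tendstoD(2)) auto
  then have "eventually (\<lambda>q. p ^ q < \<eta> / 2 \<and> 1 \<le> q) sequentially"
    by (intro eventually_conj eventually_ge_at_top)
  then obtain q where q: "p ^ q < \<eta> / 2" "1 \<le> q"
    by (auto simp: eventually_sequentially)
  define K where "K = 4 * q"
  have "\<forall>k. \<exists>h0. \<forall>h\<ge>h0. \<forall>r. odd r \<longrightarrow>
      avg_pow h (\<lambda>m. of_bool (near_multiple (2 * \<epsilon>) (Suc k) r m)) 0 \<le> 8 * (2 * \<epsilon>) + \<epsilon>"
    using \<epsilon> by (intro allI avg_pow_near_multiple) auto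
  then obtain h0 where h0: "\<And>k h r. h0 k \<le> h \<Longrightarrow> odd r \<Longrightarrow>
      avg_pow h (\<lambda>m. of_bool (near_multiple (2 * \<epsilon>) (Suc k) r m)) 0 \<le> 8 * (2 * \<epsilon>) + \<epsilon>"
    by metis
  define \<alpha> where "\<alpha> = (1 + sqrt 3) / (2 :: real)"
  have \<alpha>0: "0 < \<alpha>" by (simp add: \<alpha>_def add_pos_nonneg)
  have "\<alpha> < sqrt 2"
  proof (rule power2_less_imp_less)
    have "sqrt 3 < 2" by (rule real_less_lsqrt) auto
    then show "\<alpha>\<^sup>2 < (sqrt 2)\<^sup>2" by (simp add: \<alpha>_def power2_eq_square field_simps)
  qed simp
  then have "(\<lambda>s. (\<alpha> / sqrt 2) ^ s) \<longlonglongrightarrow> 0" using \<alpha>0 by (intro LIMSEQ_power_zero) auto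
  then have "(\<lambda>s. (\<alpha> / sqrt 2) ^ s * (\<alpha> ^ (2 * K) * sqrt (1 / \<epsilon>))) \<longlonglongrightarrow> 0"
    by (rule tendsto_mult_left_zero)
  then have "eventually (\<lambda>s. (\<alpha> / sqrt 2) ^ s * (\<alpha> ^ (2 * K) * sqrt (1 / \<epsilon>)) < \<epsilon>) sequentially"
    using \<epsilon> by (intro order_tendstoD(2)) auto
  then obtain S2 where S2: "\<And>s. S2 \<le> s \<Longrightarrow> (\<alpha> / sqrt 2) ^ s * (\<alpha> ^ (2 * K) * sqrt (1 / \<epsilon>)) < \<epsilon>"
    by (auto simp: eventually_sequentially)
  define S where "S = S2 + (\<Sum>k<K. h0 k)"
  have "norm (syrac_char N (2 ^ s * o')) \<le> \<eta> * char_sup n1 + (3 / 2) ^ (s + 2 * K) / 2 ^ (N - n1)"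
    if "s \<ge> S" "odd o'" "\<not> 3 dvd o'" "2 ^ s * \<bar>o'\<bar> \<le> 3 ^ N" "n1 \<le> N" "1 \<le> N" for s N n1 o'
  proof -
    define c where "c = sqrt (1 / (2 ^ s * \<epsilon>))"
    have near: "avg_pow (s + 2 * k) (\<lambda>m. of_bool (near_multiple (2 * \<epsilon>) (Suc k) r m)) 0 \<le> 17 * \<epsilon>"
      if "k < K" "odd r" for k r
    proof -
      have "h0 k \<le> (\<Sum>k<K. h0 k)" using that by (intro member_le_sum) auto
      then show ?thesis using h0[of k "s + 2 * k" r] that \<open>s \<ge> S\<close> by (simp add: S_def)
    qed
    have "c * \<alpha> ^ (s + 2 * K) \<le> \<epsilon>"
    proof -
      have "c = sqrt (1 / \<epsilon>) / sqrt 2 ^ s"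
        using \<epsilon> by (simp add: c_def real_sqrt_divide real_sqrt_mult real_sqrt_power)
      then have "c * \<alpha> ^ (s + 2 * K) = (\<alpha> / sqrt 2) ^ s * (\<alpha> ^ (2 * K) * sqrt (1 / \<epsilon>))"
        by (simp add: power_add power_divide)
      then show ?thesis using S2[of s] \<open>s \<ge> S\<close> by (simp add: S_def)
    qed
    then have "K * (c * \<alpha> ^ (s + 2 * K) + 17 * \<epsilon>) / q \<le> K * (\<epsilon> + 17 * \<epsilon>) / q"
      by (intro divide_right_mono mult_left_mono add_right_mono) auto
    also have "\<dots> = 72 * \<epsilon>" using q by (simp add: K_def)
    also have "\<dots> \<le> \<eta> / 2" using \<epsilon> by simp
    finally have 1: "K * (c * \<alpha> ^ (s + 2 * K) + 17 * \<epsilon>) / q \<le> \<eta> / 2" .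
    have "((1 + \<gamma>) / 2) ^ K / \<gamma> ^ q = p ^ q"
      by (simp only: p_def K_def power_mult power_divide)
    then have 2: "((1 + \<gamma>) / 2) ^ K / \<gamma> ^ q \<le> \<eta> / 2" using q by simp
    have "norm (syrac_char N (2 ^ s * o')) \<le> char_sup n1 * (((1 + \<gamma>) / 2) ^ K / \<gamma> ^ q
      + K * (c * \<alpha> ^ (s + 2 * K) + 17 * \<epsilon>) / q) + (3 / 2) ^ (s + 2 * K) / 2 ^ (N - n1)"
      unfolding \<gamma>_def c_def \<alpha>_def
      by (rule norm_syrac_char_large_valuation) (use that \<epsilon> q near in auto)
    also have "\<dots> \<le> char_sup n1 * \<eta> + (3 / 2) ^ (s + 2 * K) / 2 ^ (N - n1)"
      using 1 2 by (intro add_right_mono mult_left_mono char_sup_nonneg) linarith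
    finally show ?thesis by (simp add: mult.commute)
  qed
  then show ?thesis by blast
qed

text \<open>Only the path of \<open>j\<close> tails is followed down to \<open>x\<close>, with
  weight \<open>1 / 2 ^ j\<close>; as soon as a head occurs, the supremum one level lower takes
  over.\<close>

lemma norm_syrac_char_pow2_le:
  assumes "\<not> 3 dvd x" "1 \<le> N"
  shows "norm (syrac_char N (2 ^ j * x)) \<le> (1 - 1 / 2 ^ j) * char_sup (N - 1) + norm (syrac_char N x) / 2 ^ j"
proof (induction j)
  case (Suc j)
  have "\<not> 3 dvd 2 ^ j * x"
  proof
    assume "3 dvd 2 ^ j * x"
    moreover have "coprime (3 :: int) (2 ^ j)" by simp
    ultimately show False using assms(1) by (simp add: coprime_dvd_mult_right_iff)
  qed
  then have "norm (syrac_char (N - 1) (2 ^ j * x)) \<le> char_sup (N - 1)"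
    by (rule norm_syrac_char_le_sup)
  then have "norm (syrac_char N (2 ^ Suc j * x))
      \<le> ((1 - 1 / 2 ^ j) * char_sup (N - 1) + norm (syrac_char N x) / 2 ^ j + char_sup (N - 1)) / 2"
    using norm_syrac_char_double_le[of N "2 ^ j * x"] Suc by (simp add: mult.assoc)
  also have "\<dots> = (1 - 1 / 2 ^ Suc j) * char_sup (N - 1) + norm (syrac_char N x) / 2 ^ Suc j"
    by (simp add: field_simps)
  finally show ?case .
qed simp

text \<open>
  Halving an odd multiple of \<open>3\<^sup>-\<^sup>N\<close> of size at most \<open>1/2\<close> carries, so one lands at distance
  at least \<open>1/4\<close> from the integers.
\<close>

lemma norm_syrac_char_double_odd_le:
  assumes o: "odd o'" "\<not> 3 dvd o'" and bd: "2 * \<bar>o'\<bar> \<le> 3 ^ N" and N: "1 \<le> N"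
  shows "norm (syrac_char N (2 * o')) \<le> 9 / 10 * char_sup (N - 2)"
proof -
  \<comment> \<open>Adding \<open>3 ^ N\<close> with the sign opposite to \<open>o'\<close> makes
    the sum even and puts its half between a quarter and a half of \<open>3 ^ N\<close> in absolute
    value.\<close>
  define w :: int where "w = (if o' > 0 then - 1 else 1)"
  have "even (o' + w * 3 ^ N)" using o(1) by (simp add: w_def)
  then obtain x where x: "o' + w * 3 ^ N = 2 * x" by blast
  have c: "[2 * o' = 4 * x] (mod 3 ^ N)"
  proof -
    have "4 * x - 2 * o' = 2 * (2 * x) - 2 * o'" by simp
    also have "\<dots> = 3 ^ N * (2 * w)" unfolding x[symmetric] by (simp add: algebra_simps)
    finally show ?thesis by (metis cong_iff_dvd_diff cong_sym dvd_triv_left)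
  qed
  have x3: "\<not> 3 dvd x"
  proof
    assume "3 dvd x"
    then have "3 dvd 2 * x - w * 3 ^ N" using N by (intro dvd_diff dvd_mult) (auto simp: dvd_power)
    then show False using o(2) x by (metis add_diff_cancel_right')
  qed
  define t where "t = \<bar>real_of_int x / 3 ^ N\<bar>"
  have "3 ^ N \<le> 4 * \<bar>x\<bar>" "2 * \<bar>x\<bar> \<le> 3 ^ N"
    using x bd o(1) by (auto simp: w_def split: if_splits)
  then have "real_of_int (3 ^ N) \<le> real_of_int (4 * \<bar>x\<bar>)" "real_of_int (2 * \<bar>x\<bar>) \<le> real_of_int (3 ^ N)"
    by (simp_all only: of_int_le_iff)
  then have t: "1 / 4 \<le> t" "t \<le> 1 / 2" by (simp_all add: t_def field_simps)
  have cos0: "\<bar>cos (pi * (real_of_int x / 3 ^ N))\<bar> \<le> 71 / 100"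
  proof -
    have "cos (pi * (real_of_int x / 3 ^ N)) = cos (pi * t)"
      unfolding t_def by (metis abs_mult abs_of_pos cos_abs_real pi_gt_zero)
    moreover have "0 \<le> cos (pi * t)"
      using t by (intro cos_ge_zero) (auto simp: field_simps intro: order_trans[of _ 0])
    moreover have "cos (pi * t) \<le> cos (pi / 4)"
      using t by (intro cos_monotone_0_pi_le) auto
    moreover have "cos (pi / 4) \<le> 71 / 100"
    proof -
      have "sqrt 2 \<le> 142 / 100" by (rule real_le_lsqrt) (auto simp: power2_eq_square)
      then show ?thesis by (simp add: cos_45)
    qed
    ultimately show ?thesis by simp
  qed
  define M where "M = char_sup (N - 2)"
  have M: "norm (syrac_char N x) \<le> M" "norm (syrac_char (N - 1) x) \<le> M" "norm (syrac_char (N - 2) x) \<le> M"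
    unfolding M_def
    by (rule order_trans[OF norm_syrac_char_le_sup[OF x3] char_sup_antimono], linarith)+
  have "2 * \<bar>cos (pi * (real_of_int x / 3 ^ N))\<bar> * norm (syrac_char (N - 1) x) \<le> 2 * (71 / 100) * M"
    using cos0 M by (intro mult_mono) auto
  then have "norm (syrac_char N (4 * x)) \<le> (M + 2 * (71 / 100) * M + M) / 4"
    using M by (intro order_trans[OF norm_syrac_char_quadruple_le] divide_right_mono add_mono) auto
  also have "\<dots> \<le> 9 / 10 * M" using char_sup_nonneg[of "N - 2"] by (simp add: M_def)
  finally have "norm (syrac_char N (4 * x)) \<le> 9 / 10 * M" .
  then show ?thesis using syrac_char_cong[OF c] by (simp add: M_def)
qed

text \<open>Asking for a centered half instead of a centered representative guarantees a factor 2
  above the odd part, as \<open>norm_syrac_char_double_odd_le\<close> requires, even when the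
  centered number is odd.\<close>

lemma ex_centered_half:
  fixes \<xi> :: int
  shows "\<exists>\<xi>'. 2 * \<bar>\<xi>'\<bar> \<le> 3 ^ N \<and> [2 * \<xi>' = \<xi>] (mod 3 ^ N)"
proof -
  define h :: int where "h = (3 ^ N - 1) div 2"
  have h: "2 * h = 3 ^ N - 1" unfolding h_def by (rule dvd_mult_div_cancel) simp
  define y where "y = (half_mod N * \<xi> + h) mod 3 ^ N"
  have y: "0 \<le> y" "y < 3 ^ N" by (simp_all add: y_def)
  have "[y = half_mod N * \<xi> + h] (mod 3 ^ N)" by (simp add: y_def)
  then have "[2 * (y - h) = 2 * (half_mod N * \<xi> + h - h)] (mod 3 ^ N)"
    by (intro cong_mult cong_diff cong_refl)
  then have "[2 * (y - h) = \<xi>] (mod 3 ^ N)"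
    using cong_trans[OF _ cong_half] by simp
  moreover have "\<bar>y - h\<bar> \<le> h" using y h by (intro abs_leI) linarith+
  then have "2 * \<bar>y - h\<bar> \<le> 2 * h" by simp
  then have "2 * \<bar>y - h\<bar> \<le> 3 ^ N" unfolding h by simp
  ultimately show ?thesis by blast
qed

text \<open>If the valuation is below \<open>S\<close>, the path of tails reaches
  \<open>2 * o'\<close> with probability at least \<open>1 / 2 ^ S\<close> and gains 1/10 there,
  whence the value of \<kappa>. Otherwise one toss reaches the case bounded by \<open>X\<close> with
  probability 1/2.\<close>

lemma char_sup_step:
  assumes N: "1 \<le> N" and X: "0 \<le> X"
    and big: "\<And>s o'. S \<le> s \<Longrightarrow> odd o' \<Longrightarrow> \<not> 3 dvd o' \<Longrightarrow> 2 ^ s * \<bar>o'\<bar> \<le> 3 ^ N \<Longrightarrow>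
      norm (syrac_char N (2 ^ s * o')) \<le> X"
  defines "\<kappa> \<equiv> 1 / (10 * 2 ^ S)"
  shows "char_sup N \<le> (1 - \<kappa>) * char_sup (N - 2) + \<kappa> * X"
proof (rule char_sup_least)
  fix \<xi>0 :: int assume \<xi>0: "\<not> 3 dvd \<xi>0"
  define M where "M = char_sup (N - 2)"
  have M0: "0 \<le> M" by (simp add: M_def char_sup_nonneg)
  have M1: "char_sup (N - 1) \<le> M" "char_sup N \<le> M" by (simp_all add: M_def char_sup_antimono)
  have "1 \<le> (2::real) ^ S" by simp
  then have "2 \<le> 10 * (2::real) ^ S" by linarith
  then have \<kappa>: "0 < \<kappa>" "\<kappa> \<le> 1 / 2" unfolding \<kappa>_def by (auto intro!: divide_left_mono)
  obtain \<xi> where \<xi>: "2 * \<bar>\<xi>\<bar> \<le> 3 ^ N" "[2 * \<xi> = \<xi>0] (mod 3 ^ N)"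
    using ex_centered_half by blast
  have eq: "syrac_char N \<xi>0 = syrac_char N (2 * \<xi>)"
    using syrac_char_cong[OF \<xi>(2)] by simp
  have \<xi>3: "\<not> 3 dvd \<xi>"
  proof
    assume "3 dvd \<xi>"
    then have "3 dvd 2 * \<xi>" by simp
    moreover have "[2 * \<xi> = \<xi>0] (mod 3)" using \<xi>(2) N by (rule_tac cong_dvd_modulus) (auto simp: dvd_power)
    ultimately show False using \<xi>0 by (simp add: cong_dvd_iff)
  qed
  then have "\<xi> \<noteq> 0" by auto
  then obtain o' where o': "\<xi> = 2 ^ multiplicity 2 \<xi> * o'" "odd o'"
    using multiplicity_decompose'[of \<xi> 2] by auto
  define s where "s = multiplicity 2 \<xi>"
  have \<xi>s: "\<xi> = 2 ^ s * o'" using o' by (simp add: s_def)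
  have o3: "\<not> 3 dvd o'" using \<xi>3 \<xi>s by auto
  have "norm (syrac_char N (2 * \<xi>)) \<le> (1 - \<kappa>) * M + \<kappa> * X"
  proof (cases "S \<le> s")
    case True
    have "2 ^ s * \<bar>o'\<bar> = \<bar>\<xi>\<bar>" by (simp add: \<xi>s abs_mult)
    then have "2 ^ s * \<bar>o'\<bar> \<le> 3 ^ N" using \<xi>(1) by linarith
    then have "norm (syrac_char N \<xi>) \<le> X" unfolding \<xi>s by (intro big True o'(2) o3)
    moreover have "norm (syrac_char (N - 1) \<xi>) \<le> M"
      using norm_syrac_char_le_sup[OF \<xi>3, of "N - 1"] M1 by simp
    ultimately have 1: "norm (syrac_char N (2 * \<xi>)) \<le> (X + M) / 2"
      by (intro order_trans[OF norm_syrac_char_double_le] divide_right_mono add_mono) auto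
    have "norm (syrac_char N \<xi>0) \<le> M"
      using norm_syrac_char_le_sup[OF \<xi>0, of N] M1 by simp
    then have 2: "norm (syrac_char N (2 * \<xi>)) \<le> M" by (simp add: eq)
    show ?thesis
    proof (cases "M \<le> X")
      case True
      then have "\<kappa> * M \<le> \<kappa> * X" using \<kappa> by (intro mult_left_mono) auto
      then show ?thesis using 2 by (simp add: algebra_simps)
    next
      case False
      then have "\<kappa> * (M - X) \<le> 1 / 2 * (M - X)" using \<kappa> by (intro mult_right_mono) auto
      then show ?thesis using 1 by (simp add: algebra_simps)
    qed
  next
    case False
    have "\<bar>o'\<bar> \<le> \<bar>\<xi>\<bar>" unfolding \<xi>s by (simp add: abs_mult mult_le_cancel_right1)
    then have bd: "2 * \<bar>o'\<bar> \<le> 3 ^ N" using \<xi>(1) by simp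
    have n3: "\<not> 3 dvd 2 * o'"
      using o3 by (simp add: coprime_dvd_mult_right_iff)
    have "norm (syrac_char N (2 ^ s * (2 * o'))) \<le> (1 - 1 / 2 ^ s) * char_sup (N - 1) + norm (syrac_char N (2 * o')) / 2 ^ s"
      by (rule norm_syrac_char_pow2_le[OF n3 N])
    also have "\<dots> \<le> (1 - 1 / 2 ^ s) * M + (9 / 10 * M) / 2 ^ s"
      using M1 norm_syrac_char_double_odd_le[OF o'(2) o3 bd N]
      by (intro add_mono mult_left_mono divide_right_mono) (auto simp: M_def)
    also have "\<dots> = (1 - 1 / (10 * 2 ^ s)) * M" by (simp add: field_simps)
    also have "\<dots> \<le> (1 - \<kappa>) * M"
    proof (intro mult_right_mono M0)
      have "(2::real) ^ s \<le> 2 ^ S" using False by (intro power_increasing) auto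
      then show "1 - 1 / (10 * 2 ^ s) \<le> 1 - \<kappa>" by (simp add: \<kappa>_def field_simps)
    qed
    also have "\<dots> \<le> (1 - \<kappa>) * M + \<kappa> * X" using \<kappa> X by simp
    also have "2 ^ s * (2 * o') = 2 * \<xi>" by (simp add: \<xi>s)
    finally show ?thesis .
  qed
  then show "norm (syrac_char N \<xi>0) \<le> (1 - \<kappa>) * char_sup (N - 2) + \<kappa> * X"
    by (simp add: eq M_def)
qed

lemma iterate_contraction:
  fixes f :: "nat \<Rightarrow> real"
  assumes "0 \<le> \<kappa>" "\<kappa> \<le> 1" "0 \<le> X"
    and "\<And>N'. N - 2 * R < N' \<Longrightarrow> N' \<le> N \<Longrightarrow> f N' \<le> (1 - \<kappa>) * f (N' - 2) + \<kappa> * X"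
    and "2 * R \<le> N"
  shows "f N \<le> (1 - \<kappa>) ^ R * f (N - 2 * R) + X"
  using assms(4,5)
proof (induction R arbitrary: N)
  case 0
  then show ?case using assms by simp
next
  case (Suc R)
  have "f (N - 2) \<le> (1 - \<kappa>) ^ R * f (N - 2 - 2 * R) + X"
    using Suc.prems by (intro Suc.IH) auto
  then have "(1 - \<kappa>) * f (N - 2) \<le> (1 - \<kappa>) * ((1 - \<kappa>) ^ R * f (N - 2 * Suc R) + X)"
    using assms by (intro mult_left_mono) auto
  moreover have "f N \<le> (1 - \<kappa>) * f (N - 2) + \<kappa> * X"
    using Suc.prems by (intro Suc.prems(1)) auto
  ultimately show ?case by (simp add: algebra_simps)
qed

text \<open>Applies \<open>char_sup_step\<close> \<open>R\<close> times, where
  \<open>(1 - \<kappa>) ^ R < \<eta> / 2\<close>. Each application costs two levels, so for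
  \<open>n \<ge> 4 * R + 1\<close> all of them take place at levels at least
  \<open>n / 2\<close>.\<close>

lemma char_sup_recursion:
  assumes "\<eta> > 0"
  shows "\<exists>C. \<forall>n. char_sup n \<le> \<eta> * char_sup (n div 200) + C * (2 powr (-3 / 200)) ^ n"
proof -
  define q :: real where "q = 2 powr (-3 / 200)"
  have "2 powr (-3 / 200) < (2::real) powr 0" by (rule powr_less_mono) auto
  then have q: "0 < q" "q < 1" by (auto simp: q_def)
  obtain S K where SK: "\<forall>s\<ge>S. \<forall>N n1 o'. odd o' \<longrightarrow> \<not> 3 dvd o' \<longrightarrow> 2 ^ s * \<bar>o'\<bar> \<le> 3 ^ N \<longrightarrow> n1 \<le> N \<longrightarrow> 1 \<le> N \<longrightarrow>
    norm (syrac_char N (2 ^ s * o')) \<le> \<eta> / 2 * char_sup n1 + (3 / 2) ^ (s + 2 * K) / 2 ^ (N - n1)"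
    using norm_syrac_char_large_valuation_le[OF half_gt_zero[OF assms]] by blast
  define \<kappa> :: real where "\<kappa> = 1 / (10 * 2 ^ S)"
  have "1 \<le> (2::real) ^ S" by simp
  then have "1 < 10 * (2::real) ^ S" by linarith
  then have \<kappa>: "0 < \<kappa>" "\<kappa> < 1" by (auto simp: \<kappa>_def)
  have "(\<lambda>R. (1 - \<kappa>) ^ R) \<longlonglongrightarrow> 0" using \<kappa> by (intro LIMSEQ_power_zero) auto
  then have "eventually (\<lambda>R. (1 - \<kappa>) ^ R < \<eta> / 2) sequentially"
    using assms by (intro order_tendstoD(2)) auto
  then obtain R where R: "(1 - \<kappa>) ^ R < \<eta> / 2" by (auto simp: eventually_sequentially)
  define C0 :: real where "C0 = (3 / 2) ^ (2 * K)"
  have C0: "0 \<le> C0" by (simp add: C0_def)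
  have main: "char_sup n \<le> \<eta> * char_sup (n div 200) + C0 * q ^ n" if n: "4 * R + 1 \<le> n" for n
  proof -
    define n1 where "n1 = n div 200"
    define X where "X = \<eta> / 2 * char_sup n1 + C0 * q ^ n"
    have X0: "0 \<le> X" using assms char_sup_nonneg[of n1] C0 q by (simp add: X_def)
    have "char_sup n \<le> (1 - \<kappa>) ^ R * char_sup (n - 2 * R) + X"
    proof (rule iterate_contraction)
      fix N assume N: "n - 2 * R < N" "N \<le> n"
      have N2: "n \<le> 2 * N" "1 \<le> N" "n1 \<le> N" using N n by (auto simp: n1_def)
      show "char_sup N \<le> (1 - \<kappa>) * char_sup (N - 2) + \<kappa> * X"
        unfolding \<kappa>_def
      proof (rule char_sup_step[OF N2(2) X0])
        fix s o' assume s: "S \<le> s" "odd o'" "\<not> 3 dvd o'" "2 ^ s * \<bar>o'\<bar> \<le> (3::int) ^ N"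
        have "1 \<le> \<bar>o'\<bar>" using s(2) by (cases "o' = 0") auto
        then have "2 ^ s * 1 \<le> 2 ^ s * \<bar>o'\<bar>" by (intro mult_left_mono) auto
        from order_trans[OF this s(4)] have "(2 :: int) ^ s \<le> 3 ^ N" by simp
        then have "real_of_int (2 ^ s) \<le> real_of_int (3 ^ N)" by (simp only: of_int_le_iff)
        then have "(3 / 2 :: real) ^ s \<le> 2 powr (24 / 25 * N)" by (intro three_halves_pow_le) simp
        then have "(3 / 2) ^ s / 2 ^ (N - n1) \<le> 2 powr (24 / 25 * N) / 2 powr (real N - real n1)"
          using N2 by (simp add: powr_realpow[symmetric] of_nat_diff divide_right_mono)
        also have "\<dots> = 2 powr (24 / 25 * N - (real N - real n1))" by (rule powr_diff[symmetric])
        \<comment> \<open>From \<open>N \<ge> n / 2\<close> and \<open>n1 \<le> n / 200\<close> the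
          exponent is at most \<open>- N / 25 + n / 200\<close>, hence at most
          \<open>- 3 * n / 200\<close>.\<close>
        also have "\<dots> \<le> 2 powr (-3 / 200 * n)"
        proof (rule powr_mono)
          have "200 * n1 \<le> n" by (simp add: n1_def)
          then have "real n1 \<le> real n / 200" by simp
          moreover have "real n \<le> 2 * real N" using N2 by linarith
          ultimately show "24 / 25 * N - (real N - real n1) \<le> -3 / 200 * n" by linarith
        qed simp
        also have "\<dots> = q ^ n" by (simp add: q_def powr_power mult.commute)
        finally have "C0 * ((3 / 2) ^ s / 2 ^ (N - n1)) \<le> C0 * q ^ n"
          using C0 by (rule mult_left_mono)
        moreover have "(3 / 2) ^ (s + 2 * K) / 2 ^ (N - n1) = C0 * ((3 / 2) ^ s / 2 ^ (N - n1) :: real)"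
          by (simp add: C0_def power_add)
        ultimately show "norm (syrac_char N (2 ^ s * o')) \<le> X"
          using SK[rule_format, OF s N2(3) N2(2)] by (simp add: X_def)
      qed
    qed (use \<kappa> X0 n in auto)
    also have "(1 - \<kappa>) ^ R * char_sup (n - 2 * R) \<le> \<eta> / 2 * char_sup n1"
      using R assms n \<kappa> char_sup_nonneg by (intro mult_mono char_sup_antimono) (auto simp: n1_def)
    finally show ?thesis by (simp add: X_def n1_def)
  qed
  \<comment> \<open>For the finitely many smaller \<open>n\<close> this makes the geometric term at
    least 1, and the bound is trivial.\<close>
  define C where "C = max C0 (1 / q ^ (4 * R + 1))"
  have "char_sup n \<le> \<eta> * char_sup (n div 200) + C * q ^ n" for n
  proof (cases "4 * R + 1 \<le> n")
    case True
    have "C0 * q ^ n \<le> C * q ^ n" using q by (intro mult_right_mono) (auto simp: C_def)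
    then show ?thesis using main[OF True] by linarith
  next
    case False
    have "1 = 1 / q ^ (4 * R + 1) * q ^ (4 * R + 1)" using q by simp
    also have "\<dots> \<le> C * q ^ n" using q False C0
      by (intro mult_mono power_decreasing) (auto simp: C_def)
    finally have "1 \<le> C * q ^ n" .
    moreover have "0 \<le> \<eta> * char_sup (n div 200)" using assms char_sup_nonneg by simp
    ultimately show ?thesis using char_sup_le_1[of n] by linarith
  qed
  then show ?thesis unfolding q_def by blast
qed

lemma char_sup_superpolynomial: "\<exists>C. \<forall>n. char_sup n * real n ^ A \<le> C"
proof (rule superpolynomial_decay)
  have "2 powr (-3 / 200) < (2::real) powr 0" by (rule powr_less_mono) auto
  then show "2 powr (-3 / 200) < (1::real)" by simp
  show "\<exists>C. \<forall>n. char_sup n \<le> \<eta> * char_sup (n div 200) + C * (2 powr (-3 / 200)) ^ n" if "\<eta> > 0" for \<eta>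
    using that by (rule char_sup_recursion)
qed (simp_all add: char_sup_nonneg char_sup_le_1)

section \<open>Coin words and Parseval's identity\<close>

text \<open>
  A word lists coin tosses, latest first. If the heads come at the times \<open>b\<^sub>1 < \<dots> < b\<^sub>k\<close> of \<open>h\<close> tosses,
  then \<open>word_val\<close> is \<open>2\<^sup>h\<close> times the sum of the \<open>3\<^sup>i\<^sup>-\<^sup>1 / 2\<^sup>b\<close> with \<open>b = b\<^sub>i\<close>.
\<close>

definition words :: "nat \<Rightarrow> bool list set" where
  "words h = {w. length w = h}"

primrec word_val :: "bool list \<Rightarrow> int" where
  "word_val [] = 0"
| "word_val (b # w) = 2 * word_val w + (if b then 3 ^ count_list w True else 0)"

lemma words_0: "words 0 = {[]}"
  by (auto simp: words_def)

lemma words_Suc: "words (Suc h) = Cons True ` words h \<union> Cons False ` words h"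
  by (auto simp: words_def length_Suc_conv)

lemma finite_words [simp]: "finite (words h)"
  by (induction h) (simp_all add: words_0 words_Suc)

lemma sum_words_Suc: "(\<Sum>w\<in>words (Suc h). F w) = (\<Sum>w\<in>words h. F (True # w) + F (False # w))"
proof -
  have "(\<Sum>w\<in>words (Suc h). F w) = (\<Sum>w\<in>Cons True ` words h. F w) + (\<Sum>w\<in>Cons False ` words h. F w)"
    unfolding words_Suc by (rule sum.union_disjoint) auto
  then show ?thesis by (simp add: sum.reindex sum.distrib)
qed

lemma card_words: "card (words h) = 2 ^ h"
proof (induction h)
  case (Suc h)
  have "card (words (Suc h)) = (\<Sum>w\<in>words h. 1 + 1)"
    unfolding card_eq_sum by (rule sum_words_Suc)
  then show ?case using Suc by simp
qed (simp add: words_0)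

lemma word_val_nonneg: "0 \<le> word_val w"
  by (induction w) auto

text \<open>The parity of the value reveals the latest toss, which also fixes the number of heads in
  the remaining word; induction recovers the rest.\<close>

lemma word_val_inj:
  assumes "length v = length w" "count_list v True = count_list w True" "word_val v = word_val w"
  shows "v = w"
  using assms
proof (induction v w rule: list_induct2)
  case (Cons a v b w)
  have odd: "odd (word_val (c # x)) \<longleftrightarrow> c" for c x by simp
  have "odd (word_val (a # v)) \<longleftrightarrow> odd (word_val (b # w))" by (simp only: Cons.prems(2))
  then have "a = b" by (simp only: odd)
  then show ?case using Cons by (auto split: if_splits)
qed simp

lemma periodic_mod_affine:
  assumes "periodic_mod n f"
  shows "periodic_mod (n - m) (\<lambda>x. f (a + 3 ^ m * x))"
  unfolding periodic_mod_def
proof (intro allI impI)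
  fix x y :: int assume "[x = y] (mod 3 ^ (n - m))"
  then have "3 ^ (n - m) dvd x - y" by (simp add: cong_iff_dvd_diff)
  then have "3 ^ m * 3 ^ (n - m) dvd 3 ^ m * (x - y)" by (rule mult_dvd_mono[OF dvd_refl])
  moreover have "(3::int) ^ n dvd 3 ^ m * 3 ^ (n - m)"
    by (simp only: power_add[symmetric]) (simp add: le_imp_power_dvd)
  ultimately have "3 ^ n dvd 3 ^ m * (x - y)" by (rule dvd_trans[rotated])
  then have "[a + 3 ^ m * x = a + 3 ^ m * y] (mod 3 ^ n)"
    by (simp add: cong_iff_dvd_diff right_diff_distrib)
  then show "f (a + 3 ^ m * x) = f (a + 3 ^ m * y)" by (rule periodic_modD[OF assms])
qed

lemma syrac_exp_words:
  fixes f :: "int \<Rightarrow> real"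
  assumes "periodic_mod n f"
  shows "syrac_exp n (\<lambda>x. f (2 ^ h * x)) = (\<Sum>w\<in>words h. syrac_exp (n - count_list w True)
    (\<lambda>x. f (word_val w + 3 ^ count_list w True * x))) / 2 ^ h"
  using assms
proof (induction h arbitrary: f)
  case 0
  then show ?case by (simp add: words_0)
next
  case (Suc h)
  have per: "periodic_mod n (\<lambda>x. f (2 * x))"
    unfolding periodic_mod_def using periodic_modD[OF Suc.prems] cong_mult[OF cong_refl] by blast
  have step: "syrac_exp (n - m) (\<lambda>x. f (2 * (a + 3 ^ m * x)))
      = (syrac_exp (n - Suc m) (\<lambda>x. f (2 * a + 3 ^ m + 3 ^ Suc m * x))
        + syrac_exp (n - m) (\<lambda>x. f (2 * a + 3 ^ m * x))) / 2" for m a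
    using syrac_exp_double[OF periodic_mod_affine[OF Suc.prems, of m "2 * a"]]
    by (simp add: algebra_simps)
  have "syrac_exp n (\<lambda>x. f (2 ^ Suc h * x)) = syrac_exp n (\<lambda>x. f (2 * (2 ^ h * x)))"
    by (simp add: mult.assoc)
  also have "\<dots> = (\<Sum>w\<in>words h. syrac_exp (n - count_list w True)
      (\<lambda>x. f (2 * (word_val w + 3 ^ count_list w True * x)))) / 2 ^ h"
    by (rule Suc.IH[OF per])
  also have "\<dots> = (\<Sum>w\<in>words (Suc h). syrac_exp (n - count_list w True)
    (\<lambda>x. f (word_val w + 3 ^ count_list w True * x))) / 2 ^ Suc h"
    unfolding sum_words_Suc step by (simp add: sum_divide_distrib)
  finally show ?case .
qed

lemma sum_words_power: "(\<Sum>w\<in>words h. c ^ count_list w True) = (1 + c :: real) ^ h"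
  by (induction h) (simp_all add: words_0 sum_words_Suc sum.distrib sum_distrib_left[symmetric] distrib_right)

text \<open>Subadditivity of the square root gives a linear recursion with ratio \<alpha> and
  forcing term \<open>\<beta> ^ h\<close>. The plain sum of \<open>word_val\<close> equals
  \<open>h * 4 ^ (h - 1)\<close>, so the first moment would carry an extra factor
  \<open>h\<close>.\<close>

lemma sum_words_sqrt_val:
  defines "\<beta> \<equiv> 1 + sqrt 3" and "\<alpha> \<equiv> 2 * sqrt 2"
  shows "(\<Sum>w\<in>words h. sqrt (word_val w)) \<le> (\<alpha> ^ h - \<beta> ^ h) / (\<alpha> - \<beta>)" and "\<beta> < \<alpha>"
proof -
  have "\<beta>\<^sup>2 < \<alpha>\<^sup>2"
  proof -
    have "sqrt 3 < 2" by (rule real_less_lsqrt) auto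
    then show ?thesis by (simp add: \<beta>_def \<alpha>_def power2_eq_square algebra_simps)
  qed
  then show lt: "\<beta> < \<alpha>" by (rule power2_less_imp_less) (simp add: \<alpha>_def)
  show "(\<Sum>w\<in>words h. sqrt (word_val w)) \<le> (\<alpha> ^ h - \<beta> ^ h) / (\<alpha> - \<beta>)"
  proof (induction h)
    case 0
    then show ?case by (simp add: words_0)
  next
    case (Suc h)
    have "(\<Sum>w\<in>words (Suc h). sqrt (word_val w))
        \<le> (\<Sum>w\<in>words h. \<alpha> * sqrt (word_val w) + sqrt 3 ^ count_list w True)"
      unfolding sum_words_Suc
    proof (rule sum_mono)
      fix w
      have "sqrt (2 * real_of_int (word_val w) + 3 ^ count_list w True)
          \<le> sqrt (2 * real_of_int (word_val w)) + sqrt (3 ^ count_list w True)"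
        using word_val_nonneg[of w] by (intro sqrt_add_le_add_sqrt) auto
      then show "sqrt (real_of_int (word_val (True # w))) + sqrt (real_of_int (word_val (False # w)))
          \<le> \<alpha> * sqrt (real_of_int (word_val w)) + sqrt 3 ^ count_list w True"
        by (simp add: \<alpha>_def real_sqrt_mult real_sqrt_power mult.commute)
    qed
    also have "\<dots> = \<alpha> * (\<Sum>w\<in>words h. sqrt (word_val w)) + \<beta> ^ h"
      by (simp add: sum.distrib sum_distrib_left[symmetric] sum_words_power \<beta>_def)
    also have "\<dots> \<le> \<alpha> * ((\<alpha> ^ h - \<beta> ^ h) / (\<alpha> - \<beta>)) + \<beta> ^ h"
      using Suc by (intro add_right_mono mult_left_mono) (auto simp: \<alpha>_def)
    also have "\<dots> = (\<alpha> ^ Suc h - \<beta> ^ Suc h) / (\<alpha> - \<beta>)"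
      using lt by (simp add: field_simps)
    finally show ?case .
  qed
qed

text \<open>Markov's inequality for the square root of the value. These words leave the range of
  representatives, where distinct values may have equal residues.\<close>

lemma card_words_large_val:
  "\<exists>C\<ge>0. \<forall>h n. real (card {w \<in> words h. 3 ^ n \<le> word_val w}) \<le> C * 2 ^ h * sqrt (2 ^ h / 3 ^ n)"
proof -
  define \<beta> where "\<beta> = 1 + sqrt 3"
  define \<alpha> where "\<alpha> = 2 * sqrt 2"
  define C where "C = 1 / (\<alpha> - \<beta>)"
  have lt: "\<beta> < \<alpha>" using sum_words_sqrt_val(2) by (simp add: \<alpha>_def \<beta>_def)
  have "real (card {w \<in> words h. 3 ^ n \<le> word_val w}) \<le> C * 2 ^ h * sqrt (2 ^ h / 3 ^ n)" for h n
  proof -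
    let ?B = "{w \<in> words h. 3 ^ n \<le> word_val w}"
    have "real (card ?B) * sqrt (3 ^ n) = (\<Sum>w\<in>?B. sqrt (3 ^ n))" by simp
    also have "\<dots> \<le> (\<Sum>w\<in>?B. sqrt (word_val w))"
    proof (rule sum_mono)
      fix w assume "w \<in> ?B"
      then have "real_of_int (3 ^ n) \<le> real_of_int (word_val w)" by (simp only: of_int_le_iff mem_Collect_eq)
      then show "sqrt (3 ^ n) \<le> sqrt (word_val w)" by simp
    qed
    also have "\<dots> \<le> (\<Sum>w\<in>words h. sqrt (word_val w))"
      by (rule sum_mono2) (auto simp: word_val_nonneg)
    also have "\<dots> \<le> (\<alpha> ^ h - \<beta> ^ h) / (\<alpha> - \<beta>)"
      using sum_words_sqrt_val(1)[of h] by (simp add: \<alpha>_def \<beta>_def)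
    also have "\<dots> \<le> C * \<alpha> ^ h"
      using lt by (simp add: C_def divide_right_mono \<beta>_def)
    also have "\<alpha> ^ h = 2 ^ h * sqrt (2 ^ h)"
      by (simp add: \<alpha>_def power_mult_distrib real_sqrt_power)
    finally show ?thesis by (simp add: real_sqrt_divide field_simps)
  qed
  moreover have "0 \<le> C" using lt by (simp add: C_def)
  ultimately show ?thesis by blast
qed

text \<open>Markov's inequality for \<open>2 ^ count_list w True\<close>.\<close>

lemma card_words_many_heads:
  "real (card {w \<in> words h. M < count_list w True}) \<le> 3 ^ h / 2 ^ M"
proof -
  let ?B = "{w \<in> words h. M < count_list w True}"
  have "real (card ?B) * 2 ^ M = (\<Sum>w\<in>?B. 2 ^ M)" by simp
  also have "\<dots> \<le> (\<Sum>w\<in>?B. 2 ^ count_list w True)"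
    by (intro sum_mono power_increasing) auto
  also have "\<dots> \<le> (\<Sum>w\<in>words h. 2 ^ count_list w True)"
    by (rule sum_mono2) auto
  also have "\<dots> = 3 ^ h" using sum_words_power[of 2 h] by simp
  finally show ?thesis by (simp add: field_simps)
qed

section \<open>Fourier analysis on the residues modulo powers of 3\<close>

lemma sum_residues_shift:
  fixes g :: "int \<Rightarrow> 'a::comm_monoid_add"
  assumes "periodic_mod n g"
  shows "(\<Sum>z\<in>{0..<3 ^ n}. g (z + a)) = (\<Sum>z\<in>{0..<3 ^ n}. g z)"
proof -
  let ?N = "3 ^ n :: int"
  have inj: "inj_on (\<lambda>z. (z + a) mod ?N) {0..<?N}"
  proof (rule inj_onI)
    fix x y assume xy: "x \<in> {0..<?N}" "y \<in> {0..<?N}" "(x + a) mod ?N = (y + a) mod ?N"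
    then have "[x + a = y + a] (mod ?N)" by (simp add: cong_def)
    then have "[x = y] (mod ?N)" by (simp add: cong_add_rcancel)
    then show "x = y" using xy by (simp add: cong_def)
  qed
  have "(\<lambda>z. (z + a) mod ?N) ` {0..<?N} = {0..<?N}"
    by (rule endo_inj_surj[OF _ _ inj]) auto
  then have "(\<Sum>z\<in>{0..<?N}. g z) = (\<Sum>z\<in>{0..<?N}. g ((z + a) mod ?N))"
    using sum.reindex[OF inj, of g] by (simp add: o_def)
  then show ?thesis by (simp add: periodic_mod_mod[OF assms])
qed

lemma phase_eq_1_iff: "phase n a = 1 \<longleftrightarrow> 3 ^ n dvd a"
proof
  assume "phase n a = 1"
  then have "cos (2 * pi * (of_int a / 3 ^ n)) = 1" unfolding phase_def by (metis cis.sel(1) one_complex.sel(1))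
  then obtain k :: int where "2 * pi * (of_int a / 3 ^ n) = of_int k * 2 * pi"
    by (auto simp: cos_one_2pi_int)
  then have "(2 * pi) * (of_int a / 3 ^ n) = (2 * pi) * of_int k" by (simp only: ac_simps)
  then have "real_of_int a / 3 ^ n = of_int k" by (subst (asm) mult_cancel_left) simp
  then have "real_of_int a = of_int (k * 3 ^ n)" by (simp add: field_simps)
  then have "a = k * 3 ^ n" by (simp only: of_int_eq_iff)
  then show "3 ^ n dvd a" by simp
qed (auto simp: dvd_def phase_mult_pow3)

lemma sum_phase: "(\<Sum>\<xi>\<in>{0..<3 ^ n}. phase n (\<xi> * a)) = (if 3 ^ n dvd a then 3 ^ n else 0)"
proof (cases "3 ^ n dvd a")
  case True
  then have "phase n (\<xi> * a) = 1" for \<xi> by (simp add: phase_eq_1_iff)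
  then show ?thesis using True by simp
next
  case False
  define s where "s = (\<Sum>\<xi>\<in>{0..<3 ^ n}. phase n (\<xi> * a))"
  have per: "periodic_mod n (\<lambda>\<xi>. phase n (\<xi> * a))"
    unfolding periodic_mod_def using phase_cong cong_mult[OF _ cong_refl] by blast
  have "s = (\<Sum>\<xi>\<in>{0..<3 ^ n}. phase n ((\<xi> + 1) * a))"
    unfolding s_def by (rule sum_residues_shift[OF per, symmetric])
  also have "\<dots> = phase n a * s"
    by (simp add: s_def distrib_right phase_add[symmetric] sum_distrib_left add.commute)
  finally have "(1 - phase n a) * s = 0" by (simp add: left_diff_distrib)
  then show ?thesis using False by (auto simp: s_def phase_eq_1_iff[symmetric])
qed

definition residue_dft :: "nat \<Rightarrow> (int \<Rightarrow> real) \<Rightarrow> int \<Rightarrow> complex" where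
  "residue_dft n u \<xi> = (\<Sum>z\<in>{0..<3 ^ n}. of_real (u z) * phase n (\<xi> * z))"

lemma residue_dft_parseval:
  "(\<Sum>\<xi>\<in>{0..<3 ^ n}. (norm (residue_dft n u \<xi>))\<^sup>2) = 3 ^ n * (\<Sum>z\<in>{0..<3 ^ n}. (u z)\<^sup>2)"
proof -
  let ?R = "{0..<3 ^ n} :: int set"
  have "complex_of_real (\<Sum>\<xi>\<in>?R. (norm (residue_dft n u \<xi>))\<^sup>2)
      = (\<Sum>\<xi>\<in>?R. residue_dft n u \<xi> * cnj (residue_dft n u \<xi>))"
    unfolding of_real_sum complex_norm_square ..
  also have "\<dots> = (\<Sum>\<xi>\<in>?R. \<Sum>z\<in>?R. \<Sum>y\<in>?R. of_real (u z * u y) * phase n (\<xi> * (z - y)))"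
    unfolding residue_dft_def cnj_sum sum_product
    by (intro sum.cong refl) (simp add: right_diff_distrib phase_diff)
  also have "\<dots> = (\<Sum>z\<in>?R. \<Sum>y\<in>?R. of_real (u z * u y) * (\<Sum>\<xi>\<in>?R. phase n (\<xi> * (z - y))))"
    unfolding sum_distrib_left
    by (rule trans[OF sum.swap], rule sum.cong[OF refl], rule sum.swap)
  also have "\<dots> = (\<Sum>z\<in>?R. \<Sum>y\<in>?R. if y = z then of_real ((u z)\<^sup>2 * 3 ^ n) else 0)"
  proof (intro sum.cong refl)
    fix z y :: int assume zy: "z \<in> ?R" "y \<in> ?R"
    have "3 ^ n dvd z - y \<longleftrightarrow> y = z"
    proof
      assume "3 ^ n dvd z - y"
      then have "[z = y] (mod 3 ^ n)" by (simp add: cong_iff_dvd_diff)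
      then show "y = z" using zy by (simp add: cong_def)
    qed simp
    then show "of_real (u z * u y) * (\<Sum>\<xi>\<in>?R. phase n (\<xi> * (z - y)))
        = (if y = z then of_real ((u z)\<^sup>2 * 3 ^ n) else (0 :: complex))"
      by (simp add: sum_phase power2_eq_square)
  qed
  also have "\<dots> = complex_of_real (3 ^ n * (\<Sum>z\<in>?R. (u z)\<^sup>2))"
    by (simp add: sum_distrib_left mult.commute)
  finally show ?thesis by (simp only: of_real_eq_iff)
qed

text \<open>The arguments are the three lifts of a residue modulo \<open>3 ^ n\<close> to the
  modulus \<open>3 ^ Suc n\<close>.\<close>

definition fiber_sum :: "nat \<Rightarrow> (int \<Rightarrow> real) \<Rightarrow> int \<Rightarrow> real" where
  "fiber_sum n f z = f z + f (z + 3 ^ n) + f (z + 2 * 3 ^ n)"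

text \<open>For \<xi> divisible by 3 the character does not distinguish the three lifts of a
  residue. Shifting the summation by multiples of \<open>3 ^ n\<close> therefore turns three copies
  of the transform into one sum over fiber sums.\<close>

lemma residue_dft_fiber_sum_zero:
  assumes f: "periodic_mod (Suc n) f" and z: "\<And>z. fiber_sum n f z = 0" and \<xi>: "3 dvd \<xi>"
  shows "residue_dft (Suc n) f \<xi> = 0"
proof -
  let ?R = "{0..<3 ^ Suc n} :: int set"
  have per: "periodic_mod (Suc n) (\<lambda>z. of_real (f z) * phase (Suc n) (\<xi> * z))"
    unfolding periodic_mod_def using periodic_modD[OF f] phase_cong cong_mult[OF cong_refl] by metis
  have ph: "phase (Suc n) (\<xi> * (z + k * 3 ^ n)) = phase (Suc n) (\<xi> * z)" for z k
  proof (rule phase_cong)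
    obtain c where "\<xi> = 3 * c" using \<xi> by blast
    then have "\<xi> * (z + k * 3 ^ n) - \<xi> * z = 3 ^ Suc n * (c * k)" by (simp add: algebra_simps)
    then show "[\<xi> * (z + k * 3 ^ n) = \<xi> * z] (mod 3 ^ Suc n)"
      unfolding cong_iff_dvd_diff by (metis dvd_triv_left)
  qed
  have sh: "(\<Sum>z\<in>?R. of_real (f (z + k * 3 ^ n)) * phase (Suc n) (\<xi> * z)) = residue_dft (Suc n) f \<xi>" for k
    using sum_residues_shift[OF per, of "k * 3 ^ n"] unfolding ph residue_dft_def .
  have "3 * residue_dft (Suc n) f \<xi> = (\<Sum>z\<in>?R. of_real (f (z + 0 * 3 ^ n)) * phase (Suc n) (\<xi> * z))
      + (\<Sum>z\<in>?R. of_real (f (z + 1 * 3 ^ n)) * phase (Suc n) (\<xi> * z))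
      + (\<Sum>z\<in>?R. of_real (f (z + 2 * 3 ^ n)) * phase (Suc n) (\<xi> * z))"
    unfolding sh by simp
  also have "\<dots> = (\<Sum>z\<in>?R. of_real (fiber_sum n f z) * phase (Suc n) (\<xi> * z))"
    by (simp only: sum.distrib[symmetric] fiber_sum_def of_real_add distrib_right mult_zero_left mult_1 add_0_right)
  finally show ?thesis by (simp add: z)
qed

text \<open>\<open>u\<close> is the convolution of \<open>f\<close> with the law of
  \<open>- (3 ^ m) * x\<close> for \<open>x\<close> Syracuse of level \<open>Suc n - m\<close>, so
  its transform is that of \<open>f\<close> times a value of \<open>syrac_char\<close>. Parseval
  applies to both, and the frequencies divisible by 3, which \<open>char_sup\<close> does not
  control, drop out.\<close>

lemma syrac_convolution_l2_bound:
  fixes f :: "int \<Rightarrow> real"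
  assumes f: "periodic_mod (Suc n) f" and z: "\<And>z. fiber_sum n f z = 0" and m: "m \<le> Suc n"
  defines "u \<equiv> \<lambda>z. syrac_exp (Suc n - m) (\<lambda>x. f (z + 3 ^ m * x))"
  shows "(\<Sum>z\<in>{0..<3 ^ Suc n}. (u z)\<^sup>2) \<le> (char_sup (Suc n - m))\<^sup>2 * (\<Sum>z\<in>{0..<3 ^ Suc n}. (f z)\<^sup>2)"
proof -
  let ?N = "Suc n" let ?R = "{0..<3 ^ ?N} :: int set"
  have dft: "residue_dft ?N u \<xi> = residue_dft ?N f \<xi> * syrac_char (?N - m) (- \<xi>)" for \<xi>
  proof -
    have per: "periodic_mod ?N (\<lambda>y. of_real (f y) * phase ?N (\<xi> * (y - a)))" for a
      unfolding periodic_mod_def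
      using periodic_modD[OF f] phase_cong cong_mult[OF cong_refl cong_diff[OF _ cong_refl]] by metis
    have ph: "phase ?N (\<xi> * (3 ^ m * x)) = phase (?N - m) (\<xi> * x)" for x
    proof -
      have "phase ?N (3 ^ m * (\<xi> * x)) = phase (?N - m) (\<xi> * x)"
        using m by (simp add: phase_def power_diff del: power_Suc) (simp only: ac_simps)
      then show ?thesis by (simp add: ac_simps)
    qed
    have "residue_dft ?N u \<xi> = (\<Sum>z\<in>?R. syrac_exp (?N - m) (\<lambda>x. of_real (f (z + 3 ^ m * x)) * phase ?N (\<xi> * z)))"
      unfolding residue_dft_def u_def
      by (intro sum.cong refl)
        (simp add: syrac_exp_sum sum_distrib_right scaleR_conv_of_real mult.assoc)
    also have "\<dots> = syrac_exp (?N - m) (\<lambda>x. \<Sum>z\<in>?R. of_real (f (z + 3 ^ m * x)) * phase ?N (\<xi> * z))"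
      by (rule syrac_exp_swap_sum[symmetric])
    also have "\<dots> = syrac_exp (?N - m) (\<lambda>x. residue_dft ?N f \<xi> * phase (?N - m) (- \<xi> * x))"
    proof -
      have "(\<Sum>z\<in>?R. of_real (f (z + 3 ^ m * x)) * phase ?N (\<xi> * z))
          = residue_dft ?N f \<xi> * phase (?N - m) (- \<xi> * x)" for x
      proof -
        have "(\<Sum>z\<in>?R. of_real (f (z + 3 ^ m * x)) * phase ?N (\<xi> * z))
            = (\<Sum>z\<in>?R. of_real (f z) * phase ?N (\<xi> * (z - 3 ^ m * x)))"
          using sum_residues_shift[OF per, of "3 ^ m * x" "3 ^ m * x"] by simp
        also have "\<dots> = (\<Sum>z\<in>?R. (of_real (f z) * phase ?N (\<xi> * z)) * phase (?N - m) (- \<xi> * x))"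
          by (intro sum.cong refl)
            (simp add: right_diff_distrib phase_diff phase_minus ph)
        finally show ?thesis by (simp add: residue_dft_def sum_distrib_right)
      qed
      then show ?thesis by simp
    qed
    finally show ?thesis by (simp add: syrac_exp_cmult syrac_char_def)
  qed
  have "(norm (residue_dft ?N u \<xi>))\<^sup>2 \<le> (char_sup (?N - m))\<^sup>2 * (norm (residue_dft ?N f \<xi>))\<^sup>2" for \<xi>
  proof (cases "3 dvd \<xi>")
    case True
    then show ?thesis using residue_dft_fiber_sum_zero[OF f z] dft by simp
  next
    case False
    then have "norm (syrac_char (?N - m) (- \<xi>)) \<le> char_sup (?N - m)"
      by (intro norm_syrac_char_le_sup) simp
    then have "(norm (residue_dft ?N f \<xi>) * norm (syrac_char (?N - m) (- \<xi>)))\<^sup>2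
        \<le> (norm (residue_dft ?N f \<xi>) * char_sup (?N - m))\<^sup>2"
      by (intro power_mono mult_left_mono) auto
    then show ?thesis by (simp add: dft norm_mult power_mult_distrib mult.commute)
  qed
  then have "(\<Sum>\<xi>\<in>?R. (norm (residue_dft ?N u \<xi>))\<^sup>2)
      \<le> (char_sup (?N - m))\<^sup>2 * (\<Sum>\<xi>\<in>?R. (norm (residue_dft ?N f \<xi>))\<^sup>2)"
    unfolding sum_distrib_left by (intro sum_mono)
  then have "3 ^ ?N * (\<Sum>z\<in>?R. (u z)\<^sup>2) \<le> 3 ^ ?N * ((char_sup (?N - m))\<^sup>2 * (\<Sum>z\<in>?R. (f z)\<^sup>2))"
    unfolding residue_dft_parseval by (simp only: ac_simps)
  then show ?thesis by (rule mult_left_le_imp_le) simp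
qed

section \<open>Mixing between consecutive scales\<close>

text \<open>Words of \<open>h\<close> tosses are sorted into those with large value, those with too
  many heads to keep the level at \<open>n1\<close>, and for each \<open>m\<close> the good ones
  with \<open>m\<close> heads. Good words with equal \<open>m\<close> have distinct residues, so
  Cauchy--Schwarz runs over at most \<open>2 ^ h\<close> of the \<open>3 ^ Suc n\<close>
  residues.\<close>

lemma syrac_exp_pow2_bound:
  "\<exists>C\<ge>0. \<forall>n h n1. \<forall>f :: int \<Rightarrow> real. periodic_mod (Suc n) f \<longrightarrow> (\<forall>z. fiber_sum n f z = 0) \<longrightarrow>
     (\<forall>z. \<bar>f z\<bar> \<le> 2) \<longrightarrow> n1 \<le> Suc n \<longrightarrow>
     \<bar>syrac_exp (Suc n) (\<lambda>x. f (2 ^ h * x))\<bar> \<le> C * sqrt (2 ^ h / 3 ^ Suc n)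
       + 2 * ((3 / 2) ^ h / 2 ^ (Suc n - n1)) + real (n + 2) * (2 * char_sup n1 * sqrt (3 ^ Suc n / 2 ^ h))"
proof -
  obtain C where C: "C \<ge> 0"
    "\<And>h n. real (card {w \<in> words h. 3 ^ n \<le> word_val w}) \<le> C * 2 ^ h * sqrt (2 ^ h / 3 ^ n)"
    using card_words_large_val by blast
  have "\<bar>syrac_exp (Suc n) (\<lambda>x. f (2 ^ h * x))\<bar> \<le> 2 * C * sqrt (2 ^ h / 3 ^ Suc n)
       + 2 * ((3 / 2) ^ h / 2 ^ (Suc n - n1)) + real (n + 2) * (2 * char_sup n1 * sqrt (3 ^ Suc n / 2 ^ h))"
    if f: "periodic_mod (Suc n) f" and fz: "\<And>z. fiber_sum n f z = 0" and f2: "\<And>z. \<bar>f z\<bar> \<le> 2" and n1: "n1 \<le> Suc n"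
    for n h n1 and f :: "int \<Rightarrow> real"
  proof -
    let ?N = "Suc n"
    define M where "M = ?N - n1"
    define u where "u m z = syrac_exp (?N - m) (\<lambda>x. f (z + 3 ^ m * x))" for m z
    define U where "U w = u (count_list w True) (word_val w)" for w
    define B1 where "B1 = {w \<in> words h. 3 ^ ?N \<le> word_val w}"
    define B2 where "B2 = {w \<in> words h. M < count_list w True}"
    define G where "G m = {w \<in> words h. count_list w True = m \<and> word_val w < 3 ^ ?N}" for m
    have fin: "finite B1" "finite B2" "finite (G m)" for m by (simp_all add: B1_def B2_def G_def)
    have u2: "\<bar>u m z\<bar> \<le> 2" for m z
      unfolding u_def using norm_syrac_exp_le[of "\<lambda>x. f (z + 3 ^ m * x)" 2] f2 by simp
    have b1: "(\<Sum>w\<in>B1. \<bar>U w\<bar>) \<le> 2 * (C * 2 ^ h * sqrt (2 ^ h / 3 ^ ?N))"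
    proof -
      have "(\<Sum>w\<in>B1. \<bar>U w\<bar>) \<le> (\<Sum>w\<in>B1. 2)" by (intro sum_mono) (simp add: U_def u2)
      also have "\<dots> = 2 * real (card B1)" by simp
      finally show ?thesis using C(2)[of h ?N] unfolding B1_def by linarith
    qed
    have b2: "(\<Sum>w\<in>B2. \<bar>U w\<bar>) \<le> 2 * (3 ^ h / 2 ^ M)"
    proof -
      have "(\<Sum>w\<in>B2. \<bar>U w\<bar>) \<le> (\<Sum>w\<in>B2. 2)" by (intro sum_mono) (simp add: U_def u2)
      also have "\<dots> = 2 * real (card B2)" by simp
      finally show ?thesis using card_words_many_heads[of h M] unfolding B2_def by linarith
    qed
    have g: "(\<Sum>w\<in>G m. \<bar>U w\<bar>) \<le> 2 * char_sup n1 * sqrt (3 ^ ?N * 2 ^ h)" if m: "m \<le> M" for m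
    proof -
      let ?Z = "word_val ` G m"
      have inj: "inj_on word_val (G m)"
        by (rule inj_onI) (auto simp: G_def words_def intro: word_val_inj)
      have Z: "?Z \<subseteq> {0..<3 ^ ?N}" using word_val_nonneg by (auto simp: G_def)
      have "card ?Z \<le> card (words h)"
        unfolding card_image[OF inj] by (rule card_mono) (auto simp: G_def)
      then have cZ: "real (card ?Z) \<le> 2 ^ h" by (simp add: card_words)
      have mN: "m \<le> ?N" using m by (simp add: M_def)
      have "(\<Sum>w\<in>G m. \<bar>U w\<bar>) = (\<Sum>w\<in>G m. \<bar>u m (word_val w)\<bar>)"
        by (intro sum.cong refl) (simp add: U_def G_def)
      also have "\<dots> = (\<Sum>z\<in>?Z. \<bar>u m z\<bar>)" by (simp add: sum.reindex[OF inj])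
      finally have eq: "(\<Sum>w\<in>G m. \<bar>U w\<bar>) = (\<Sum>z\<in>?Z. \<bar>u m z\<bar>)" .
      have "(\<Sum>z\<in>?Z. \<bar>u m z\<bar>)\<^sup>2 \<le> (\<Sum>z\<in>?Z. \<bar>u m z\<bar>\<^sup>2) * card ?Z"
        by (rule sum_squared_le_sum_of_squares)
      also have "\<dots> \<le> (\<Sum>z\<in>{0..<3 ^ ?N}. (u m z)\<^sup>2) * 2 ^ h"
        using Z cZ by (intro mult_mono) (auto intro!: sum_mono2 sum_nonneg)
      also have "(\<Sum>z\<in>{0..<3 ^ ?N}. (u m z)\<^sup>2) \<le> (char_sup (?N - m))\<^sup>2 * (\<Sum>z\<in>{0..<3 ^ ?N}. (f z)\<^sup>2)"
        unfolding u_def by (rule syrac_convolution_l2_bound[OF f fz mN])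
      also have "\<dots> \<le> (char_sup n1)\<^sup>2 * (4 * 3 ^ ?N)"
      proof (rule mult_mono)
        have "char_sup (?N - m) \<le> char_sup n1" using m n1 by (intro char_sup_antimono) (simp add: M_def)
        then show "(char_sup (?N - m))\<^sup>2 \<le> (char_sup n1)\<^sup>2" by (intro power_mono char_sup_nonneg)
        have "(f z)\<^sup>2 \<le> 2\<^sup>2" for z using f2[of z] abs_le_square_iff[of "f z" 2] by simp
        then have "(\<Sum>z\<in>{0..<3 ^ ?N}. (f z)\<^sup>2) \<le> (\<Sum>z\<in>{0..<3 ^ ?N :: int}. 4)" by (intro sum_mono) simp
        then show "(\<Sum>z\<in>{0..<3 ^ ?N}. (f z)\<^sup>2) \<le> 4 * 3 ^ ?N" by simp
      qed (simp_all add: sum_nonneg)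
      finally have "(\<Sum>z\<in>?Z. \<bar>u m z\<bar>)\<^sup>2 \<le> (char_sup n1)\<^sup>2 * (4 * 3 ^ ?N) * 2 ^ h" by simp
      also have "\<dots> = (2 * char_sup n1 * sqrt (3 ^ ?N * 2 ^ h))\<^sup>2"
        by (simp only: power_mult_distrib) simp
      finally show ?thesis unfolding eq
        by (rule power2_le_imp_le) (simp add: char_sup_nonneg)
    qed
    have un: "(\<Sum>w\<in>A \<union> B. \<bar>U w\<bar>) \<le> (\<Sum>w\<in>A. \<bar>U w\<bar>) + (\<Sum>w\<in>B. \<bar>U w\<bar>)"
      if "finite A" "finite B" for A B
      using sum_Un[OF that, of "\<lambda>w. \<bar>U w\<bar>"] sum_nonneg[of "A \<inter> B" "\<lambda>w. \<bar>U w\<bar>"] by simp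
    have "words h \<subseteq> B1 \<union> B2 \<union> (\<Union>m\<in>{..M}. G m)"
      by (auto simp: B1_def B2_def G_def)
    then have "(\<Sum>w\<in>words h. \<bar>U w\<bar>) \<le> (\<Sum>w\<in>B1 \<union> B2 \<union> (\<Union>m\<in>{..M}. G m). \<bar>U w\<bar>)"
      using fin by (intro sum_mono2) auto
    also have "\<dots> \<le> (\<Sum>w\<in>B1 \<union> B2. \<bar>U w\<bar>) + (\<Sum>w\<in>(\<Union>m\<in>{..M}. G m). \<bar>U w\<bar>)"
      using fin by (intro un) auto
    also have "(\<Sum>w\<in>B1 \<union> B2. \<bar>U w\<bar>) \<le> (\<Sum>w\<in>B1. \<bar>U w\<bar>) + (\<Sum>w\<in>B2. \<bar>U w\<bar>)"
      using fin by (intro un) auto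
    also have "(\<Sum>w\<in>(\<Union>m\<in>{..M}. G m). \<bar>U w\<bar>) = (\<Sum>m\<in>{..M}. \<Sum>w\<in>G m. \<bar>U w\<bar>)"
      using fin by (intro sum.UNION_disjoint) (auto simp: G_def)
    also have "\<dots> \<le> (\<Sum>m\<in>{..M}. 2 * char_sup n1 * sqrt (3 ^ ?N * 2 ^ h))"
      using g by (intro sum_mono) auto
    also have "\<dots> \<le> real (n + 2) * (2 * char_sup n1 * sqrt (3 ^ ?N * 2 ^ h))"
      by (simp add: M_def char_sup_nonneg mult_right_mono)
    finally have sum: "(\<Sum>w\<in>words h. \<bar>U w\<bar>) \<le> 2 * (C * 2 ^ h * sqrt (2 ^ h / 3 ^ ?N)) + 2 * (3 ^ h / 2 ^ M)
        + real (n + 2) * (2 * char_sup n1 * sqrt (3 ^ ?N * 2 ^ h))"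
      using b1 b2 by simp
    have "\<bar>syrac_exp ?N (\<lambda>x. f (2 ^ h * x))\<bar> = \<bar>\<Sum>w\<in>words h. U w\<bar> / 2 ^ h"
      using syrac_exp_words[OF f, of h] by (simp add: U_def u_def)
    also have "\<dots> \<le> (\<Sum>w\<in>words h. \<bar>U w\<bar>) / 2 ^ h"
      by (intro divide_right_mono sum_abs) simp
    also have "\<dots> \<le> (2 * (C * 2 ^ h * sqrt (2 ^ h / 3 ^ ?N)) + 2 * (3 ^ h / 2 ^ M)
        + real (n + 2) * (2 * char_sup n1 * sqrt (3 ^ ?N * 2 ^ h))) / 2 ^ h"
      by (intro divide_right_mono sum) simp
    also have "\<dots> = 2 * C * sqrt (2 ^ h / 3 ^ ?N) + 2 * ((3 / 2) ^ h / 2 ^ M)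
        + real (n + 2) * (2 * char_sup n1 * (sqrt (3 ^ ?N * 2 ^ h) / 2 ^ h))"
      by (simp add: add_divide_distrib power_divide)
    also have "sqrt (3 ^ ?N * 2 ^ h) / 2 ^ h = sqrt (3 ^ ?N / 2 ^ h)"
    proof -
      have "sqrt (2 ^ h * 2 ^ h) = (2 ^ h :: real)" by (simp only: real_sqrt_abs2) simp
      then have "sqrt (3 ^ ?N * 2 ^ h) / 2 ^ h = sqrt (3 ^ ?N * 2 ^ h) / sqrt (2 ^ h * 2 ^ h)" by (simp only:)
      also have "\<dots> = sqrt (3 ^ ?N / 2 ^ h)"
        by (simp only: real_sqrt_divide[symmetric]) simp
      finally show ?thesis .
    qed
    finally show ?thesis by (simp only: M_def)
  qed
  moreover have "0 \<le> 2 * C" using C(1) by simp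
  ultimately show ?thesis by blast
qed

text \<open>Multiplication by a number coprime to 3 permutes the lifts within a fiber, since it
  fixes or swaps the two nonzero residues modulo 3.\<close>

lemma fiber_sum_half_mod_pow:
  assumes f: "periodic_mod (Suc n) f" and fz: "\<And>z. fiber_sum n f z = 0"
  shows "fiber_sum n (\<lambda>z. f (half_mod (Suc n) ^ h * z)) z = 0"
proof -
  define a where "a = half_mod (Suc n) ^ h"
  have cong: "f (a * (z + k * 3 ^ n)) = f (a * z + j * 3 ^ n)" if "[a * k = j] (mod 3)" for k j
  proof (rule periodic_modD[OF f])
    have "[3 ^ n * (a * k) = 3 ^ n * j] (mod 3 ^ n * 3)"
      using that by (simp add: cong_cmult_leftI cong_def mult_mod_right[symmetric])
    then have "[a * z + 3 ^ n * (a * k) = a * z + 3 ^ n * j] (mod 3 ^ Suc n)"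
      by (intro cong_add cong_refl) (simp add: mult.commute)
    then show "[a * (z + k * 3 ^ n) = a * z + j * 3 ^ n] (mod 3 ^ Suc n)"
      by (simp add: algebra_simps)
  qed
  have "\<not> 3 dvd a" using not_3_dvd_half_mod_mult[of "Suc n" 1 h] by (simp add: a_def)
  then have "a mod 3 = 1 \<or> a mod 3 = 2" by presburger
  moreover have red: "[a * k = (a mod 3) * k] (mod 3)" for k
    by (simp add: cong_def mod_mult_left_eq)
  have "[a * 1 = 1] (mod 3) \<and> [a * 2 = 2] (mod 3)" if "a mod 3 = 1"
    using red[of 1] red[of 2] that by (simp add: cong_def)
  moreover have "[a * 1 = 2] (mod 3) \<and> [a * 2 = 1] (mod 3)" if "a mod 3 = 2"
    using red[of 1] red[of 2] that by (simp add: cong_def)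
  ultimately consider "[a * 1 = 1] (mod 3)" "[a * 2 = 2] (mod 3)" | "[a * 1 = 2] (mod 3)" "[a * 2 = 1] (mod 3)"
    by blast
  then show ?thesis
  proof cases
    case 1
    then show ?thesis using cong[OF 1(1)] cong[OF 1(2)] fz[of "a * z"]
      by (simp add: fiber_sum_def a_def)
  next
    case 2
    then show ?thesis using cong[OF 2(1)] cong[OF 2(2)] fz[of "a * z"]
      by (simp add: fiber_sum_def a_def)
  qed
qed

text \<open>Since 2 is invertible, \<open>f x\<close> can be written as
  \<open>f' (2 ^ h * x)\<close>, and \<open>f'\<close> inherits the hypotheses. This introduces
  \<open>h\<close> tosses for a given \<open>f\<close>.\<close>

lemma syrac_exp_fiber_sum_zero_bound:
  "\<exists>C\<ge>0. \<forall>n h n1. \<forall>f :: int \<Rightarrow> real. periodic_mod (Suc n) f \<longrightarrow> (\<forall>z. fiber_sum n f z = 0) \<longrightarrow>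
     (\<forall>z. \<bar>f z\<bar> \<le> 2) \<longrightarrow> n1 \<le> Suc n \<longrightarrow>
     \<bar>syrac_exp (Suc n) f\<bar> \<le> C * sqrt (2 ^ h / 3 ^ Suc n)
       + 2 * ((3 / 2) ^ h / 2 ^ (Suc n - n1)) + real (n + 2) * (2 * char_sup n1 * sqrt (3 ^ Suc n / 2 ^ h))"
proof -
  obtain C where C: "C \<ge> 0" "\<forall>n h n1. \<forall>f :: int \<Rightarrow> real. periodic_mod (Suc n) f \<longrightarrow> (\<forall>z. fiber_sum n f z = 0) \<longrightarrow>
     (\<forall>z. \<bar>f z\<bar> \<le> 2) \<longrightarrow> n1 \<le> Suc n \<longrightarrow>
     \<bar>syrac_exp (Suc n) (\<lambda>x. f (2 ^ h * x))\<bar> \<le> C * sqrt (2 ^ h / 3 ^ Suc n)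
       + 2 * ((3 / 2) ^ h / 2 ^ (Suc n - n1)) + real (n + 2) * (2 * char_sup n1 * sqrt (3 ^ Suc n / 2 ^ h))"
    using syrac_exp_pow2_bound by blast
  show ?thesis
  proof (intro exI[of _ C] conjI C(1) allI impI)
    fix n h n1 and f :: "int \<Rightarrow> real"
    assume f: "periodic_mod (Suc n) f" and fz: "\<forall>z. fiber_sum n f z = 0"
      and f2: "\<forall>z. \<bar>f z\<bar> \<le> 2" and n1: "n1 \<le> Suc n"
    define f' where "f' z = f (half_mod (Suc n) ^ h * z)" for z
    have eq: "f' (2 ^ h * x) = f x" for x
    proof -
      have "[half_mod (Suc n) ^ h * (2 ^ h * x) = x] (mod 3 ^ Suc n)"
      proof -
        have "half_mod (Suc n) ^ h * (2 ^ h * x) = (2 * half_mod (Suc n)) ^ h * x"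
          by (simp add: power_mult_distrib mult.assoc mult.left_commute)
        also have "[\<dots> = 1 ^ h * x] (mod 3 ^ Suc n)"
          by (intro cong_mult cong_pow cong_refl cong_two_half_mod)
        finally show ?thesis by simp
      qed
      then show ?thesis unfolding f'_def by (rule periodic_modD[OF f])
    qed
    have p1: "periodic_mod (Suc n) f'"
      unfolding f'_def periodic_mod_def using periodic_modD[OF f] cong_mult[OF cong_refl] by blast
    have p2: "fiber_sum n f' z = 0" for z
      unfolding f'_def by (rule fiber_sum_half_mod_pow[OF f]) (use fz in blast)
    have p3: "\<bar>f' z\<bar> \<le> 2" for z using f2 by (simp add: f'_def)
    show "\<bar>syrac_exp (Suc n) f\<bar> \<le> C * sqrt (2 ^ h / 3 ^ Suc n)
       + 2 * ((3 / 2) ^ h / 2 ^ (Suc n - n1)) + real (n + 2) * (2 * char_sup n1 * sqrt (3 ^ Suc n / 2 ^ h))"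
      using C(2)[rule_format, OF p1 p2 p3 n1, of h] unfolding eq .
  qed
qed

lemma ex_pow2_between:
  fixes x :: real
  assumes "1 \<le> x"
  shows "\<exists>h. 2 ^ h \<le> x \<and> x < 2 * 2 ^ h"
proof -
  define h where "h = nat \<lfloor>log 2 x\<rfloor>"
  have "0 \<le> log 2 x" using assms by simp
  then have h: "real h \<le> log 2 x" "log 2 x < real h + 1" by (auto simp: h_def)
  have "2 powr real h \<le> x" using h(1) assms by (simp add: le_log_iff)
  moreover have "x < 2 powr (real h + 1)" using h(2) assms by (simp add: log_less_iff)
  ultimately show ?thesis by (intro exI[of _ h]) (simp add: powr_realpow powr_add)
qed

lemma syrac_exp_fiber_sum_zero_decay:
  "\<exists>C. \<forall>n. \<forall>f :: int \<Rightarrow> real. periodic_mod (Suc n) f \<longrightarrow> (\<forall>z. fiber_sum n f z = 0) \<longrightarrow> (\<forall>z. \<bar>f z\<bar> \<le> 2) \<longrightarrow>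
     \<bar>syrac_exp (Suc n) f\<bar> * real (Suc n) ^ B \<le> C"
proof -
  obtain C1 where C1: "C1 \<ge> 0" "\<forall>n h n1. \<forall>f :: int \<Rightarrow> real. periodic_mod (Suc n) f \<longrightarrow> (\<forall>z. fiber_sum n f z = 0) \<longrightarrow>
     (\<forall>z. \<bar>f z\<bar> \<le> 2) \<longrightarrow> n1 \<le> Suc n \<longrightarrow>
     \<bar>syrac_exp (Suc n) f\<bar> \<le> C1 * sqrt (2 ^ h / 3 ^ Suc n)
       + 2 * ((3 / 2) ^ h / 2 ^ (Suc n - n1)) + real (n + 2) * (2 * char_sup n1 * sqrt (3 ^ Suc n / 2 ^ h))"
    using syrac_exp_fiber_sum_zero_bound by blast
  \<comment> \<open>The third term loses a factor of order \<open>N\<close> for the number of head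
    counts, \<open>N ^ B\<close> in the square root, and \<open>N ^ B\<close> for the claim itself;
    hence the exponent \<open>2 * B + 1\<close>.\<close>
  obtain C2 where C2: "\<And>n. char_sup n * real n ^ (2 * B + 1) \<le> C2"
    using char_sup_superpolynomial by blast
  have C20: "0 \<le> C2" using C2[of 0] by simp
  define q :: real where "q = 2 powr (-7 / 200)"
  have "2 powr (-7 / 200) < (2::real) powr 0" by (rule powr_less_mono) auto
  then have q: "0 < q" "q < 1" by (auto simp: q_def)
  obtain C3 where C3: "\<And>n. real n ^ B * q ^ n \<le> C3" using bounded_power_times_geometric[OF q] by blast
  obtain C4 where C4: "\<And>n. real n ^ (2 * B + 1) * (1 / 3) ^ n \<le> C4"
    using bounded_power_times_geometric[of "1 / 3" "2 * B + 1"] by auto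
  \<comment> \<open>Ensures \<open>N div 200 \<ge> 1\<close> and, through \<open>C4\<close>,
    \<open>N ^ (2 * B) \<le> 3 ^ N\<close>, so that a power of 2 below \<open>x\<close>
    exists.\<close>
  define N0 where "N0 = max 200 (nat \<lceil>C4\<rceil>)"
  define K where "K = max (2 * real N0 ^ B) (C1 + 2 * C3 + 8 * (400 ^ (2 * B + 1) * C2))"
  have "\<bar>syrac_exp (Suc n) f\<bar> * real (Suc n) ^ B \<le> K"
    if f: "periodic_mod (Suc n) f" and fz: "\<forall>z. fiber_sum n f z = 0" and f2: "\<forall>z. \<bar>f z\<bar> \<le> 2"
    for n and f :: "int \<Rightarrow> real"
  proof (cases "Suc n < N0")
    case True
    have "\<bar>syrac_exp (Suc n) f\<bar> \<le> 2" using norm_syrac_exp_le[of f 2] f2 by simp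
    moreover have "real (Suc n) ^ B \<le> real N0 ^ B" using True by (intro power_mono) auto
    ultimately have "\<bar>syrac_exp (Suc n) f\<bar> * real (Suc n) ^ B \<le> 2 * real N0 ^ B"
      by (intro mult_mono) auto
    then show ?thesis by (simp add: K_def)
  next
    case False
    define N where "N = Suc n"
    have "N0 \<le> N" using False by (simp add: N_def)
    then have "200 \<le> N" "nat \<lceil>C4\<rceil> \<le> N" unfolding N0_def by (simp_all only: max.bounded_iff)
    then have N: "200 \<le> N" "C4 \<le> real N" using real_nat_ceiling_ge[of C4] by auto
    define Y where "Y = real N ^ B"
    have Y: "1 \<le> Y" using N by (simp add: Y_def)
    have YY: "real N ^ (2 * B) = Y\<^sup>2" by (simp add: Y_def power_mult[symmetric] mult.commute)
    \<comment> \<open>\<open>2 ^ h\<close> is taken within a factor 2 of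
      \<open>3 ^ N / N ^ (2 * B)\<close>: small enough for the first term to be of order
      \<open>1 / N ^ B\<close>, large enough for the square root in the third to be at most
      \<open>2 * N ^ B\<close>.\<close>
    define x where "x = 3 ^ N / Y\<^sup>2"
    have "1 \<le> x"
    proof -
      have "real N * Y\<^sup>2 * (1 / 3) ^ N \<le> real N"
        using order_trans[OF C4[of N] N(2)] by (simp add: YY[symmetric])
      then have "real N * (Y\<^sup>2 * (1 / 3) ^ N) \<le> real N * 1" by (simp only: mult.assoc mult_1_right)
      then have "Y\<^sup>2 * (1 / 3) ^ N \<le> 1" using N by (simp only: mult_le_cancel_left_pos)
      then show ?thesis using Y by (simp add: x_def field_simps power_divide)
    qed
    then obtain h where h: "2 ^ h \<le> x" "x < 2 * 2 ^ h" using ex_pow2_between by blast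
    define n1 where "n1 = N div 200"
    have main: "\<bar>syrac_exp N f\<bar> \<le> C1 * sqrt (2 ^ h / 3 ^ N)
       + 2 * ((3 / 2) ^ h / 2 ^ (N - n1)) + real (n + 2) * (2 * char_sup n1 * sqrt (3 ^ N / 2 ^ h))"
      using C1(2) f fz f2 unfolding N_def by (simp add: n1_def N_def del: power_Suc)
    have t1: "sqrt (2 ^ h / 3 ^ N) * Y \<le> 1"
    proof -
      have "2 ^ h / 3 ^ N \<le> 1 / Y\<^sup>2" using h(1) Y by (simp add: x_def field_simps)
      then have "sqrt (2 ^ h / 3 ^ N) \<le> sqrt (1 / Y\<^sup>2)" by simp
      then show ?thesis using Y by (simp add: real_sqrt_divide field_simps)
    qed
    have t3: "sqrt (3 ^ N / 2 ^ h) \<le> 2 * Y"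
    proof -
      have "3 ^ N / 2 ^ h \<le> 2 * Y\<^sup>2" using h(2) Y by (simp add: x_def field_simps)
      also have "\<dots> \<le> (2 * Y)\<^sup>2" by (simp add: power_mult_distrib)
      finally have "3 ^ N / 2 ^ h \<le> (2 * Y)\<^sup>2" .
      then show ?thesis using Y by (intro real_le_lsqrt) auto
    qed
    have t2: "(3 / 2) ^ h / 2 ^ (N - n1) * Y \<le> C3"
    proof -
      have "x \<le> 3 ^ N" using Y by (simp add: x_def divide_le_eq)
      then have "2 ^ h \<le> (3::real) ^ N" using h(1) by linarith
      then have "(3 / 2 :: real) ^ h \<le> 2 powr (24 / 25 * N)" by (rule three_halves_pow_le)
      then have "(3 / 2) ^ h / 2 ^ (N - n1) \<le> 2 powr (24 / 25 * N) / 2 powr (real N - real n1)"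
        by (simp add: powr_realpow[symmetric] of_nat_diff divide_right_mono n1_def)
      also have "\<dots> = 2 powr (24 / 25 * N - (real N - real n1))" by (rule powr_diff[symmetric])
      \<comment> \<open>The exponent is \<open>- N / 25 + n1\<close> with
        \<open>n1 \<le> N / 200\<close>.\<close>
      also have "\<dots> \<le> 2 powr (-7 / 200 * N)"
      proof (rule powr_mono)
        have "200 * n1 \<le> N" by (simp add: n1_def)
        then have "real n1 \<le> real N / 200" by simp
        then show "24 / 25 * N - (real N - real n1) \<le> -7 / 200 * N" by linarith
      qed simp
      also have "\<dots> = q ^ N" by (simp add: q_def powr_power mult.commute)
      finally have "(3 / 2) ^ h / 2 ^ (N - n1) * Y \<le> q ^ N * Y" using Y by (intro mult_right_mono) auto
      also have "\<dots> \<le> C3" using C3[of N] by (simp add: Y_def mult.commute)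
      finally show ?thesis .
    qed
    have t4: "char_sup n1 * real N ^ (2 * B + 1) \<le> 400 ^ (2 * B + 1) * C2"
    proof -
      have "N = 200 * n1 + N mod 200" "N mod 200 < 200" by (simp_all add: n1_def)
      moreover have "1 \<le> n1" using div_le_mono[OF N(1), of 200] by (simp add: n1_def)
      ultimately have "N \<le> 400 * n1" by linarith
      then have "real N \<le> 400 * real n1" by linarith
      then have "real N ^ (2 * B + 1) \<le> (400 * real n1) ^ (2 * B + 1)" by (intro power_mono) auto
      then have "char_sup n1 * real N ^ (2 * B + 1) \<le> char_sup n1 * (400 * real n1) ^ (2 * B + 1)"
        by (intro mult_left_mono char_sup_nonneg)
      also have "\<dots> = 400 ^ (2 * B + 1) * (char_sup n1 * real n1 ^ (2 * B + 1))"
        by (simp only: power_mult_distrib ac_simps)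
      also have "\<dots> \<le> 400 ^ (2 * B + 1) * C2" using C2 by (intro mult_left_mono) auto
      finally show ?thesis .
    qed
    have t5: "real (n + 2) * (2 * char_sup n1 * sqrt (3 ^ N / 2 ^ h)) * Y \<le> 8 * (400 ^ (2 * B + 1) * C2)"
    proof -
      have "real (n + 2) * (2 * char_sup n1 * sqrt (3 ^ N / 2 ^ h)) * Y \<le> (2 * real N) * (2 * char_sup n1 * (2 * Y)) * Y"
        using t3 Y char_sup_nonneg[of n1] by (intro mult_mono) (auto simp: N_def)
      also have "\<dots> = 8 * (char_sup n1 * (real N * Y\<^sup>2))" by (simp add: power2_eq_square)
      also have "real N * Y\<^sup>2 = real N ^ (2 * B + 1)" by (simp add: YY[symmetric])
      finally show ?thesis using t4 by linarith
    qed
    have "\<bar>syrac_exp N f\<bar> * Y \<le> (C1 * sqrt (2 ^ h / 3 ^ N)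
       + 2 * ((3 / 2) ^ h / 2 ^ (N - n1)) + real (n + 2) * (2 * char_sup n1 * sqrt (3 ^ N / 2 ^ h))) * Y"
      using main Y by (intro mult_right_mono) auto
    also have "\<dots> = C1 * (sqrt (2 ^ h / 3 ^ N) * Y) + 2 * ((3 / 2) ^ h / 2 ^ (N - n1) * Y)
        + real (n + 2) * (2 * char_sup n1 * sqrt (3 ^ N / 2 ^ h)) * Y"
      by (simp only: distrib_right mult.assoc)
    also have "\<dots> \<le> C1 * 1 + 2 * C3 + 8 * (400 ^ (2 * B + 1) * C2)"
      using t1 t2 t5 C1(1) by (intro add_mono mult_left_mono) auto
    also have "\<dots> \<le> K" by (simp add: K_def)
    finally show ?thesis by (simp only: Y_def N_def)
  qed
  then show ?thesis by blast
qed

section \<open>From expectations to the sum of absolute differences\<close>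

lemma periodic_mod_mono:
  assumes "periodic_mod m f" "m \<le> n"
  shows "periodic_mod n f"
  unfolding periodic_mod_def
proof (intro allI impI)
  fix x y :: int assume "[x = y] (mod 3 ^ n)"
  then have "[x = y] (mod 3 ^ m)" by (rule cong_dvd_modulus) (rule le_imp_power_dvd[OF assms(2)])
  then show "f x = f y" by (rule periodic_modD[OF assms(1)])
qed

lemma syrac_exp_project_le:
  assumes "periodic_mod m f" "m \<le> n"
  shows "syrac_exp n f = syrac_exp m f"
  using assms(2)
proof (induction n rule: dec_induct)
  case (step n)
  then show ?case using syrac_exp_project[OF periodic_mod_mono[OF assms(1)], of n] by simp
qed simp

text \<open>Extended periodically to the integers, so that the laws at different moduli can be
  compared at the same argument.\<close>

definition residue_prob :: "nat \<Rightarrow> int \<Rightarrow> real" where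
  "residue_prob n y = pmf (syrac_pmf n) (y mod 3 ^ n)"

lemma periodic_residue_prob: "periodic_mod n (residue_prob n)"
  by (auto simp: periodic_mod_def residue_prob_def cong_def)

lemma syrac_exp_residue_prob:
  fixes f :: "int \<Rightarrow> real"
  assumes "1 \<le> n"
  shows "syrac_exp n f = (\<Sum>y\<in>{0..<3 ^ n}. residue_prob n y * f y)"
  unfolding syrac_exp_sum_residues[OF assms] by (intro sum.cong refl) (simp add: residue_prob_def)

text \<open>The inner sum of the theorem is the expectation of an indicator that is periodic modulo
  \<open>3 ^ m\<close>, hence may be computed at level \<open>m\<close>.\<close>

lemma sum_pmf_residue_class:
  assumes "1 \<le> m" "m \<le> n"
  shows "(\<Sum>Y' | Y' \<in> {0..<3 ^ n} \<and> [Y' = Y] (mod 3 ^ m). pmf (syrac_pmf n) Y') = residue_prob m Y"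
proof -
  define g :: "int \<Rightarrow> real" where "g x = of_bool ([x = Y] (mod 3 ^ m))" for x
  have per: "periodic_mod m g"
    by (auto simp: periodic_mod_def g_def cong_def)
  have "(\<Sum>Y' | Y' \<in> {0..<3 ^ n} \<and> [Y' = Y] (mod 3 ^ m). pmf (syrac_pmf n) Y')
      = (\<Sum>Y'\<in>{0..<3 ^ n}. if [Y' = Y] (mod 3 ^ m) then pmf (syrac_pmf n) Y' else 0)"
    by (rule sum.inter_filter) simp
  also have "\<dots> = syrac_exp n g"
    unfolding syrac_exp_sum_residues[OF order_trans[OF assms]] g_def by (intro sum.cong refl) simp
  also have "\<dots> = syrac_exp m g" by (rule syrac_exp_project_le[OF per assms(2)])
  also have "\<dots> = (\<Sum>x\<in>{0..<3 ^ m}. if x = Y mod 3 ^ m then pmf (syrac_pmf m) x else 0)"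
    unfolding syrac_exp_sum_residues[OF assms(1)] g_def
    by (intro sum.cong refl) (auto simp: cong_def)
  also have "\<dots> = residue_prob m Y" by (simp add: residue_prob_def)
  finally show ?thesis .
qed

lemma sum_residues_Suc:
  fixes G :: "int \<Rightarrow> real"
  shows "(\<Sum>Y\<in>{0..<3 ^ Suc n}. G Y) = (\<Sum>y\<in>{0..<3 ^ n}. fiber_sum n G y)"
proof -
  define N :: int where "N = 3 ^ n"
  have N: "0 < N" by (simp add: N_def)
  have img: "(\<lambda>z. z + k * N) ` {0..<N} = {k * N..<(k + 1) * N}" for k
    using image_add_int_atLeastLessThan[of "k * N" "(k + 1) * N"] by (simp add: algebra_simps)
  have blk: "(\<Sum>z\<in>{k * N..<(k + 1) * N}. G z) = (\<Sum>z\<in>{0..<N}. G (z + k * N))" for k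
    unfolding img[symmetric] by (subst sum.reindex) (auto simp: inj_on_def)
  have "{0..<3 * N} = {0 * N..<(0 + 1) * N} \<union> ({1 * N..<(1 + 1) * N} \<union> {2 * N..<(2 + 1) * N})"
    using N by auto
  then have "(\<Sum>Y\<in>{0..<3 * N}. G Y) = (\<Sum>z\<in>{0 * N..<(0 + 1) * N}. G z)
      + ((\<Sum>z\<in>{1 * N..<(1 + 1) * N}. G z) + (\<Sum>z\<in>{2 * N..<(2 + 1) * N}. G z))"
    by (simp only:) (subst sum.union_disjoint; auto)+
  also have "\<dots> = (\<Sum>y\<in>{0..<N}. fiber_sum n G y)"
    unfolding blk by (simp add: fiber_sum_def N_def sum.distrib)
  finally show ?thesis by (simp add: N_def)
qed

text \<open>The left-hand side of the theorem once \<open>sum_pmf_residue_class\<close> has replaced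
  the class sums.\<close>

definition oscillation :: "nat \<Rightarrow> nat \<Rightarrow> real" where
  "oscillation m n = (\<Sum>Y\<in>{0..<3 ^ n}. \<bar>residue_prob n Y - residue_prob m Y / 3 ^ (n - m)\<bar>)"

text \<open>
  Duality: the oscillation is the expectation of the sign pattern minus its fiber average.
\<close>

lemma oscillation_Suc_decay: "\<exists>C. \<forall>n\<ge>1. oscillation n (Suc n) * real (Suc n) ^ B \<le> C"
proof -
  obtain C where C: "\<forall>n. \<forall>f :: int \<Rightarrow> real. periodic_mod (Suc n) f \<longrightarrow> (\<forall>z. fiber_sum n f z = 0) \<longrightarrow> (\<forall>z. \<bar>f z\<bar> \<le> 2) \<longrightarrow>
     \<bar>syrac_exp (Suc n) f\<bar> * real (Suc n) ^ B \<le> C"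
    using syrac_exp_fiber_sum_zero_decay by blast
  have "oscillation n (Suc n) * real (Suc n) ^ B \<le> C" if n: "1 \<le> n" for n
  proof -
    let ?N = "Suc n"
    have per_n: "periodic_mod ?N (residue_prob n)"
      by (rule periodic_mod_mono[OF periodic_residue_prob]) simp
    define f where "f Y = sgn (residue_prob ?N Y - residue_prob n Y / 3)" for Y
    have f: "periodic_mod ?N f"
      unfolding f_def periodic_mod_def
      by (intro allI impI arg_cong[where f = sgn] arg_cong2[where f = "(-)"] arg_cong2[where f = "(/)"] refl)
        (blast intro: periodic_modD[OF per_n] periodic_modD[OF periodic_residue_prob])+
    have f1: "\<bar>f Y\<bar> \<le> 1" for Y by (simp add: f_def sgn_if)
    define F where "F = fiber_sum n f"
    have wrap: "f (z + 3 * 3 ^ n + k) = f (z + k)" for z k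
      by (rule periodic_modD[OF f]) (simp add: cong_iff_dvd_diff)
    have F_shift: "F (z + 3 ^ n) = F z" for z
      using wrap[of z 0] by (simp add: F_def fiber_sum_def algebra_simps)
    have F_shift_nat: "F (z + int k * 3 ^ n) = F z" for z k
    proof (induction k)
      case (Suc k)
      then show ?case using F_shift[of "z + int k * 3 ^ n"] by (simp add: algebra_simps)
    qed simp
    have F: "periodic_mod n F"
      unfolding periodic_mod_def
    proof (intro allI impI)
      fix x y :: int assume "[x = y] (mod 3 ^ n)"
      then obtain k where "x - y = 3 ^ n * k" by (auto simp: cong_iff_dvd_diff)
      then have k: "x = y + k * 3 ^ n" by (simp add: algebra_simps)
      show "F x = F y"
      proof (cases "0 \<le> k")
        case True
        then show ?thesis using F_shift_nat[of y "nat k"] k by simp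
      next
        case False
        then show ?thesis using F_shift_nat[of x "nat (- k)"] k by simp
      qed
    qed
    \<comment> \<open>Subtracting the fiber average makes the fiber sums vanish; the bound 2 is 1
      for the sign and 1 for the average.\<close>
    define g where "g z = f z - F z / 3" for z
    have g: "periodic_mod ?N g"
      unfolding g_def periodic_mod_def
    proof (intro allI impI)
      fix x y :: int assume "[x = y] (mod 3 ^ ?N)"
      then have "f x = f y" "F x = F y"
        using periodic_modD[OF f] periodic_modD[OF periodic_mod_mono[OF F, of ?N]] by simp_all
      then show "f x - F x / 3 = f y - F y / 3" by simp
    qed
    have "fiber_sum n g z = 0" for z
      using F_shift[of z] F_shift_nat[of z 2]
      by (simp add: fiber_sum_def g_def) (simp add: F_def fiber_sum_def)
    moreover have "\<bar>g z\<bar> \<le> 2" for z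
    proof -
      have "\<bar>F z\<bar> \<le> 3" using f1[of z] f1[of "z + 3 ^ n"] f1[of "z + 2 * 3 ^ n"] by (simp add: F_def fiber_sum_def)
      then show ?thesis using f1[of z] by (simp add: g_def)
    qed
    moreover have "oscillation n ?N = syrac_exp ?N g"
    proof -
      have "oscillation n ?N = (\<Sum>Y\<in>{0..<3 ^ ?N}. residue_prob ?N Y * f Y - residue_prob n Y * f Y / 3)"
        unfolding oscillation_def by (intro sum.cong refl) (auto simp: f_def sgn_if abs_if)
      also have "\<dots> = syrac_exp ?N f - (\<Sum>Y\<in>{0..<3 ^ ?N}. residue_prob n Y * f Y) / 3"
        by (simp add: sum_subtractf sum_divide_distrib syrac_exp_residue_prob del: power_Suc)
      \<comment> \<open>\<open>residue_prob n\<close> is constant on fibers, so pairing it with the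
        sign pattern pairs the law at level \<open>n\<close> with \<open>F\<close>; projection then
        raises the level to \<open>Suc n\<close>.\<close>
      also have "(\<Sum>Y\<in>{0..<3 ^ ?N}. residue_prob n Y * f Y) = (\<Sum>y\<in>{0..<3 ^ n}. residue_prob n y * F y)"
      proof -
        have "residue_prob n (y + k * 3 ^ n) = residue_prob n y" for y k
          by (simp add: residue_prob_def)
        from this[of _ 1] this[of _ 2] show ?thesis
          unfolding sum_residues_Suc by (intro sum.cong refl) (simp add: fiber_sum_def F_def algebra_simps)
      qed
      also have "\<dots> = syrac_exp ?N F"
        using syrac_exp_residue_prob[OF n, of F] syrac_exp_project[OF F] by simp
      also have "syrac_exp ?N f - syrac_exp ?N F / 3 = syrac_exp ?N g"
        unfolding g_def using syrac_exp_add[of ?N f "\<lambda>z. (- 1 / 3) * F z"] syrac_exp_cmult[of ?N "- 1 / 3" F]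
        by simp
      finally show ?thesis .
    qed
    ultimately have "\<bar>oscillation n ?N\<bar> * real ?N ^ B \<le> C" using C g by simp
    moreover have "oscillation n ?N * real ?N ^ B \<le> \<bar>oscillation n ?N\<bar> * real ?N ^ B"
      by (intro mult_right_mono) auto
    ultimately show ?thesis by linarith
  qed
  then show ?thesis by blast
qed

text \<open>Level \<open>n\<close> is inserted as an intermediate stage. The error between
  \<open>m\<close> and \<open>n\<close> is periodic modulo \<open>3 ^ n\<close> and splits evenly
  among three lifts, so its sum is unchanged.\<close>

lemma oscillation_triangle:
  assumes "m \<le> n"
  shows "oscillation m (Suc n) \<le> oscillation n (Suc n) + oscillation m n"
proof -
  define d where "d Y = \<bar>residue_prob n Y - residue_prob m Y / 3 ^ (n - m)\<bar>" for Y
  have d: "fiber_sum n d y = 3 * d y" for y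
  proof -
    have "periodic_mod n (residue_prob m)" by (rule periodic_mod_mono[OF periodic_residue_prob assms])
    then have "d (y + k * 3 ^ n) = d y" for k
      unfolding d_def using periodic_modD[OF periodic_residue_prob[of n], of "y + k * 3 ^ n" y]
        periodic_modD[of n "residue_prob m" "y + k * 3 ^ n" y] by (simp add: cong_iff_dvd_diff)
    from this[of 1] this[of 2] show ?thesis by (simp add: fiber_sum_def)
  qed
  have "\<bar>residue_prob (Suc n) Y - residue_prob m Y / 3 ^ (Suc n - m)\<bar>
      \<le> \<bar>residue_prob (Suc n) Y - residue_prob n Y / 3 ^ (Suc n - n)\<bar> + d Y / 3" for Y
  proof -
    have split: "residue_prob (Suc n) Y - residue_prob m Y / 3 ^ (Suc n - m)
        = (residue_prob (Suc n) Y - residue_prob n Y / 3) + (residue_prob n Y - residue_prob m Y / 3 ^ (n - m)) / 3"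
      using assms by (simp add: Suc_diff_le field_simps)
    show ?thesis
      unfolding split
      using abs_triangle_ineq[of "residue_prob (Suc n) Y - residue_prob n Y / 3"
          "(residue_prob n Y - residue_prob m Y / 3 ^ (n - m)) / 3"] by (simp add: d_def)
  qed
  then have "oscillation m (Suc n) \<le> (\<Sum>Y\<in>{0..<3 ^ Suc n}.
      \<bar>residue_prob (Suc n) Y - residue_prob n Y / 3 ^ (Suc n - n)\<bar> + d Y / 3)"
    unfolding oscillation_def by (rule sum_mono)
  also have "\<dots> = oscillation n (Suc n) + (\<Sum>Y\<in>{0..<3 ^ Suc n}. d Y) / 3"
    by (simp only: sum.distrib oscillation_def sum_divide_distrib)
  also have "(\<Sum>Y\<in>{0..<3 ^ Suc n}. d Y) = 3 * (\<Sum>y\<in>{0..<3 ^ n}. d y)"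
    unfolding sum_residues_Suc d by (simp add: sum_distrib_left)
  finally show ?thesis by (simp add: oscillation_def d_def)
qed

lemma oscillation_le_sum:
  assumes "m \<le> n"
  shows "oscillation m n \<le> (\<Sum>k\<in>{m..<n}. oscillation k (Suc k))"
  using assms
proof (induction n rule: dec_induct)
  case base
  then show ?case by (simp add: oscillation_def)
next
  case (step n)
  then show ?case using oscillation_triangle[of m n] by simp
qed

lemma oscillation_decay: "\<exists>C\<ge>0. \<forall>m\<ge>1. \<forall>n\<ge>m. oscillation m n \<le> C / real m ^ B"
proof -
  \<comment> \<open>Two extra powers pay for the summation over all scales \<open>k \<ge> m\<close>,
    since the series of inverse squares converges.\<close>
  obtain C where C: "\<And>n. n \<ge> 1 \<Longrightarrow> oscillation n (Suc n) * real (Suc n) ^ (B + 2) \<le> C"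
    using oscillation_Suc_decay by blast
  define S where "S = (\<Sum>k. inverse (real (Suc k) ^ 2))"
  have smb: "summable (\<lambda>k. inverse (real (Suc k) ^ 2))"
    using inverse_power_summable[of 2, where 'a = real] by (subst summable_Suc_iff) simp
  have S0: "0 \<le> S" unfolding S_def by (rule suminf_nonneg[OF smb]) simp
  have "oscillation m n \<le> \<bar>C\<bar> * S / real m ^ B" if m: "1 \<le> m" "m \<le> n" for m n
  proof -
    have "oscillation k (Suc k) \<le> \<bar>C\<bar> / real m ^ B * inverse (real (Suc k) ^ 2)" if k: "k \<in> {m..<n}" for k
    proof -
      have "oscillation k (Suc k) * real (Suc k) ^ (B + 2) \<le> \<bar>C\<bar>" using C[of k] m k by fastforce
      then have "oscillation k (Suc k) \<le> \<bar>C\<bar> / real (Suc k) ^ (B + 2)"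
        by (subst pos_le_divide_eq) auto
      also have "\<dots> = \<bar>C\<bar> / real (Suc k) ^ B * inverse (real (Suc k) ^ 2)"
        by (simp only: power_add divide_inverse inverse_mult_distrib mult.assoc)
      also have "\<dots> \<le> \<bar>C\<bar> / real m ^ B * inverse (real (Suc k) ^ 2)"
        using m k by (intro mult_right_mono divide_left_mono power_mono mult_pos_pos) auto
      finally show ?thesis .
    qed
    then have "oscillation m n \<le> (\<Sum>k\<in>{m..<n}. \<bar>C\<bar> / real m ^ B * inverse (real (Suc k) ^ 2))"
      by (intro order_trans[OF oscillation_le_sum[OF m(2)] sum_mono])
    also have "\<dots> = \<bar>C\<bar> / real m ^ B * (\<Sum>k\<in>{m..<n}. inverse (real (Suc k) ^ 2))"
      by (rule sum_distrib_left[symmetric])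
    also have "\<dots> \<le> \<bar>C\<bar> / real m ^ B * S"
      unfolding S_def by (intro mult_left_mono sum_le_suminf[OF smb]) auto
    finally show ?thesis by simp
  qed
  moreover have "0 \<le> \<bar>C\<bar> * S" using S0 by simp
  ultimately show ?thesis by blast
qed

theorem proposition1p14:
  fixes A :: real
  assumes "A > 0"
  shows "\<exists>C :: real. \<forall>m n :: nat. 1 \<le> m \<and> m \<le> n \<longrightarrow>
    (\<Sum>Y \<in> carrier (residue_ring (3 ^ n)).
       \<bar>pmf (syrac_pmf n) Y
         - 3 powi (int m - int n)
           * (\<Sum>Y' | Y' \<in> carrier (residue_ring (3 ^ n)) \<and> [Y' = Y] (mod 3 ^ m). pmf (syrac_pmf n) Y')\<bar>)
      \<le> C * real m powr (- A)"
proof -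
  define B where "B = nat \<lceil>A\<rceil>"
  have B: "A \<le> real B" by (simp add: B_def real_nat_ceiling_ge)
  obtain C where C: "0 \<le> C" "\<forall>m\<ge>1. \<forall>n\<ge>m. oscillation m n \<le> C / real m ^ B"
    using oscillation_decay[of B] by blast
  have carrier: "carrier (residue_ring (3 ^ n)) = {0..<3 ^ n}" for n
    by (auto simp: residue_ring_def)
  show ?thesis
  proof (intro exI[of _ C] allI impI)
    fix m n :: nat assume "1 \<le> m \<and> m \<le> n"
    then have m: "1 \<le> m" "m \<le> n" by auto
    have "3 powi (int m - int n) = 1 / (3 :: real) ^ (n - m)"
      using m(2) by (simp add: power_int_diff power_diff)
    then have "(\<Sum>Y \<in> carrier (residue_ring (3 ^ n)).
       \<bar>pmf (syrac_pmf n) Y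
         - 3 powi (int m - int n)
           * (\<Sum>Y' | Y' \<in> carrier (residue_ring (3 ^ n)) \<and> [Y' = Y] (mod 3 ^ m). pmf (syrac_pmf n) Y')\<bar>)
      = oscillation m n"
      unfolding carrier oscillation_def sum_pmf_residue_class[OF m]
      by (intro sum.cong refl) (simp add: residue_prob_def)
    also have "\<dots> \<le> C / real m ^ B" using C(2) m by blast
    also have "\<dots> = C * real m powr (- real B)" using m by (simp add: powr_minus powr_realpow divide_inverse)
    also have "\<dots> \<le> C * real m powr (- A)"
      using B m C(1) by (intro mult_left_mono powr_mono) auto
    finally show "(\<Sum>Y \<in> carrier (residue_ring (3 ^ n)).
       \<bar>pmf (syrac_pmf n) Y
         - 3 powi (int m - int n)
           * (\<Sum>Y' | Y' \<in> carrier (residue_ring (3 ^ n)) \<and> [Y' = Y] (mod 3 ^ m). pmf (syrac_pmf n) Y')\<bar>)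
      \<le> C * real m powr (- A)" .
  qed
qed

end
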